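(* Let $m\ge 1$, $N=1+m$, $\lambda\ge 1$, $\nu>1$, $Q=(m+1)+\lambda m$, let $\Omega\subset\mathbb{R}^{N}$ be a $\Lambda$-connected bounded open set, and let $f\in L^r(\Omega)$, $r\ge 1$, be a nonnegative function which is not identically zero. Let $u$ be the weak solution of $$-\Delta_\lambda u=\frac{f}{u^\nu}\ \text{ in }\Omega,\qquad u>0\ \text{ in }\Omega,\qquad u=0\ \text{ on }\partial\Omega$$ obtained as the a.e. pointwise limit $u=\lim_{n\to\infty}u_n$ of the solutions $u_n$ of the approximating problems described in the context. Then: (i) if $r>\frac{Q}{2}$, then $u\in L^\infty(\Omega)$; (ii) if $1\le r<\frac{Q}{2}$, then $u\in L^s(\Omega)$ with $s=\frac{Qr(\nu+1)}{Q-2r}$.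
   Context: Points of $\mathbb{R}^N=\mathbb{R}^{1+m}$ are written $X=(x,y)$ with $x\in\mathbb{R}$, $y\in\mathbb{R}^m$. The Grushin operator is $\Delta_\lambda u=u_{xx}+|x|^{2\lambda}\Delta_y u=\operatorname{div}(A\nabla u)$, where $A(X)=\operatorname{diag}(1,|x|^{2\lambda}I_m)$. An open set $\Omega$ is $\Lambda$-connected if any two points of $\Omega$ can be joined by a continuous curve lying in $\Omega$ which is piecewise an integral curve of the vector fields $\pm\partial_x,\pm|x|^\lambda\partial_{y_1},\dots,\pm|x|^\lambda\partial_{y_m}$. $\Omega'\Subset\Omega$ means that $\overline{\Omega'}$ is a compact subset of $\Omega$. $C^1_0(\Omega)$ is the space of $C^1$ functions with compact support in $\Omega$. Function spaces: let $V_A(\Omega)$ be the set of $u\in C^1(\Omega)$ with $\|u\|^2:=\int_\Omega|u|^2dX+\int_\Omega\langle A\nabla u,\nabla u\rangle dX<\infty$. $H^{1,\lambda}(\Omega)$ is the completion of $(V_A(\Omega),\|\cdot\|)$, and $H^{1,\lambda}_0(\Omega)$ is the completion of $C^1_0(\Omega)$ under $\|u\|_0:=(\int_\Omega\langle A\nabla u,\nabla u\rangle dX)^{1/2}$ (equivalent to $\|\cdot\|$ on $C^1_0(\Omega)$ by a Poincaré inequality). An element represented by a Cauchy sequence $\{u_n\}$ is identified with $u=\lim u_n$ in $L^2(\Omega)$; setting $U=\lim\sqrt{A}\nabla u_n$ in $L^2(\Omega)^N$ (which is uniquely determined by $u$), the weak quasi-gradient is $\nabla^*u:=(\sqrt{A})^{-1}U$,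 defined a.e. in $\Omega$. $u\in H^{1,\lambda}_{loc}(\Omega)$ means $u\in H^{1,\lambda}(\Omega')$ for every open $\Omega'\Subset\Omega$. Weak solution (for $\nu>1$): $u\in H^{1,\lambda}_{loc}(\Omega)$ with $u^{\frac{\nu+1}{2}}\in H^{1,\lambda}_0(\Omega)$, such that for every $\Omega'\Subset\Omega$ there is $C(\Omega')>0$ with $u\ge C(\Omega')$ a.e. in $\Omega'$, and $\int_\Omega\langle A\nabla^*u,\nabla v\rangle dX=\int_\Omega\frac{fv}{u^\nu}dX$ for all $v\in C^1_0(\Omega)$. Approximating problems: for $n\in\mathbb{N}$ let $f_n=\min\{f,n\}$, and let $u_n\in H^{1,\lambda}_0(\Omega)\cap L^\infty(\Omega)$ be the unique nonnegative function with $\int_\Omega\langle A\nabla^*u_n,\nabla v\rangle dX=\int_\Omega\frac{f_nv}{(u_n+\frac1n)^\nu}dX$ for all $v\in C^1_0(\Omega)$. The sequence $\{u_n\}$ is a.e. increasing in $n$, and its pointwise limit $u$ is a weak solution, that is: $u\in H^{1,\lambda}_{loc}(\Omega)$, $u^{\frac{\nu+1}{2}}\in H^{1,\lambda}_0(\Omega)$, $u$ is bounded below by a positive constant a.e. in each $\Omega'\Subset\Omega$, and $\int_\Omega\langle A\nabla^*u,\nabla v\rangle dX=\int_\Omega\frac{fv}{u^\nu}dX$ for all $v\in C^1_0(\Omega)$. *)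

theory Defs
  imports "HOL-Analysis.Analysis"
begin

(* A point X = (x, y) of R^(1+m) is an element of real * (real^'m), with m = CARD('m).
   Functions are total; only their values on the open set Omega matter, and elements of the
   function spaces are represented by arbitrary members of their a.e. class. *)

type_synonym 'm point = "real \<times> (real ^ 'm)"

definition grushin_A :: "real \<Rightarrow> 'm::finite point \<Rightarrow> 'm point \<Rightarrow> 'm point" where
  "grushin_A lam X V = (fst V, (\<bar>fst X\<bar> powr (2 * lam)) *\<^sub>R snd V)"

definition grushin_sqrtA :: "real \<Rightarrow> 'm::finite point \<Rightarrow> 'm point \<Rightarrow> 'm point" where
  "grushin_sqrtA lam X V = (fst V, (\<bar>fst X\<bar> powr lam) *\<^sub>R snd V)"

(* The inverse of sqrt A; meaningful only off the null set x = 0. *)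
definition grushin_sqrtA_inv :: "real \<Rightarrow> 'm::finite point \<Rightarrow> 'm point \<Rightarrow> 'm point" where
  "grushin_sqrtA_inv lam X V = (fst V, (\<bar>fst X\<bar> powr (- lam)) *\<^sub>R snd V)"

lemma grushin_sqrtA_square: "grushin_sqrtA lam X (grushin_sqrtA lam X V) = grushin_A lam X V"
  by (simp add: grushin_A_def grushin_sqrtA_def flip: powr_add)

lemma grushin_sqrtA_inverse:
  assumes "fst X \<noteq> 0"
  shows "grushin_sqrtA lam X (grushin_sqrtA_inv lam X V) = V"
    and "grushin_sqrtA_inv lam X (grushin_sqrtA lam X V) = V"
  using assms by (simp_all add: grushin_sqrtA_def grushin_sqrtA_inv_def flip: powr_add)

definition grushin_fields :: "real \<Rightarrow> ('m::finite point \<Rightarrow> 'm point) set" where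
  "grushin_fields lam =
     {(\<lambda>X. (\<sigma>, 0)) | \<sigma>. \<sigma> \<in> {1, -1}} \<union>
     {(\<lambda>X. (0, (\<sigma> * \<bar>fst X\<bar> powr lam) *\<^sub>R axis i 1)) | \<sigma> i. \<sigma> \<in> {1, -1}}"

definition integral_curve_on ::
  "('a::real_normed_vector \<Rightarrow> 'a) \<Rightarrow> (real \<Rightarrow> 'a) \<Rightarrow> real set \<Rightarrow> bool" where
  "integral_curve_on V \<gamma> I \<longleftrightarrow> (\<forall>s\<in>I. (\<gamma> has_vector_derivative V (\<gamma> s)) (at s within I))"

(* The curve is parametrised over [t 0, t k], with breakpoints t 0 < ... < t k. *)
definition Lambda_connected :: "real \<Rightarrow> 'm::finite point set \<Rightarrow> bool" where
  "Lambda_connected lam \<Omega> \<longleftrightarrow>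
     (\<forall>P\<in>\<Omega>. \<forall>R\<in>\<Omega>. \<exists>(k::nat) (t :: nat \<Rightarrow> real) \<gamma>.
        (\<forall>i<k. t i < t (Suc i)) \<and>
        continuous_on {t 0..t k} \<gamma> \<and> \<gamma> (t 0) = P \<and> \<gamma> (t k) = R \<and>
        \<gamma> ` {t 0..t k} \<subseteq> \<Omega> \<and>
        (\<forall>i<k. \<exists>V\<in>grushin_fields lam. integral_curve_on V \<gamma> {t i..t (Suc i)}))"

definition compactly_inside :: "'a::topological_space set \<Rightarrow> 'a set \<Rightarrow> bool"
    (infix "\<Subset>" 50) where
  "\<Omega>' \<Subset> \<Omega> \<longleftrightarrow> compact (closure \<Omega>') \<and> closure \<Omega>' \<subseteq> \<Omega>"

definition Lp :: "real \<Rightarrow> 'a::euclidean_space set \<Rightarrow> ('a \<Rightarrow> 'b::euclidean_space) set" where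
  "Lp p \<Omega> = {u. u \<in> borel_measurable (lebesgue_on \<Omega>) \<and>
                integrable (lebesgue_on \<Omega>) (\<lambda>X. norm (u X) powr p)}"

definition Linfty :: "'a::euclidean_space set \<Rightarrow> ('a \<Rightarrow> 'b::euclidean_space) set" where
  "Linfty \<Omega> = {u. u \<in> borel_measurable (lebesgue_on \<Omega>) \<and>
                 (\<exists>C. AE X in lebesgue_on \<Omega>. norm (u X) \<le> C)}"

definition L2_limit ::
  "'a::euclidean_space set \<Rightarrow> (nat \<Rightarrow> 'a \<Rightarrow> 'b::euclidean_space) \<Rightarrow> ('a \<Rightarrow> 'b) \<Rightarrow> bool" where
  "L2_limit \<Omega> \<phi> u \<longleftrightarrow> (\<forall>n. \<phi> n \<in> Lp 2 \<Omega>) \<and> u \<in> Lp 2 \<Omega> \<and>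
     (\<lambda>n. \<integral>X. (norm (\<phi> n X - u X))\<^sup>2 \<partial>lebesgue_on \<Omega>) \<longlonglongrightarrow> 0"

definition grad :: "('a::euclidean_space \<Rightarrow> real) \<Rightarrow> 'a \<Rightarrow> 'a" where
  "grad u X = (THE D. GDERIV u X :> D)"

definition C1 :: "'a::euclidean_space set \<Rightarrow> ('a \<Rightarrow> real) set" where
  "C1 \<Omega> = {u. (\<forall>X\<in>\<Omega>. u differentiable (at X)) \<and> continuous_on \<Omega> (grad u)}"

definition C1_0 :: "'a::euclidean_space set \<Rightarrow> ('a \<Rightarrow> real) set" where
  "C1_0 \<Omega> = {u \<in> C1 \<Omega>. support_on \<Omega> u \<Subset> \<Omega>}"

definition energy :: "real \<Rightarrow> 'm::finite point set \<Rightarrow> ('m point \<Rightarrow> real) \<Rightarrow> real" where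
  "energy lam \<Omega> u = (\<integral>X. grushin_A lam X (grad u X) \<bullet> grad u X \<partial>lebesgue_on \<Omega>)"

definition V_A :: "real \<Rightarrow> 'm::finite point set \<Rightarrow> ('m point \<Rightarrow> real) set" where
  "V_A lam \<Omega> = {u \<in> C1 \<Omega>. integrable (lebesgue_on \<Omega>) (\<lambda>X. (u X)\<^sup>2) \<and>
     integrable (lebesgue_on \<Omega>) (\<lambda>X. grushin_A lam X (grad u X) \<bullet> grad u X)}"

definition normA :: "real \<Rightarrow> 'm::finite point set \<Rightarrow> ('m point \<Rightarrow> real) \<Rightarrow> real" where
  "normA lam \<Omega> u = sqrt ((\<integral>X. (u X)\<^sup>2 \<partial>lebesgue_on \<Omega>) + energy lam \<Omega> u)"

definition normA0 :: "real \<Rightarrow> 'm::finite point set \<Rightarrow> ('m point \<Rightarrow> real) \<Rightarrow> real" where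
  "normA0 lam \<Omega> u = sqrt (energy lam \<Omega> u)"

(* phi is a sequence in S, Cauchy for the norm nrm, and u is the L2 function with which the
   class of phi in the completion of (S, nrm) is identified. *)
definition represents :: "('a::euclidean_space \<Rightarrow> real) set \<Rightarrow> (('a \<Rightarrow> real) \<Rightarrow> real) \<Rightarrow>
    'a set \<Rightarrow> (nat \<Rightarrow> 'a \<Rightarrow> real) \<Rightarrow> ('a \<Rightarrow> real) \<Rightarrow> bool" where
  "represents S nrm \<Omega> \<phi> u \<longleftrightarrow>
     (\<forall>n. \<phi> n \<in> S) \<and>
     (\<forall>e>0. \<exists>M. \<forall>i\<ge>M. \<forall>j\<ge>M. nrm (\<lambda>X. \<phi> i X - \<phi> j X) < e) \<and>
     L2_limit \<Omega> \<phi> u"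

definition H1 :: "real \<Rightarrow> 'm::finite point set \<Rightarrow> ('m point \<Rightarrow> real) set" where
  "H1 lam \<Omega> = {u. \<exists>\<phi>. represents (V_A lam \<Omega>) (normA lam \<Omega>) \<Omega> \<phi> u}"

definition H1_0 :: "real \<Rightarrow> 'm::finite point set \<Rightarrow> ('m point \<Rightarrow> real) set" where
  "H1_0 lam \<Omega> = {u. \<exists>\<phi>. represents (C1_0 \<Omega>) (normA0 lam \<Omega>) \<Omega> \<phi> u}"

definition H1_loc :: "real \<Rightarrow> 'm::finite point set \<Rightarrow> ('m point \<Rightarrow> real) set" where
  "H1_loc lam \<Omega> = {u. \<forall>\<Omega>'. open \<Omega>' \<and> \<Omega>' \<Subset> \<Omega> \<longrightarrow> u \<in> H1 lam \<Omega>'}"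

(* G is (a version of) the weak quasi-gradient attached to the representing sequence phi. *)
definition quasi_gradient_along :: "real \<Rightarrow> 'm::finite point set \<Rightarrow>
    (nat \<Rightarrow> 'm point \<Rightarrow> real) \<Rightarrow> ('m point \<Rightarrow> 'm point) \<Rightarrow> bool" where
  "quasi_gradient_along lam \<Omega> \<phi> G \<longleftrightarrow>
     (\<exists>U. L2_limit \<Omega> (\<lambda>n X. grushin_sqrtA lam X (grad (\<phi> n) X)) U \<and>
          (AE X in lebesgue_on \<Omega>. G X = grushin_sqrtA_inv lam X (U X)))"

(* The weak quasi-gradient is determined a.e. by u, so it is rendered as a relation between
   u and the versions G of its quasi-gradient, one relation for each of the three spaces. *)
definition quasi_gradient_H1 :: "real \<Rightarrow> 'm::finite point set \<Rightarrow>
    ('m point \<Rightarrow> real) \<Rightarrow> ('m point \<Rightarrow> 'm point) \<Rightarrow> bool" where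
  "quasi_gradient_H1 lam \<Omega> u G \<longleftrightarrow>
     (\<exists>\<phi>. represents (V_A lam \<Omega>) (normA lam \<Omega>) \<Omega> \<phi> u \<and> quasi_gradient_along lam \<Omega> \<phi> G)"

definition quasi_gradient_H1_0 :: "real \<Rightarrow> 'm::finite point set \<Rightarrow>
    ('m point \<Rightarrow> real) \<Rightarrow> ('m point \<Rightarrow> 'm point) \<Rightarrow> bool" where
  "quasi_gradient_H1_0 lam \<Omega> u G \<longleftrightarrow>
     (\<exists>\<phi>. represents (C1_0 \<Omega>) (normA0 lam \<Omega>) \<Omega> \<phi> u \<and> quasi_gradient_along lam \<Omega> \<phi> G)"

definition quasi_gradient_loc :: "real \<Rightarrow> 'm::finite point set \<Rightarrow>
    ('m point \<Rightarrow> real) \<Rightarrow> ('m point \<Rightarrow> 'm point) \<Rightarrow> bool" where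
  "quasi_gradient_loc lam \<Omega> u G \<longleftrightarrow>
     (\<forall>\<Omega>'. open \<Omega>' \<and> \<Omega>' \<Subset> \<Omega> \<longrightarrow> quasi_gradient_H1 lam \<Omega>' u G)"

definition weak_equation :: "real \<Rightarrow> 'm::finite point set \<Rightarrow>
    ('m point \<Rightarrow> 'm point) \<Rightarrow> ('m point \<Rightarrow> real) \<Rightarrow> bool" where
  "weak_equation lam \<Omega> G h \<longleftrightarrow>
     (\<forall>v\<in>C1_0 \<Omega>. (\<integral>X. grushin_A lam X (G X) \<bullet> grad v X \<partial>lebesgue_on \<Omega>)
                 = (\<integral>X. h X * v X \<partial>lebesgue_on \<Omega>))"

definition weak_solution :: "real \<Rightarrow> real \<Rightarrow> 'm::finite point set \<Rightarrow>
    ('m point \<Rightarrow> real) \<Rightarrow> ('m point \<Rightarrow> real) \<Rightarrow> bool" where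
  "weak_solution lam \<nu> \<Omega> f u \<longleftrightarrow>
     u \<in> H1_loc lam \<Omega> \<and>
     (\<lambda>X. u X powr ((\<nu> + 1) / 2)) \<in> H1_0 lam \<Omega> \<and>
     (\<forall>\<Omega>'. \<Omega>' \<Subset> \<Omega> \<longrightarrow> (\<exists>C>0. AE X in lebesgue. X \<in> \<Omega>' \<longrightarrow> C \<le> u X)) \<and>
     (\<exists>G. quasi_gradient_loc lam \<Omega> u G \<and>
          weak_equation lam \<Omega> G (\<lambda>X. f X / u X powr \<nu>))"

definition approx_solution :: "real \<Rightarrow> real \<Rightarrow> 'm::finite point set \<Rightarrow>
    ('m point \<Rightarrow> real) \<Rightarrow> nat \<Rightarrow> ('m point \<Rightarrow> real) \<Rightarrow> bool" where
  "approx_solution lam \<nu> \<Omega> f n w \<longleftrightarrow>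
     w \<in> H1_0 lam \<Omega> \<inter> Linfty \<Omega> \<and>
     (AE X in lebesgue_on \<Omega>. 0 \<le> w X) \<and>
     (\<exists>G. quasi_gradient_H1_0 lam \<Omega> w G \<and>
          weak_equation lam \<Omega> G (\<lambda>X. min (f X) (real n) / (w X + 1 / real n) powr \<nu>))"

end

theory Submission
  imports Defs
begin

text \<open>
  The Sobolev inequality with the sharp exponent \<open>q = 2Q/(Q - 2)\<close> comes from averaging. From a point
  of \<open>{w = 1}\<close> one first moves horizontally, away from \<open>x = 0\<close>, by some \<open>s \<in> [r, 2r]\<close>, and then
  vertically inside a cube of side \<open>r \<bar>x'\<bar> powr lam\<close>. If \<open>r powr Q\<close> is twice the measure of
  \<open>{w \<noteq> 0}\<close>, half of the end points lie outside \<open>{w \<noteq> 0}\<close>, while the mean square increment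
  of \<open>w\<close> is at most a constant times \<open>r\<^sup>2\<close> times the energy; hence
  \<open>\<bar>{w = 1}\<bar> \<le> C \<bar>{w \<noteq> 0}\<bar> powr (2/Q) * energy\<close>. Applied to truncations of a function between
  consecutive dyadic levels and summed (Maz'ya's truncation method) this is the Sobolev inequality.

  For the equation, let \<open>\<phi> k\<close> be test functions converging to the approximate solution \<open>w\<close> in
  energy. Testing with \<open>\<Phi>(\<phi> k)\<close> and applying the Sobolev inequality to \<open>\<Psi>(\<phi> k)\<close>, where
  \<open>\<Phi>' = \<Psi>'\<^sup>2\<close>, gives in the limit \<open>(\<integral> \<Psi>(w) powr q) powr (2/q) \<le> C \<integral> h \<Phi>(w)\<close> without any
  calculus in the completed space. For \<open>\<Psi>(t) = (max 0 (t - k)) powr \<gamma>\<close> the right-hand side is at most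
  \<open>C \<integral> f (max 0 (w - k)) powr (2\<gamma> - 1 - \<nu>)\<close>. If \<open>r < Q/2\<close>, take \<open>k = 0\<close>, choose \<open>\<gamma>\<close> so that Holder's
  inequality reproduces \<open>\<integral> w powr s\<close> on the right with a smaller power, and absorb. If \<open>r > Q/2\<close>, take
  \<open>\<gamma> = (\<nu> + 1)/2\<close>, for which the exponent \<open>2\<gamma> - 1 - \<nu>\<close> vanishes, and iterate over the levels \<open>k\<close>
  as Stampacchia does. All bounds are independent of \<open>n\<close> and pass to the limit.
\<close>

section \<open>Gradients and translations\<close>

lemma differentiable_imp_GDERIV:
  fixes u :: "'a::euclidean_space \<Rightarrow> real"
  assumes "u differentiable (at X)"
  shows "GDERIV u X :> adjoint (frechet_derivative u (at X)) 1"
proof -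
  have d: "(u has_derivative frechet_derivative u (at X)) (at X)"
    using assms by (simp add: frechet_derivative_works)
  then have "linear (frechet_derivative u (at X))"
    by (rule has_derivative_linear)
  then have "h \<bullet> adjoint (frechet_derivative u (at X)) 1 = frechet_derivative u (at X) h" for h
    by (subst adjoint_works) auto
  then show ?thesis
    using d by (simp add: gderiv_def)
qed

text \<open>\<open>grad\<close> is a definite description, so nothing can be said about it before
  uniqueness. Both candidates represent the same linear functional, which is evaluated at their
  difference.\<close>

lemma GDERIV_unique:
  fixes u :: "'a::euclidean_space \<Rightarrow> real"
  assumes "GDERIV u X :> D" "GDERIV u X :> E"
  shows "D = E"
proof -
  have "(\<lambda>h. h \<bullet> D) = (\<lambda>h. h \<bullet> E)"
    using assms unfolding gderiv_def by (rule has_derivative_unique)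
  then have "(D - E) \<bullet> D = (D - E) \<bullet> E"
    by metis
  then have "(D - E) \<bullet> (D - E) = 0"
    by (simp add: inner_diff_right)
  then show ?thesis by simp
qed

lemma grad_eq: "GDERIV u X :> D \<Longrightarrow> grad u X = D"
  unfolding grad_def by (blast intro: GDERIV_unique)

lemma GDERIV_grad:
  "u differentiable (at X) \<Longrightarrow> GDERIV u X :> grad u X"
  using differentiable_imp_GDERIV grad_eq by metis

lemma GDERIV_imp_differentiable: "GDERIV u X :> D \<Longrightarrow> u differentiable (at X)"
  unfolding gderiv_def differentiable_def by blast

lemma GDERIV_imp_continuous_on:
  assumes "\<And>X. GDERIV u X :> D X"
  shows "continuous_on UNIV u"
  using assms by (meson GDERIV_imp_differentiable continuous_at_imp_continuous_on
      differentiable_imp_continuous_within)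

lemma C1I:
  assumes "\<And>X. X \<in> S \<Longrightarrow> GDERIV u X :> D X" "continuous_on S D"
  shows "u \<in> C1 S"
proof -
  have "continuous_on S (grad u)"
    using assms(2) by (rule continuous_on_eq) (simp add: grad_eq[OF assms(1)])
  then show ?thesis
    using assms(1) by (auto simp: C1_def intro: GDERIV_imp_differentiable)
qed

lemma C1_GDERIV: "u \<in> C1 S \<Longrightarrow> X \<in> S \<Longrightarrow> GDERIV u X :> grad u X"
  by (simp add: C1_def GDERIV_grad)

text \<open>This is the Cauchy-Schwarz inequality on the unit interval, obtained by expanding the
  nonnegative integral of \<open>(g' t - c)\<^sup>2\<close>, where \<open>c\<close> is the increment
  and hence the mean of \<open>g'\<close>.\<close>

lemma square_increment_le_integral:
  fixes g :: "real \<Rightarrow> real"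
  assumes d: "\<And>t. t \<in> {0..1} \<Longrightarrow> (g has_real_derivative g' t) (at t within {0..1})"
    and c: "continuous_on {0..1} g'"
  shows "ennreal ((g 1 - g 0)\<^sup>2) \<le> (\<integral>\<^sup>+t. ennreal ((g' t)\<^sup>2) * indicator {0..1} t \<partial>lborel)"
proof -
  define c where "c = g 1 - g 0"
  have i1: "(g' has_integral c) {0..1}"
    unfolding c_def
    by (rule fundamental_theorem_of_calculus)
       (auto intro: d simp flip: has_real_derivative_iff_has_vector_derivative)
  have "(\<lambda>t. (g' t)\<^sup>2) integrable_on {0..1}"
    by (intro integrable_continuous_real continuous_intros c(1) assms)
  then have i2: "((\<lambda>t. (g' t)\<^sup>2) has_integral integral {0..1} (\<lambda>t. (g' t)\<^sup>2)) {0..1}"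
    by (rule integrable_integral)
  have "((\<lambda>t. (g' t)\<^sup>2 - 2 * c * g' t + c\<^sup>2) has_integral
      (integral {0..1} (\<lambda>t. (g' t)\<^sup>2) - 2 * c * c + c\<^sup>2)) {0..1}"
    using has_integral_const_real[of "c\<^sup>2" 0 1]
    by (intro has_integral_add has_integral_diff i2 has_integral_mult_right i1) simp
  then have "0 \<le> integral {0..1} (\<lambda>t. (g' t)\<^sup>2) - 2 * c * c + c\<^sup>2"
    by (rule has_integral_nonneg) (use zero_le_power2[of "g' _ - c"] in \<open>simp add: power2_diff algebra_simps\<close>)
  then have "c\<^sup>2 \<le> integral {0..1} (\<lambda>t. (g' t)\<^sup>2)"
    by (simp add: power2_eq_square)
  moreover have "(\<integral>\<^sup>+t. ennreal ((g' t)\<^sup>2) * indicator {0..1} t \<partial>lborel)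
      = ennreal (integral {0..1} (\<lambda>t. (g' t)\<^sup>2))"
  proof -
    have "(\<integral>\<^sup>+t. ennreal (indicator {0..1} t *\<^sub>R (g' t)\<^sup>2) \<partial>lborel)
      = ennreal (integral\<^sup>L lborel (\<lambda>t. indicator {0..1} t *\<^sub>R (g' t)\<^sup>2))"
      using borel_integrable_atLeastAtMost'[of 0 1 "\<lambda>t. (g' t)\<^sup>2"] assms
      by (intro nn_integral_eq_integral) (auto simp: set_integrable_def intro!: continuous_intros)
    moreover have "integral\<^sup>L lborel (\<lambda>t. indicator {0..1} t *\<^sub>R (g' t)\<^sup>2) = integral {0..1} (\<lambda>t. (g' t)\<^sup>2)"
      using set_borel_integral_eq_integral(2)[OF borel_integrable_atLeastAtMost'[of 0 1 "\<lambda>t. (g' t)\<^sup>2"]] assms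
      by (auto simp: set_lebesgue_integral_def intro!: continuous_intros)
    moreover have "ennreal (indicator {0..1} t *\<^sub>R (g' t)\<^sup>2) = ennreal ((g' t)\<^sup>2) * indicator {0..1} t" for t :: real
      by (auto simp: indicator_def)
    ultimately show ?thesis by simp
  qed
  ultimately show ?thesis
    unfolding c_def by (simp add: ennreal_leI)
qed

section \<open>Translations, scalings and mean square increments\<close>

lemma nn_integral_lborel_translate:
  fixes c :: "'a::euclidean_space"
  assumes [measurable]: "f \<in> borel_measurable borel"
  shows "(\<integral>\<^sup>+x. f (x + c) \<partial>lborel) = (\<integral>\<^sup>+x. f x \<partial>lborel)"
proof -
  have "(\<integral>\<^sup>+x. f x \<partial>lborel) = (\<integral>\<^sup>+x. f x \<partial>distr lborel borel ((+) c))"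
    by (simp add: lborel_distr_plus)
  also have "\<dots> = (\<integral>\<^sup>+x. f (x + c) \<partial>lborel)"
    by (subst nn_integral_distr) (auto simp: add.commute)
  finally show ?thesis by simp
qed

lemma nn_integral_lborel_scale:
  fixes t :: "'a::euclidean_space"
  assumes [measurable]: "f \<in> borel_measurable borel" and "c > 0"
  shows "(\<integral>\<^sup>+x. f x \<partial>lborel) = ennreal (c ^ DIM('a)) * (\<integral>\<^sup>+x. f (t + c *\<^sub>R x) \<partial>lborel)"
  using assms(2)
  by (subst lborel_affine[of c t])
     (auto simp: nn_integral_density nn_integral_distr nn_integral_cmult ennreal_power)

text \<open>Bound the increment along each segment by the one-dimensional estimate and exchange the
  integrals. For fixed \<open>t\<close> the shift by \<open>t *\<^sub>R h\<close> disappears by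
  translation invariance, so the integral over \<open>t\<close> is that of a constant. Both sides
  may be infinite.\<close>

lemma translation_square_bound:
  fixes g :: "'a::euclidean_space \<Rightarrow> real"
  assumes g: "\<And>y. GDERIV g y :> D y" and D: "continuous_on UNIV D"
  shows "(\<integral>\<^sup>+y. ennreal ((g (y + h) - g y)\<^sup>2) \<partial>lborel) \<le> (\<integral>\<^sup>+y. ennreal ((h \<bullet> D y)\<^sup>2) \<partial>lborel)"
proof -
  have [measurable]: "D \<in> borel_measurable borel"
    using D by (rule borel_measurable_continuous_onI)
  have "ennreal ((g (y + h) - g y)\<^sup>2)
      \<le> (\<integral>\<^sup>+t. ennreal ((h \<bullet> D (y + t *\<^sub>R h))\<^sup>2) * indicator {0..1} t \<partial>lborel)" for y
  proof -
    have "((\<lambda>t. g (y + t *\<^sub>R h)) has_real_derivative h \<bullet> D (y + t *\<^sub>R h)) (at t within {0..1})" for t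
    proof -
      have "(g has_derivative (\<lambda>v. v \<bullet> D (y + t *\<^sub>R h))) (at (y + t *\<^sub>R h))"
        using g by (simp add: gderiv_def)
      moreover have "((\<lambda>t. y + t *\<^sub>R h) has_derivative (\<lambda>s. s *\<^sub>R h)) (at t within {0..1})"
        by (auto intro!: derivative_eq_intros)
      ultimately have "((\<lambda>t. g (y + t *\<^sub>R h)) has_derivative (\<lambda>s. (s *\<^sub>R h) \<bullet> D (y + t *\<^sub>R h))) (at t within {0..1})"
        using has_derivative_compose by blast
      then show ?thesis
        by (simp add: has_field_derivative_def mult_commute_abs)
    qed
    moreover have "continuous_on {0..1} (\<lambda>t. h \<bullet> D (y + t *\<^sub>R h))"
      by (intro continuous_intros continuous_on_compose2[OF D]) auto
    ultimately show ?thesis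
      using square_increment_le_integral[of "\<lambda>t. g (y + t *\<^sub>R h)" "\<lambda>t. h \<bullet> D (y + t *\<^sub>R h)"] by simp
  qed
  then have "(\<integral>\<^sup>+y. ennreal ((g (y + h) - g y)\<^sup>2) \<partial>lborel)
      \<le> (\<integral>\<^sup>+y. (\<integral>\<^sup>+t. ennreal ((h \<bullet> D (y + t *\<^sub>R h))\<^sup>2) * indicator {0..1} t \<partial>lborel) \<partial>lborel)"
    by (rule nn_integral_mono)
  also have "\<dots> = (\<integral>\<^sup>+t. (\<integral>\<^sup>+y. ennreal ((h \<bullet> D (y + t *\<^sub>R h))\<^sup>2) * indicator {0..1} t \<partial>lborel) \<partial>(lborel :: real measure))"
    by (rule lborel_pair.Fubini') measurable
  also have "\<dots> = (\<integral>\<^sup>+t. (\<integral>\<^sup>+y. ennreal ((h \<bullet> D y)\<^sup>2) \<partial>lborel) * indicator {0..1} t \<partial>(lborel :: real measure))"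
    by (simp add: nn_integral_multc nn_integral_lborel_translate[of "\<lambda>y. ennreal ((h \<bullet> D y)\<^sup>2)"])
  also have "\<dots> = (\<integral>\<^sup>+y. ennreal ((h \<bullet> D y)\<^sup>2) \<partial>lborel)"
    by (simp add: nn_integral_cmult)
  finally show ?thesis .
qed

section \<open>Level sets and the Grushin energy\<close>

lemma norm_grushin_sqrtA_square:
  "(norm (grushin_sqrtA lam X V))\<^sup>2 = (fst V)\<^sup>2 + (\<bar>fst X\<bar> powr lam)\<^sup>2 * (norm (snd V))\<^sup>2"
  by (simp add: grushin_sqrtA_def norm_Pair power_mult_distrib)

lemma borel_measurable_grushin_sqrtA [measurable]:
  assumes [measurable]: "f \<in> borel_measurable M" "g \<in> borel_measurable M"
  shows "(\<lambda>z. grushin_sqrtA lam (f z) (g z)) \<in> borel_measurable M"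
proof -
  have [measurable]: "(fst :: 'm point \<Rightarrow> real) \<in> borel_measurable borel"
    "(snd :: 'm point \<Rightarrow> real ^ 'm) \<in> borel_measurable borel"
    by (auto intro!: borel_measurable_continuous_onI continuous_intros)
  show ?thesis
    unfolding grushin_sqrtA_def by measurable
qed

section \<open>Averages over Grushin displacements\<close>

lemma emeasure_unit_cube: "emeasure lborel (cbox 0 One :: 'a::euclidean_space set) = 1"
  by (subst emeasure_lborel_cbox) auto

lemma norm_unit_cube_le:
  fixes \<sigma> :: "real ^ 'm"
  assumes "\<sigma> \<in> cbox 0 One"
  shows "(norm \<sigma>)\<^sup>2 \<le> real CARD('m)"
proof -
  have "(\<sigma> $ i)\<^sup>2 \<le> 1" for i
  proof -
    have "axis i 1 \<in> (Basis :: (real ^ 'm) set)" by (simp add: axis_in_Basis_iff)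
    then have "0 \<le> \<sigma> \<bullet> axis i 1" "\<sigma> \<bullet> axis i 1 \<le> 1"
      using assms by (auto simp: mem_box)
    then show ?thesis
      by (simp add: inner_axis power_le_one)
  qed
  then have "(\<Sum>i\<in>UNIV. (\<sigma> $ i)\<^sup>2) \<le> (\<Sum>i\<in>(UNIV :: 'm set). 1)"
    by (intro sum_mono)
  then show ?thesis
    by (simp add: norm_vec_def L2_set_def sum_nonneg)
qed

text \<open>The weight of the vertical step is taken at the abscissa reached by the horizontal one.
  The sign \<open>e\<close> selects the direction away from the degenerate hyperplane, and the
  vertical step is proportional to \<open>r\<close> when measured by the vector fields.\<close>

definition grushin_shift ::
  "real \<Rightarrow> real \<Rightarrow> real \<Rightarrow> 'm::finite point \<Rightarrow> real \<Rightarrow> real ^ 'm \<Rightarrow> 'm point" where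
  "grushin_shift lam r e X s \<sigma> =
     (fst X + e * s, snd X + (r * \<bar>fst X + e * s\<bar> powr lam) *\<^sub>R \<sigma>)"

lemma grushin_shift_measurable [measurable]:
  assumes [measurable]: "f \<in> borel_measurable M" "g \<in> borel_measurable M" "h \<in> borel_measurable M"
  shows "(\<lambda>z. grushin_shift lam r e (f z) (g z) (h z)) \<in> borel_measurable M"
proof -
  have [measurable]: "(fst :: 'm point \<Rightarrow> real) \<in> borel_measurable borel"
    "(snd :: 'm point \<Rightarrow> real ^ 'm) \<in> borel_measurable borel"
    by (auto intro!: borel_measurable_continuous_onI continuous_intros)
  show ?thesis
    unfolding grushin_shift_def by measurable
qed

text \<open>Moving away from the line \<open>x = 0\<close> by at least \<open>r\<close> makes the Jacobian
  \<open>(r \<bar>x'\<bar> powr lam) ^ m\<close> of the shift at least \<open>r powr (m (1 + lam))\<close>; together with the length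
  \<open>r\<close> of the range of \<open>s\<close> this is where the homogeneous dimension \<open>Q\<close> comes from.\<close>

lemma nn_integral_grushin_shift_le:
  fixes X :: "'m::finite point" and lam r e :: real
  assumes [measurable]: "F \<in> sets borel" and "r > 0" "lam \<ge> 0" "\<bar>e\<bar> = 1" "0 \<le> e * fst X"
  shows "(\<integral>\<^sup>+s. \<integral>\<^sup>+\<sigma>. indicator F (grushin_shift lam r e X s \<sigma>) * indicator (cbox 0 One) \<sigma>
            * indicator {r..2*r} s \<partial>lborel \<partial>lborel)
         \<le> ennreal (r powr (- ((1 + lam) * CARD('m)))) * emeasure lborel F"
proof -
  let ?K = "r powr (- ((1 + lam) * CARD('m)))"
  have inner: "(\<integral>\<^sup>+\<sigma>. indicator F (grushin_shift lam r e X s \<sigma>) * indicator (cbox 0 One) \<sigma>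
            * indicator {r..2*r} s \<partial>lborel)
      \<le> ennreal ?K * (\<integral>\<^sup>+y'. indicator F (fst X + e * s, y') \<partial>lborel)" for s
  proof (cases "s \<in> {r..2*r}")
    case s: True
    define c where "c = r * \<bar>fst X + e * s\<bar> powr lam"
    have "r \<le> \<bar>fst X + e * s\<bar>"
      using assms s by (auto simp: abs_if split: if_splits)
    then have "r powr lam \<le> \<bar>fst X + e * s\<bar> powr lam"
      using assms by (intro powr_mono2) auto
    then have "r * r powr lam \<le> c"
      using assms by (simp add: c_def)
    then have c: "r powr (1 + lam) \<le> c"
      using \<open>r > 0\<close> by (simp add: powr_add)
    have "r powr (1 + lam) > 0" using \<open>r > 0\<close> by simp
    then have "c > 0" using c by linarith
    have "(r powr (1 + lam)) ^ CARD('m) \<le> c ^ CARD('m)"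
      using c by (intro power_mono) auto
    moreover have "(r powr (1 + lam)) ^ CARD('m) = r powr ((1 + lam) * CARD('m))"
      using \<open>r > 0\<close> by (simp add: powr_powr flip: powr_realpow)
    ultimately have "?K * r powr ((1 + lam) * CARD('m)) \<le> ?K * c ^ CARD('m)"
      by (intro mult_left_mono) auto
    \<comment> \<open>The substitution \<open>y' = snd X + c *\<^sub>R \<sigma>\<close> consumes the
      Jacobian \<open>c ^ CARD('m)\<close>. A factor that is at least 1 may be inserted to supply
      it, and only \<open>?K\<close> remains.\<close>
    then have c': "1 \<le> ?K * c ^ CARD('m)"
      using \<open>r > 0\<close> by (simp flip: powr_add)
    have "(\<integral>\<^sup>+\<sigma>. indicator F (grushin_shift lam r e X s \<sigma>) * indicator (cbox 0 One) \<sigma>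
            * indicator {r..2*r} s \<partial>lborel)
        \<le> (\<integral>\<^sup>+\<sigma>. indicator F (fst X + e * s, snd X + c *\<^sub>R \<sigma>) \<partial>lborel)"
      by (intro nn_integral_mono) (auto simp: grushin_shift_def c_def indicator_def)
    also have "\<dots> \<le> ennreal (?K * c ^ CARD('m)) * (\<integral>\<^sup>+\<sigma>. indicator F (fst X + e * s, snd X + c *\<^sub>R \<sigma>) \<partial>lborel)"
      using c' by (metis mult_1 mult_right_mono ennreal_1 ennreal_leI zero_le)
    also have "\<dots> = ennreal ?K * (ennreal (c ^ CARD('m)) * (\<integral>\<^sup>+\<sigma>. indicator F (fst X + e * s, snd X + c *\<^sub>R \<sigma>) \<partial>lborel))"
      using \<open>c > 0\<close> by (simp add: ennreal_mult mult.assoc)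
    also have "ennreal (c ^ CARD('m)) * (\<integral>\<^sup>+\<sigma>. indicator F (fst X + e * s, snd X + c *\<^sub>R \<sigma>) \<partial>lborel)
        = (\<integral>\<^sup>+y'. indicator F (fst X + e * s, y') \<partial>lborel)"
      using nn_integral_lborel_scale[of "\<lambda>y'. indicator F (fst X + e * s, y')" c "snd X"] \<open>c > 0\<close>
      by simp
    finally show ?thesis .
  qed auto
  have "(\<integral>\<^sup>+s. \<integral>\<^sup>+\<sigma>. indicator F (grushin_shift lam r e X s \<sigma>) * indicator (cbox 0 One) \<sigma>
            * indicator {r..2*r} s \<partial>lborel \<partial>lborel)
      \<le> (\<integral>\<^sup>+s. ennreal ?K * (\<integral>\<^sup>+y'. indicator F (fst X + e * s, y') \<partial>lborel) \<partial>lborel)"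
    by (intro nn_integral_mono inner)
  also have "\<dots> = ennreal ?K * (\<integral>\<^sup>+s. (\<integral>\<^sup>+y'. indicator F (fst X + e * s, y') \<partial>lborel) \<partial>lborel)"
    by (rule nn_integral_cmult) measurable
  also have "(\<integral>\<^sup>+s. (\<integral>\<^sup>+y'. indicator F (fst X + e * s, y') \<partial>lborel) \<partial>lborel)
      = (\<integral>\<^sup>+s. (\<integral>\<^sup>+y'. indicator F (s, y') \<partial>(lborel :: (real ^ 'm) measure)) \<partial>lborel)"
    using \<open>\<bar>e\<bar> = 1\<close> by (subst nn_integral_real_affine[of _ e "fst X"]) auto
  also have "\<dots> = (\<integral>\<^sup>+z. indicator F z \<partial>(lborel \<Otimes>\<^sub>M lborel))"
    by (rule lborel.nn_integral_fst) (simp add: lborel_prod)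
  also have "\<dots> = emeasure lborel F"
    by (simp add: lborel_prod)
  finally show ?thesis .
qed

text \<open>All displacements together have mass \<open>r\<close>. By the preceding estimate those
  ending in \<open>F\<close> have mass at most \<open>r powr (1 - Q)\<close> times the measure of
  \<open>F\<close>, where \<open>Q = 1 + (1 + lam) * CARD('m)\<close>, and this is at most
  \<open>r / 2\<close>.\<close>

lemma grushin_shift_half_mass:
  fixes X :: "'m::finite point" and lam r e :: real
  assumes F [measurable]: "F \<in> sets borel" and "r > 0" "lam \<ge> 0" "\<bar>e\<bar> = 1" "0 \<le> e * fst X"
    and small: "emeasure lborel F \<le> ennreal (r powr (1 + (1 + lam) * CARD('m)) / 2)"
  shows "ennreal (r / 2) \<le> (\<integral>\<^sup>+s. \<integral>\<^sup>+\<sigma>. indicator (- F) (grushin_shift lam r e X s \<sigma>)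
            * indicator (cbox 0 One) \<sigma> * indicator {r..2*r} s \<partial>lborel \<partial>lborel)"
    (is "_ \<le> ?R")
proof -
  let ?I = "\<lambda>G s \<sigma>. indicator G (grushin_shift lam r e X s \<sigma>) * indicator (cbox 0 One) \<sigma>
            * indicator {r..2*r} s :: ennreal"
  have split: "?I UNIV s \<sigma> = ?I F s \<sigma> + ?I (- F) s \<sigma>" for s \<sigma>
    by (auto simp: indicator_def)
  have "ennreal r = (\<integral>\<^sup>+s. \<integral>\<^sup>+\<sigma>. ?I UNIV s \<sigma> \<partial>lborel \<partial>lborel)"
    using \<open>r > 0\<close> by (simp add: nn_integral_multc emeasure_unit_cube)
  also have "\<dots> = (\<integral>\<^sup>+s. \<integral>\<^sup>+\<sigma>. ?I F s \<sigma> \<partial>lborel \<partial>lborel) + ?R"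
    by (simp only: split) (simp add: nn_integral_add)
  also have "\<dots> \<le> ennreal (r powr (- ((1 + lam) * CARD('m)))) * emeasure lborel F + ?R"
    using assms by (intro add_right_mono nn_integral_grushin_shift_le) auto
  also have "\<dots> \<le> ennreal (r powr (- ((1 + lam) * CARD('m)))) * ennreal (r powr (1 + (1 + lam) * CARD('m)) / 2) + ?R"
    by (intro add_right_mono mult_left_mono small) auto
  also have "\<dots> = ennreal (r / 2) + ?R"
  proof -
    have "r powr (- ((1 + lam) * CARD('m))) * r powr (1 + (1 + lam) * CARD('m)) = r"
      using \<open>r > 0\<close> by (simp flip: powr_add)
    then show ?thesis by (simp flip: ennreal_mult')
  qed
  finally have le: "ennreal r \<le> ennreal (r / 2) + ?R" .
  \<comment> \<open>In the extended reals the finite summand \<open>r / 2\<close> can be cancelled,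
    whereas \<open>?R\<close> could not simply be isolated by subtraction.\<close>
  have "ennreal r = ennreal (r / 2) + ennreal (r / 2)"
    using \<open>r > 0\<close> by (simp flip: ennreal_plus)
  then show ?thesis
    using le by (simp add: ennreal_add_left_cancel_le)
qed

text \<open>From each point of \<open>?E\<close> displacements of mass at least \<open>r / 2\<close>
  end where \<open>w = 0\<close>, so along them \<open>w\<close> drops from 1 to 0. Integrating the
  squared increments over the starting point and over the displacement gives on one side
  \<open>r / 2\<close> times the measure of \<open>?E\<close>, and on the other side, by
  \<open>translation_square_bound\<close>, a multiple of \<open>r ^ 3\<close> times the
  energy.\<close>

lemma level_set_half_bound:
  fixes w :: "'m::finite point \<Rightarrow> real" and lam r e :: real
  assumes w: "\<And>X. GDERIV w X :> D X" and D: "continuous_on UNIV D"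
    and "r > 0" "lam \<ge> 0" "\<bar>e\<bar> = 1"
    and small: "emeasure lborel {X. w X \<noteq> 0} \<le> ennreal (r powr (1 + (1 + lam) * CARD('m)) / 2)"
  shows "emeasure lborel {X. w X = 1 \<and> 0 \<le> e * fst X}
    \<le> ennreal (4 * (4 + real CARD('m)) * r\<^sup>2) * (\<integral>\<^sup>+X. ennreal ((norm (grushin_sqrtA lam X (D X)))\<^sup>2) \<partial>lborel)"
    (is "emeasure lborel ?E \<le> _ * ?En")
proof -
  have cw: "continuous_on UNIV w" using w by (rule GDERIV_imp_continuous_on)
  have [measurable]: "w \<in> borel_measurable borel" "D \<in> borel_measurable borel"
    "(fst :: 'm point \<Rightarrow> real) \<in> borel_measurable borel"
    "(snd :: 'm point \<Rightarrow> real ^ 'm) \<in> borel_measurable borel"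
    by (auto intro!: borel_measurable_continuous_onI cw D continuous_intros)
  define F where "F = {X. w X \<noteq> 0}"
  have [measurable]: "F \<in> sets borel" unfolding F_def by measurable
  have [measurable]: "?E \<in> sets borel" by measurable
  let ?c = "\<lambda>s \<sigma>. indicator (cbox 0 One) (\<sigma> :: real ^ 'm) * indicator {r..2*r} (s :: real) :: ennreal"
  define d1 where "d1 X s = ennreal (2 * (w (X + (e * s, 0)) - w X)\<^sup>2)" for X s
  \<comment> \<open>The vertical increment is a function of the intermediate point. Once that point
    is translated back to \<open>X\<close>, no dependence on \<open>s\<close> is left.\<close>
  define d2 where "d2 X \<sigma> = ennreal (2 * (w (X + (0, (r * \<bar>fst X\<bar> powr lam) *\<^sub>R \<sigma>)) - w X)\<^sup>2)" for X \<sigma>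
  have [measurable]: "(\<lambda>z. d1 (f z) (g z)) \<in> borel_measurable M"
    if [measurable]: "f \<in> borel_measurable M" "g \<in> borel_measurable M" for f g and M :: "'c measure"
    unfolding d1_def by measurable
  have [measurable]: "(\<lambda>z. d2 (f z) (g z)) \<in> borel_measurable M"
    if [measurable]: "f \<in> borel_measurable M" "g \<in> borel_measurable M" for f g and M :: "'c measure"
    unfolding d2_def by measurable
  have point: "indicator ?E X * indicator (- F) (grushin_shift lam r e X s \<sigma>)
      \<le> d1 X s + d2 (X + (e * s, 0)) \<sigma>" for X s \<sigma>
  proof (cases "X \<in> ?E \<and> grushin_shift lam r e X s \<sigma> \<notin> F")
    case True
    let ?Y = "X + (e * s, 0)"
    have Z: "?Y + (0, (r * \<bar>fst ?Y\<bar> powr lam) *\<^sub>R \<sigma>) = grushin_shift lam r e X s \<sigma>"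
      by (cases X) (simp add: grushin_shift_def)
    have "w X = 1" "w (grushin_shift lam r e X s \<sigma>) = 0" using True by (auto simp: F_def)
    then have eq: "d1 X s + d2 ?Y \<sigma> = ennreal (2 * (w ?Y - 1)\<^sup>2 + 2 * (w ?Y)\<^sup>2)"
      unfolding d1_def d2_def Z by (simp flip: ennreal_plus)
    \<comment> \<open>The difference of the two sides is the square of
      \<open>2 * w ?Y - 1\<close>.\<close>
    have "1 \<le> 2 * (w ?Y - 1)\<^sup>2 + 2 * (w ?Y)\<^sup>2"
      using zero_le_power2[of "2 * w ?Y - 1"] by (simp add: power2_eq_square algebra_simps)
    then have "1 \<le> d1 X s + d2 ?Y \<sigma>"
      unfolding eq by (metis ennreal_1 ennreal_leI)
    then show ?thesis using True by (simp add: indicator_def)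
  qed (auto simp: indicator_def)
  have d1: "(\<integral>\<^sup>+X. d1 X s \<partial>lborel) \<le> ennreal (8 * r\<^sup>2) * ?En" if "s \<in> {r..2*r}" for s
  proof -
    have "e\<^sup>2 = 1" using \<open>\<bar>e\<bar> = 1\<close> by (metis power2_abs one_power2)
    have "s\<^sup>2 \<le> (2 * r)\<^sup>2" using that \<open>r > 0\<close> by (intro power_mono) auto
    have "(\<integral>\<^sup>+X. d1 X s \<partial>lborel) = 2 * (\<integral>\<^sup>+X. ennreal ((w (X + (e * s, 0)) - w X)\<^sup>2) \<partial>lborel)"
      by (simp add: d1_def ennreal_mult nn_integral_cmult)
    also have "\<dots> \<le> 2 * (\<integral>\<^sup>+X. ennreal (((e * s, 0) \<bullet> D X)\<^sup>2) \<partial>lborel)"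
      by (intro mult_left_mono translation_square_bound w D) auto
    also have "\<dots> \<le> 2 * (\<integral>\<^sup>+X. ennreal (4 * r\<^sup>2) * ennreal ((norm (grushin_sqrtA lam X (D X)))\<^sup>2) \<partial>lborel)"
    proof (intro mult_left_mono nn_integral_mono)
      fix X
      have "((e * s, 0) \<bullet> D X)\<^sup>2 = s\<^sup>2 * (fst (D X))\<^sup>2"
        using \<open>e\<^sup>2 = 1\<close> by (simp add: inner_prod_def power_mult_distrib)
      also have "\<dots> \<le> (4 * r\<^sup>2) * (norm (grushin_sqrtA lam X (D X)))\<^sup>2"
        using \<open>s\<^sup>2 \<le> (2 * r)\<^sup>2\<close> by (intro mult_mono) (auto simp: norm_grushin_sqrtA_square power_mult_distrib)
      finally show "ennreal (((e * s, 0) \<bullet> D X)\<^sup>2) \<le> ennreal (4 * r\<^sup>2) * ennreal ((norm (grushin_sqrtA lam X (D X)))\<^sup>2)"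
        by (simp add: ennreal_leI flip: ennreal_mult)
    qed auto
    also have "\<dots> = ennreal (8 * r\<^sup>2) * ?En"
      using ennreal_mult[of 2 "4 * r\<^sup>2"] by (simp add: nn_integral_cmult flip: mult.assoc)
    finally show ?thesis .
  qed
  have d2: "(\<integral>\<^sup>+X. d2 X \<sigma> \<partial>lborel) \<le> ennreal (2 * CARD('m) * r\<^sup>2) * ?En" if "\<sigma> \<in> cbox 0 One" for \<sigma>
  proof -
    \<comment> \<open>On a slice of fixed \<open>x\<close> the vertical displacement is a constant
      vector, so the translation estimate applies in \<open>real ^ 'm\<close> although the
      displacement varies with \<open>x\<close>.\<close>
    have sec: "(\<integral>\<^sup>+y. ennreal ((w (x, y + k *\<^sub>R \<sigma>) - w (x, y))\<^sup>2) \<partial>lborel)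
        \<le> (\<integral>\<^sup>+y. ennreal (((k *\<^sub>R \<sigma>) \<bullet> snd (D (x, y)))\<^sup>2) \<partial>lborel)" for x k
    proof (rule translation_square_bound)
      fix y
      have "(w has_derivative (\<lambda>h. h \<bullet> D (x, y))) (at (x, y))"
        using w by (simp add: gderiv_def)
      moreover have "((\<lambda>y. (x, y)) has_derivative (\<lambda>h. (0, h))) (at y)"
        by (auto intro!: derivative_eq_intros)
      ultimately have "((\<lambda>y. w (x, y)) has_derivative (\<lambda>h. (0, h) \<bullet> D (x, y))) (at y)"
        using has_derivative_compose[of "\<lambda>y. (x, y)" _ y UNIV w] by blast
      then show "GDERIV (\<lambda>y. w (x, y)) y :> snd (D (x, y))"
        by (simp add: gderiv_def inner_prod_def)
    next
      show "continuous_on UNIV (\<lambda>y. snd (D (x, y)))"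
        by (intro continuous_intros continuous_on_compose2[OF D]) auto
    qed
    have "(\<integral>\<^sup>+X. d2 X \<sigma> \<partial>lborel) = (\<integral>\<^sup>+x. \<integral>\<^sup>+y. d2 (x, y) \<sigma> \<partial>lborel \<partial>lborel)"
      by (subst lborel.nn_integral_fst) (simp_all add: lborel_prod)
    also have "\<dots> = (\<integral>\<^sup>+x. 2 * (\<integral>\<^sup>+y. ennreal ((w (x, y + (r * \<bar>x\<bar> powr lam) *\<^sub>R \<sigma>) - w (x, y))\<^sup>2) \<partial>lborel) \<partial>lborel)"
      by (simp add: d2_def ennreal_mult nn_integral_cmult)
    also have "\<dots> \<le> (\<integral>\<^sup>+x. 2 * (\<integral>\<^sup>+y. ennreal ((((r * \<bar>x\<bar> powr lam) *\<^sub>R \<sigma>) \<bullet> snd (D (x, y)))\<^sup>2) \<partial>lborel) \<partial>lborel)"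
      by (intro nn_integral_mono mult_left_mono sec) auto
    also have "\<dots> \<le> (\<integral>\<^sup>+x. 2 * (\<integral>\<^sup>+y. ennreal (CARD('m) * r\<^sup>2) * ennreal ((norm (grushin_sqrtA lam (x, y) (D (x, y))))\<^sup>2) \<partial>lborel) \<partial>lborel)"
    proof (intro mult_left_mono nn_integral_mono)
      fix x y
      let ?a = "\<bar>x\<bar> powr lam" and ?v = "snd (D (x, y))"
      have "(((r * ?a) *\<^sub>R \<sigma>) \<bullet> ?v)\<^sup>2 = r\<^sup>2 * ?a\<^sup>2 * (\<sigma> \<bullet> ?v)\<^sup>2"
        by (simp add: power_mult_distrib)
      also have "(\<sigma> \<bullet> ?v)\<^sup>2 \<le> (norm \<sigma> * norm ?v)\<^sup>2"
        using Cauchy_Schwarz_ineq2[of \<sigma> ?v] by (metis abs_ge_zero power2_abs power_mono)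
      also have "(norm \<sigma> * norm ?v)\<^sup>2 \<le> CARD('m) * (norm ?v)\<^sup>2"
        using norm_unit_cube_le[OF that] by (simp add: power_mult_distrib mult_right_mono)
      also have "r\<^sup>2 * ?a\<^sup>2 * (CARD('m) * (norm ?v)\<^sup>2) = CARD('m) * r\<^sup>2 * (?a\<^sup>2 * (norm ?v)\<^sup>2)"
        by simp
      also have "\<dots> \<le> CARD('m) * r\<^sup>2 * (norm (grushin_sqrtA lam (x, y) (D (x, y))))\<^sup>2"
        by (intro mult_left_mono) (auto simp: norm_grushin_sqrtA_square)
      finally have "(((r * ?a) *\<^sub>R \<sigma>) \<bullet> ?v)\<^sup>2 \<le> CARD('m) * r\<^sup>2 * (norm (grushin_sqrtA lam (x, y) (D (x, y))))\<^sup>2"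
        by (auto simp: mult_left_mono)
      then show "ennreal ((((r * ?a) *\<^sub>R \<sigma>) \<bullet> ?v)\<^sup>2)
          \<le> ennreal (CARD('m) * r\<^sup>2) * ennreal ((norm (grushin_sqrtA lam (x, y) (D (x, y))))\<^sup>2)"
        by (simp add: ennreal_leI flip: ennreal_mult)
    qed auto
    also have "\<dots> = ennreal (2 * CARD('m) * r\<^sup>2) * (\<integral>\<^sup>+x. \<integral>\<^sup>+y. ennreal ((norm (grushin_sqrtA lam (x, y) (D (x, y))))\<^sup>2) \<partial>lborel \<partial>lborel)"
      using ennreal_mult[of 2 "CARD('m) * r\<^sup>2"]
      by (simp add: nn_integral_cmult flip: mult.assoc)
    also have "(\<integral>\<^sup>+x. \<integral>\<^sup>+y. ennreal ((norm (grushin_sqrtA lam (x, y) (D (x, y))))\<^sup>2) \<partial>lborel \<partial>lborel) = ?En"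
      by (subst lborel.nn_integral_fst) (simp_all add: lborel_prod)
    finally show ?thesis .
  qed
  have "ennreal (r / 2) * emeasure lborel ?E = (\<integral>\<^sup>+X. ennreal (r / 2) * indicator ?E X \<partial>lborel)"
    by (simp add: nn_integral_cmult)
  also have "\<dots> \<le> (\<integral>\<^sup>+X. \<integral>\<^sup>+s. \<integral>\<^sup>+\<sigma>. (d1 X s + d2 (X + (e * s, 0)) \<sigma>) * ?c s \<sigma> \<partial>lborel \<partial>lborel \<partial>lborel)"
  proof (rule nn_integral_mono)
    fix X :: "'m point"
    show "ennreal (r / 2) * indicator ?E X \<le> (\<integral>\<^sup>+s. \<integral>\<^sup>+\<sigma>. (d1 X s + d2 (X + (e * s, 0)) \<sigma>) * ?c s \<sigma> \<partial>lborel \<partial>lborel)"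
    proof (cases "X \<in> ?E")
      case True
      have "ennreal (r / 2) \<le> (\<integral>\<^sup>+s. \<integral>\<^sup>+\<sigma>. indicator (- F) (grushin_shift lam r e X s \<sigma>)
            * indicator (cbox 0 One) \<sigma> * indicator {r..2*r} s \<partial>lborel \<partial>lborel)"
        using assms True by (intro grushin_shift_half_mass) (auto simp: F_def)
      also have "\<dots> \<le> (\<integral>\<^sup>+s. \<integral>\<^sup>+\<sigma>. (d1 X s + d2 (X + (e * s, 0)) \<sigma>) * ?c s \<sigma> \<partial>lborel \<partial>lborel)"
        unfolding mult.assoc using point[of X] True by (intro nn_integral_mono mult_right_mono) auto
      finally show ?thesis using True by simp
    qed auto
  qed
  \<comment> \<open>The integral over \<open>X\<close> is moved innermost in two exchanges, so that
    for fixed \<open>s\<close> and \<open>\<sigma>\<close> the estimates \<open>d1\<close> and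
    \<open>d2\<close> can be used.\<close>
  also have "\<dots> = (\<integral>\<^sup>+s. \<integral>\<^sup>+X. \<integral>\<^sup>+\<sigma>. (d1 X s + d2 (X + (e * s, 0)) \<sigma>) * ?c s \<sigma> \<partial>lborel \<partial>lborel \<partial>lborel)"
    by (rule lborel_pair.Fubini') measurable
  also have "\<dots> = (\<integral>\<^sup>+s. \<integral>\<^sup>+\<sigma>. \<integral>\<^sup>+X. (d1 X s + d2 (X + (e * s, 0)) \<sigma>) * ?c s \<sigma> \<partial>lborel \<partial>lborel \<partial>lborel)"
    by (intro nn_integral_cong lborel_pair.Fubini') measurable
  also have "\<dots> \<le> (\<integral>\<^sup>+s. \<integral>\<^sup>+\<sigma>. (ennreal (2 * (4 + real CARD('m)) * r\<^sup>2) * ?En) * ?c s \<sigma> \<partial>lborel \<partial>lborel)"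
  proof (intro nn_integral_mono)
    fix s \<sigma>
    show "(\<integral>\<^sup>+X. (d1 X s + d2 (X + (e * s, 0)) \<sigma>) * ?c s \<sigma> \<partial>lborel) \<le> (ennreal (2 * (4 + real CARD('m)) * r\<^sup>2) * ?En) * ?c s \<sigma>"
    proof (cases "s \<in> {r..2*r} \<and> \<sigma> \<in> cbox 0 One")
      case True
      have "(\<integral>\<^sup>+X. d1 X s + d2 (X + (e * s, 0)) \<sigma> \<partial>lborel) = (\<integral>\<^sup>+X. d1 X s \<partial>lborel) + (\<integral>\<^sup>+X. d2 X \<sigma> \<partial>lborel)"
        using nn_integral_lborel_translate[of "\<lambda>X. d2 X \<sigma>" "(e * s, 0)"] by (simp add: nn_integral_add)
      also have "\<dots> \<le> ennreal (8 * r\<^sup>2) * ?En + ennreal (2 * CARD('m) * r\<^sup>2) * ?En"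
        using True by (intro add_mono d1 d2) auto
      also have "\<dots> = ennreal (2 * (4 + real CARD('m)) * r\<^sup>2) * ?En"
        by (simp add: distrib_left distrib_right ennreal_plus)
      finally show ?thesis using True by (simp add: nn_integral_multc)
    qed auto
  qed
  also have "\<dots> = (ennreal (2 * (4 + real CARD('m)) * r\<^sup>2) * ?En) * ennreal r"
    using \<open>r > 0\<close> by (simp add: nn_integral_cmult nn_integral_multc emeasure_unit_cube)
  finally have "ennreal (r / 2) * emeasure lborel ?E \<le> (ennreal (2 * (4 + real CARD('m)) * r\<^sup>2) * ?En) * ennreal r" .
  then have "ennreal (2 / r) * (ennreal (r / 2) * emeasure lborel ?E)
      \<le> ennreal (2 / r) * ((ennreal (2 * (4 + real CARD('m)) * r\<^sup>2) * ?En) * ennreal r)"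
    by (rule mult_left_mono) simp
  moreover have "ennreal (2 / r) * (ennreal (r / 2) * emeasure lborel ?E) = emeasure lborel ?E"
    using \<open>r > 0\<close> by (simp flip: mult.assoc ennreal_mult)
  moreover have "ennreal (2 / r) * ((ennreal (2 * (4 + real CARD('m)) * r\<^sup>2) * ?En) * ennreal r)
      = ennreal (4 * (4 + real CARD('m)) * r\<^sup>2) * ?En"
  proof -
    have "ennreal (2 / r) * ((ennreal (2 * (4 + real CARD('m)) * r\<^sup>2) * ?En) * ennreal r)
        = (ennreal (2 / r) * ennreal (2 * (4 + real CARD('m)) * r\<^sup>2) * ennreal r) * ?En"
      by (simp add: ac_simps)
    also have "ennreal (2 / r) * ennreal (2 * (4 + real CARD('m)) * r\<^sup>2) * ennreal r
        = ennreal (2 / r * (2 * (4 + real CARD('m)) * r\<^sup>2) * r)"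
      using \<open>r > 0\<close> by (simp flip: ennreal_mult)
    also have "2 / r * (2 * (4 + real CARD('m)) * r\<^sup>2) * r = 4 * (4 + real CARD('m)) * r\<^sup>2"
      using \<open>r > 0\<close> by simp
    finally show ?thesis .
  qed
  ultimately show ?thesis by simp
qed

text \<open>Take \<open>r\<close> with \<open>r powr Q = 2 * a\<close>, the radius for which the
  smallness hypothesis of the half-space estimate becomes exactly \<open>a\<close>. The factor
  \<open>r\<^sup>2\<close> then turns into a multiple of \<open>a powr (2 / Q)\<close>. For
  \<open>a = 0\<close> this radius would vanish, but then the level set is a null set.\<close>

lemma level_set_bound:
  fixes w :: "'m::finite point \<Rightarrow> real" and lam Q a :: real
  assumes w: "\<And>X. GDERIV w X :> D X" and D: "continuous_on UNIV D"
    and "lam \<ge> 0" and Q: "Q = 1 + (1 + lam) * CARD('m)"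
    and a: "emeasure lborel {X. w X \<noteq> 0} \<le> ennreal a" "a \<ge> 0"
  shows "emeasure lborel {X. w X = 1}
    \<le> ennreal (32 * (4 + real CARD('m)) * a powr (2 / Q)) * (\<integral>\<^sup>+X. ennreal ((norm (grushin_sqrtA lam X (D X)))\<^sup>2) \<partial>lborel)"
    (is "_ \<le> _ * ?En")
proof -
  have cw: "continuous_on UNIV w" using w by (rule GDERIV_imp_continuous_on)
  have [measurable]: "w \<in> borel_measurable borel"
    "(fst :: 'm point \<Rightarrow> real) \<in> borel_measurable borel"
    by (auto intro!: borel_measurable_continuous_onI cw continuous_intros)
  have "Q \<ge> 1" using Q \<open>lam \<ge> 0\<close> by simp
  show ?thesis
  proof (cases "a = 0")
    case True
    have "emeasure lborel {X. w X = 1} \<le> emeasure lborel {X. w X \<noteq> 0}"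
      by (intro emeasure_mono) auto
    then show ?thesis using a True by simp
  next
    case False
    define r where "r = (2 * a) powr (1 / Q)"
    have "r > 0" using False a by (simp add: r_def)
    have rQ: "r powr (1 + (1 + lam) * CARD('m)) / 2 = a"
      unfolding Q[symmetric] r_def using False a \<open>Q \<ge> 1\<close> by (simp add: powr_powr)
    have "r\<^sup>2 = (2 * a) powr (2 / Q)"
      using False a \<open>Q \<ge> 1\<close> by (simp add: r_def powr_powr flip: powr_realpow)
    \<comment> \<open>The crude bound 4 for \<open>2 powr (2 / Q)\<close> keeps the final constant
      independent of \<open>Q\<close>; together with the two half-spaces it accounts for the
      32.\<close>
    also have "\<dots> = 2 powr (2 / Q) * a powr (2 / Q)"
      using a by (simp add: powr_mult)
    also have "\<dots> \<le> 2 powr 2 * a powr (2 / Q)"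
      using \<open>Q \<ge> 1\<close> by (intro mult_right_mono powr_mono) (auto simp: field_simps)
    finally have r2: "r\<^sup>2 \<le> 4 * a powr (2 / Q)" by simp
    have half: "emeasure lborel {X. w X = 1 \<and> 0 \<le> e * fst X}
        \<le> ennreal (4 * (4 + real CARD('m)) * r\<^sup>2) * ?En" if "\<bar>e\<bar> = 1" for e
      using assms \<open>r > 0\<close> that rQ by (intro level_set_half_bound) auto
    \<comment> \<open>The two closed half-spaces overlap in \<open>fst X = 0\<close>; subadditivity
      is enough.\<close>
    have "emeasure lborel {X. w X = 1}
      \<le> emeasure lborel ({X. w X = 1 \<and> 0 \<le> 1 * fst X} \<union> {X. w X = 1 \<and> 0 \<le> (-1) * fst X})"
      by (intro emeasure_mono) auto
    also have "\<dots> \<le> emeasure lborel {X. w X = 1 \<and> 0 \<le> 1 * fst X} + emeasure lborel {X. w X = 1 \<and> 0 \<le> (-1) * fst X}"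
      by (intro emeasure_subadditive) auto
    also have "\<dots> \<le> ennreal (4 * (4 + real CARD('m)) * r\<^sup>2) * ?En + ennreal (4 * (4 + real CARD('m)) * r\<^sup>2) * ?En"
      by (intro add_mono half) auto
    also have "\<dots> = ennreal (8 * (4 + real CARD('m)) * r\<^sup>2) * ?En"
      by (subst distrib_right[symmetric], subst ennreal_plus[symmetric])
         (auto intro!: arg_cong2[of _ _ _ _ "(*)"] arg_cong[of _ _ ennreal] simp: algebra_simps)
    also have "\<dots> \<le> ennreal (32 * (4 + real CARD('m)) * a powr (2 / Q)) * ?En"
      using mult_left_mono[OF r2, of "8 * (4 + real CARD('m))"]
      by (intro mult_right_mono ennreal_leI) (auto simp: algebra_simps)
    finally show ?thesis .
  qed
qed

section \<open>The Sobolev inequality\<close>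

text \<open>The square of the positive part of \<open>x\<close> is
  \<open>(x\<^sup>2 + x * \<bar>x\<bar>) / 2\<close>. Only the derivative of
  \<open>x * \<bar>x\<bar>\<close> has to be found, by the difference quotient at 0 and by a local
  choice of sign elsewhere.\<close>

lemma DERIV_pos_part_square:
  "((\<lambda>t::real. (max 0 (t - c))\<^sup>2) has_real_derivative 2 * max 0 (t - c)) (at t)"
proof -
  have "((\<lambda>x::real. x * \<bar>x\<bar>) has_real_derivative 2 * \<bar>x\<bar>) (at x)" for x
  proof (cases "x = 0")
    case True
    have "(\<lambda>h. \<bar>h::real\<bar>) \<midarrow>0\<rightarrow> 0"
      by (intro tendsto_eq_intros) auto
    then have "(\<lambda>h. ((x + h) * \<bar>x + h\<bar> - x * \<bar>x\<bar>) / h) \<midarrow>0\<rightarrow> 0"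
      by (rule Lim_transform_eventually) (auto simp: True eventually_at intro!: exI[of _ 1])
    then show ?thesis by (simp add: DERIV_def True)
  next
    case False
    have "((\<lambda>t. t * (sgn x * t)) has_real_derivative 2 * \<bar>x\<bar>) (at x)"
      by (auto intro!: derivative_eq_intros simp: abs_sgn)
    moreover have "open {t. 0 < sgn x * t}"
      by (intro open_Collect_less continuous_intros)
    moreover have "x \<in> {t. 0 < sgn x * t}" using False by (auto simp: sgn_if)
    moreover have "t * (sgn x * t) = t * \<bar>t\<bar>" if "t \<in> {t. 0 < sgn x * t}" for t
      using that by (auto simp: sgn_if split: if_splits)
    ultimately show ?thesis
      by (rule has_field_derivative_transform_within_open)
  qed
  note D = this
  have "((\<lambda>t. ((t - c)\<^sup>2 + (t - c) * \<bar>t - c\<bar>) / 2) has_real_derivative 2 * max 0 (t - c)) (at t)"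
    by (rule derivative_eq_intros DERIV_chain2[OF D] refl | simp add: max_def)+
  moreover have "(\<lambda>t. (max 0 (t - c))\<^sup>2) = (\<lambda>t. ((t - c)\<^sup>2 + (t - c) * \<bar>t - c\<bar>) / 2)"
    by (auto simp: max_def power2_eq_square fun_eq_iff abs_if algebra_simps)
  ultimately show ?thesis by simp
qed

text \<open>The primitive of a triangular hat on \<open>{1..2}\<close>, a \<open>C\<^sup>1\<close> substitute for piecewise linear truncation.\<close>

definition spline_step :: "real \<Rightarrow> real" where
  "spline_step t = 2 * ((max 0 (t - 1))\<^sup>2 - 2 * (max 0 (t - 3/2))\<^sup>2 + (max 0 (t - 2))\<^sup>2)"

definition spline_step' :: "real \<Rightarrow> real" where
  "spline_step' t = 4 * (max 0 (t - 1) - 2 * max 0 (t - 3/2) + max 0 (t - 2))"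

lemma DERIV_spline_step: "(spline_step has_real_derivative spline_step' t) (at t)"
  unfolding spline_step_def [abs_def] spline_step'_def
  by (rule derivative_eq_intros DERIV_pos_part_square refl | simp)+

lemma spline_step_nonzero: "spline_step t \<noteq> 0 \<Longrightarrow> t > 1"
  by (rule ccontr) (auto simp: spline_step_def max_def split: if_splits)

lemma spline_step_one: "t \<ge> 2 \<Longrightarrow> spline_step t = 1"
  by (simp add: spline_step_def max_def power2_eq_square field_simps)

lemma spline_step'_le: "\<bar>spline_step' t\<bar> \<le> 2"
  by (auto simp: spline_step'_def max_def)

lemma spline_step'_nonzero: "spline_step' t \<noteq> 0 \<Longrightarrow> 1 < t \<and> t < 2"
  by (auto simp: spline_step'_def max_def split: if_splits)

lemma grushin_sqrtA_scaleR: "grushin_sqrtA lam X (k *\<^sub>R V) = k *\<^sub>R grushin_sqrtA lam X V"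
  by (simp add: grushin_sqrtA_def)

lemma GDERIV_compose_real:
  assumes "GDERIV g X :> D" "(F has_real_derivative F') (at (g X))"
  shows "GDERIV (\<lambda>X. F (g X)) X :> F' *\<^sub>R D"
  using GDERIV_DERIV_compose[OF assms] .

text \<open>Apply \<open>level_set_bound\<close> to \<open>spline_step (g / s)\<close>. It vanishes
  unless \<open>g > s\<close>, equals 1 where \<open>g \<ge> 2 * s\<close>, and its gradient lives
  on the strip between with factor at most \<open>2 / s\<close>; squaring this factor turns 32 into
  128. Measuring energy on the strip alone allows the energies of different levels to be
  added.\<close>

lemma dyadic_level_bound:
  fixes g :: "'m::finite point \<Rightarrow> real" and lam Q s e :: real
  assumes g: "\<And>X. GDERIV g X :> D X" and D: "continuous_on UNIV D"
    and "lam \<ge> 0" and Q: "Q = 1 + (1 + lam) * CARD('m)"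
    and fin: "emeasure lborel {X. g X \<noteq> 0} < \<infinity>" and "s > 0" "e \<ge> 0"
    and e: "(\<integral>\<^sup>+X. ennreal ((norm (grushin_sqrtA lam X (D X)))\<^sup>2) * indicator {X. s < g X \<and> g X < 2 * s} X \<partial>lborel) \<le> ennreal e"
  shows "measure lborel {X. g X > 2 * s}
    \<le> 128 * (4 + real CARD('m)) / s\<^sup>2 * measure lborel {X. g X > s} powr (2 / Q) * e"
proof -
  have cg: "continuous_on UNIV g" using g by (rule GDERIV_imp_continuous_on)
  have [measurable]: "g \<in> borel_measurable borel" "D \<in> borel_measurable borel"
    by (auto intro!: borel_measurable_continuous_onI cg D)
  let ?a = "measure lborel {X. g X > s}"
  have fin_s: "emeasure lborel {X. g X > s} < \<infinity>"
    by (rule le_less_trans[OF _ fin]) (use \<open>s > 0\<close> in \<open>auto intro!: emeasure_mono\<close>)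
  define w where "w X = spline_step (1 / s * g X)" for X
  define D' where "D' X = (spline_step' (1 / s * g X) * (1 / s)) *\<^sub>R D X" for X
  have w: "GDERIV w X :> D' X" for X
    unfolding w_def [abs_def] D'_def
    by (rule GDERIV_compose_real[OF g, where F = "\<lambda>t. spline_step (1 / s * t)"])
       (rule DERIV_chain2[OF DERIV_spline_step] derivative_eq_intros refl | simp)+
  have cD': "continuous_on UNIV D'"
    unfolding D'_def [abs_def] spline_step'_def by (intro continuous_intros cg D)
  have "{X. w X \<noteq> 0} \<subseteq> {X. g X > s}"
    using \<open>s > 0\<close> by (auto simp: w_def dest!: spline_step_nonzero)
  then have "emeasure lborel {X. w X \<noteq> 0} \<le> emeasure lborel {X. g X > s}"
    by (intro emeasure_mono) auto
  also have "\<dots> = ennreal ?a"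
    using fin_s by (simp add: emeasure_eq_ennreal_measure)
  finally have wa: "emeasure lborel {X. w X \<noteq> 0} \<le> ennreal ?a" .
  have pt: "(norm (grushin_sqrtA lam X (D' X)))\<^sup>2
      \<le> 4 / s\<^sup>2 * (norm (grushin_sqrtA lam X (D X)))\<^sup>2 * indicator {X. s < g X \<and> g X < 2 * s} X" for X
  proof -
    let ?k = "spline_step' (1 / s * g X) * (1 / s)"
    have eq: "(norm (grushin_sqrtA lam X (D' X)))\<^sup>2 = ?k\<^sup>2 * (norm (grushin_sqrtA lam X (D X)))\<^sup>2"
      by (simp add: D'_def grushin_sqrtA_scaleR power_mult_distrib power_divide)
    show ?thesis
    proof (cases "spline_step' (1 / s * g X) = 0")
      case True then show ?thesis using eq by simp
    next
      case False
      then have "s < g X \<and> g X < 2 * s"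
        using spline_step'_nonzero[of "1 / s * g X"] \<open>s > 0\<close> by (simp add: field_simps)
      moreover have "?k\<^sup>2 \<le> 4 / s\<^sup>2"
      proof -
        have "(spline_step' (1 / s * g X))\<^sup>2 \<le> 2\<^sup>2"
          using spline_step'_le[of "1 / s * g X"] by (metis abs_ge_zero power2_abs power_mono)
        then show ?thesis using \<open>s > 0\<close> by (simp add: power_mult_distrib power_divide divide_right_mono)
      qed
      ultimately have "?k\<^sup>2 * (norm (grushin_sqrtA lam X (D X)))\<^sup>2 \<le> 4 / s\<^sup>2 * (norm (grushin_sqrtA lam X (D X)))\<^sup>2"
        by (intro mult_right_mono) auto
      then show ?thesis unfolding eq using \<open>s < g X \<and> g X < 2 * s\<close> by simp
    qed
  qed
  have "(\<integral>\<^sup>+X. ennreal ((norm (grushin_sqrtA lam X (D' X)))\<^sup>2) \<partial>lborel)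
     \<le> (\<integral>\<^sup>+X. ennreal (4 / s\<^sup>2) * (ennreal ((norm (grushin_sqrtA lam X (D X)))\<^sup>2) * indicator {X. s < g X \<and> g X < 2 * s} X) \<partial>lborel)"
  proof (rule nn_integral_mono)
    fix X
    show "ennreal ((norm (grushin_sqrtA lam X (D' X)))\<^sup>2)
      \<le> ennreal (4 / s\<^sup>2) * (ennreal ((norm (grushin_sqrtA lam X (D X)))\<^sup>2) * indicator {X. s < g X \<and> g X < 2 * s} X)"
      using pt[of X] by (cases "s < g X \<and> g X < 2 * s") (auto simp: ennreal_leI simp flip: ennreal_mult)
  qed
  also have "\<dots> \<le> ennreal (4 / s\<^sup>2) * ennreal e"
    using e by (subst nn_integral_cmult) (auto intro!: mult_left_mono)
  finally have En: "(\<integral>\<^sup>+X. ennreal ((norm (grushin_sqrtA lam X (D' X)))\<^sup>2) \<partial>lborel) \<le> ennreal (4 / s\<^sup>2 * e)"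
    using \<open>e \<ge> 0\<close> by (subst ennreal_mult) auto
  have "emeasure lborel {X. g X > 2 * s} \<le> emeasure lborel {X. w X = 1}"
  proof (rule emeasure_mono)
    show "{X. g X > 2 * s} \<subseteq> {X. w X = 1}"
      using \<open>s > 0\<close> by (auto simp: w_def field_simps intro!: spline_step_one)
    have "continuous_on UNIV w" using w by (rule GDERIV_imp_continuous_on)
    then have [measurable]: "w \<in> borel_measurable borel" by (rule borel_measurable_continuous_onI)
    show "{X. w X = 1} \<in> sets lborel" by simp
  qed
  also have "\<dots> \<le> ennreal (32 * (4 + real CARD('m)) * ?a powr (2 / Q))
      * (\<integral>\<^sup>+X. ennreal ((norm (grushin_sqrtA lam X (D' X)))\<^sup>2) \<partial>lborel)"
    using assms w cD' wa by (intro level_set_bound) auto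
  also have "\<dots> \<le> ennreal (32 * (4 + real CARD('m)) * ?a powr (2 / Q)) * ennreal (4 / s\<^sup>2 * e)"
    by (intro mult_left_mono En) auto
  also have "\<dots> = ennreal (32 * (4 + real CARD('m)) * ?a powr (2 / Q) * (4 / s\<^sup>2 * e))"
    using \<open>e \<ge> 0\<close> by (intro ennreal_mult[symmetric]) auto
  finally have "measure lborel {X. g X > 2 * s} \<le> 32 * (4 + real CARD('m)) * ?a powr (2 / Q) * (4 / s\<^sup>2 * e)"
    using \<open>e \<ge> 0\<close> by (simp add: measure_def enn2real_leI)
  then show ?thesis by (simp add: field_simps)
qed

text \<open>Replacing each \<open>b j\<close> on the right by the whole sum \<open>B\<close> leads
  to \<open>B \<le> \<beta> + C * E * B powr \<theta>\<close>. Either \<open>\<beta>\<close> is at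
  least half of \<open>B\<close>, or the last term is, and then division by
  \<open>B powr \<theta>\<close> bounds \<open>B\<close>. The bound is independent of the number of
  levels.\<close>

lemma sum_absorb:
  fixes b e :: "nat \<Rightarrow> real" and C E \<theta> \<beta> :: real
  assumes b: "\<And>j. 0 \<le> b j" and e: "\<And>j. 0 \<le> e j" and E: "(\<Sum>j<J. e j) \<le> E"
    and step: "\<And>j. j < J \<Longrightarrow> b (Suc j) \<le> C * b j powr \<theta> * e j"
    and "b 0 \<le> \<beta>" "0 < \<theta>" "\<theta> < 1" "C \<ge> 0"
  shows "(\<Sum>j\<le>J. b j) \<le> 2 * \<beta> + (2 * C * E) powr (1 / (1 - \<theta>))"
proof -
  let ?B = "\<Sum>j\<le>J. b j"
  have "0 \<le> ?B" by (intro sum_nonneg b)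
  have "0 \<le> E" using sum_nonneg[of "{..<J}" e] e E by simp
  have bB: "b j \<le> ?B" if "j < J" for j
    using that b by (intro member_le_sum) auto
  have "?B = b 0 + (\<Sum>j<J. b (Suc j))"
    by (simp add: sum.atMost_shift)
  also have "(\<Sum>j<J. b (Suc j)) \<le> (\<Sum>j<J. C * ?B powr \<theta> * e j)"
  proof (rule sum_mono)
    fix j assume "j \<in> {..<J}"
    then have "b (Suc j) \<le> C * b j powr \<theta> * e j" by (simp add: step)
    also have "\<dots> \<le> C * ?B powr \<theta> * e j"
      using \<open>j \<in> _\<close> assms by (intro mult_right_mono mult_left_mono powr_mono2 bB e b) auto
    finally show "b (Suc j) \<le> C * ?B powr \<theta> * e j" .
  qed
  also have "\<dots> = C * ?B powr \<theta> * (\<Sum>j<J. e j)"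
    by (simp add: sum_distrib_left)
  also have "\<dots> \<le> C * ?B powr \<theta> * E"
    using assms by (intro mult_left_mono E) auto
  finally have le: "?B \<le> \<beta> + C * E * ?B powr \<theta>"
    using \<open>b 0 \<le> \<beta>\<close> by (simp add: algebra_simps)
  have "0 \<le> \<beta>" using b[of 0] \<open>b 0 \<le> \<beta>\<close> by simp
  show ?thesis
  proof (cases "?B \<le> 2 * \<beta>")
    case True
    then show ?thesis by (smt (verit) powr_ge_zero)
  next
    case False
    then have "?B > 0" using \<open>0 \<le> \<beta>\<close> by linarith
    have "?B \<le> 2 * C * E * ?B powr \<theta>" using le False by linarith
    then have "?B / ?B powr \<theta> \<le> 2 * C * E"
      using \<open>?B > 0\<close> by (simp add: pos_divide_le_eq)
    moreover have "?B / ?B powr \<theta> = ?B powr (1 - \<theta>)"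
      using \<open>?B > 0\<close> by (simp add: powr_diff)
    ultimately have "?B powr (1 - \<theta>) \<le> 2 * C * E" by simp
    then have "(?B powr (1 - \<theta>)) powr (1 / (1 - \<theta>)) \<le> (2 * C * E) powr (1 / (1 - \<theta>))"
      using assms by (intro powr_mono2) auto
    then have "?B \<le> (2 * C * E) powr (1 / (1 - \<theta>))"
      using assms \<open>?B > 0\<close> by (simp add: powr_powr)
    then show ?thesis using \<open>0 \<le> \<beta>\<close> by simp
  qed
qed

text \<open>With \<open>q = 2 * Q / (Q - 2)\<close>, the outer \<open>2 powr q\<close> compares
  consecutive dyadic levels. The second factor is what \<open>sum_absorb\<close> yields with
  \<open>\<theta> = 2 / Q\<close>, the base being twice \<open>2 powr q\<close> times the constant
  of \<open>dyadic_level_bound\<close>.\<close>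

definition sobolev_const :: "nat \<Rightarrow> real \<Rightarrow> real" where
  "sobolev_const m Q = 2 powr (2 * Q / (Q - 2)) *
     (2 * (2 powr (2 * Q / (Q - 2)) * (128 * (4 + real m)))) powr (Q / (Q - 2))"

text \<open>A nonzero value below \<open>\<delta>\<close> is covered by the first term. A larger
  value lies in one dyadic interval, and the summand of that interval alone dominates
  \<open>t powr q\<close>.\<close>

lemma dyadic_pointwise_bound:
  fixes t \<delta> q :: real
  assumes "0 \<le> t" "0 < \<delta>" "t \<le> \<delta> * 2 ^ J" "0 < q"
  shows "t powr q \<le> (if t \<noteq> 0 then \<delta> powr q else 0) + (\<Sum>j<J. if t > \<delta> * 2 ^ j then (\<delta> * 2 ^ Suc j) powr q else 0)"
  using assms(3)
proof (induction J)
  case 0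
  then show ?case using assms by (auto intro!: powr_mono2)
next
  case (Suc J)
  show ?case
  proof (cases "t \<le> \<delta> * 2 ^ J")
    case True
    then show ?thesis using Suc.IH by simp
  next
    case False
    have "t powr q \<le> (\<delta> * 2 ^ Suc J) powr q"
      using assms Suc.prems by (intro powr_mono2) auto
    moreover have "0 \<le> (\<Sum>j<J. if t > \<delta> * 2 ^ j then (\<delta> * 2 ^ Suc j) powr q else 0)"
      by (intro sum_nonneg) auto
    moreover have "0 \<le> \<delta> powr q" by simp
    ultimately have "t powr q \<le> \<delta> powr q + ((\<Sum>j<J. if t > \<delta> * 2 ^ j then (\<delta> * 2 ^ Suc j) powr q else 0)
        + (\<delta> * 2 ^ Suc J) powr q)"
      by linarith
    moreover have "t \<noteq> 0" using False \<open>0 < \<delta>\<close> by auto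
    ultimately show ?thesis using False by simp
  qed
qed

text \<open>Put \<open>b j = s j powr q * a j\<close>, where \<open>a j\<close> is the measure of
  the set \<open>g > s j\<close>. The level estimate becomes
  \<open>b (Suc j) \<le> C * b j powr (2 / Q) * ee j\<close>, and \<open>sum_absorb\<close> bounds
  the sum of the \<open>b j\<close>. Levels have to start at some \<open>\<delta> > 0\<close>; what
  lies below is paid for by the terms with \<open>V\<close>, which disappear as
  \<open>\<delta>\<close> tends to 0.\<close>

lemma sobolev_approx:
  fixes g :: "'m::finite point \<Rightarrow> real" and lam Q \<delta> E :: real
  defines "q \<equiv> 2 * Q / (Q - 2)"
  assumes g: "\<And>X. GDERIV g X :> D X" and D: "continuous_on UNIV D"
    and "lam \<ge> 0" and Q: "Q = 1 + (1 + lam) * CARD('m)" and "Q > 2"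
    and fin: "emeasure lborel {X. g X \<noteq> 0} \<le> ennreal V" "V \<ge> 0"
    and "E \<ge> 0" and nonneg: "\<And>X. 0 \<le> g X" and bdd: "\<And>X. g X \<le> B"
    and e: "(\<integral>\<^sup>+X. ennreal ((norm (grushin_sqrtA lam X (D X)))\<^sup>2) \<partial>lborel) \<le> ennreal E"
    and "\<delta> > 0"
  shows "(\<integral>\<^sup>+X. ennreal (g X powr q) \<partial>lborel)
    \<le> ennreal (sobolev_const CARD('m) Q * E powr (Q / (Q - 2)) + \<delta> powr q * (V + 2 * 2 powr q * V))"
proof -
  have cg: "continuous_on UNIV g" using g by (rule GDERIV_imp_continuous_on)
  have [measurable]: "g \<in> borel_measurable borel" "D \<in> borel_measurable borel"
    by (auto intro!: borel_measurable_continuous_onI cg D)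
  have "q > 2" using \<open>Q > 2\<close> by (simp add: q_def field_simps)
  \<comment> \<open>The identity \<open>q - 2 = q * (2 / Q)\<close> is what selects the Sobolev
    exponent: it lets the powers of \<open>s j\<close> on both sides of the level estimate
    match.\<close>
  have q2: "q - 2 = q * (2 / Q)" and q3: "1 / (1 - 2 / Q) = Q / (Q - 2)"
    using \<open>Q > 2\<close> by (simp_all add: q_def field_simps)
  \<comment> \<open>Since \<open>g\<close> is bounded, finitely many dyadic levels exhaust its
    range.\<close>
  obtain J where J: "B / \<delta> < 2 ^ J"
    using real_arch_pow[of 2 "B / \<delta>"] by auto
  then have BJ: "g X \<le> \<delta> * 2 ^ J" for X
    using bdd[of X] \<open>\<delta> > 0\<close> by (simp add: field_simps)
  define s where "s j = \<delta> * 2 ^ j" for j :: nat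
  have s_pos: "s j > 0" for j using \<open>\<delta> > 0\<close> by (simp add: s_def)
  have s_Suc: "s (Suc j) = 2 * s j" for j by (simp add: s_def)
  let ?N = "\<lambda>X. (norm (grushin_sqrtA lam X (D X)))\<^sup>2"
  define en where "en j = (\<integral>\<^sup>+X. ennreal (?N X) * indicator {X. s j < g X \<and> g X < 2 * s j} X \<partial>lborel)" for j
  have en_sum: "(\<Sum>j<J. en j) \<le> ennreal E"
  proof -
    \<comment> \<open>Each strip indicator is at most the difference of two consecutive superlevel
      indicators, and these differences telescope.\<close>
    have disj: "(\<Sum>j<J. indicator {X. s j < g X \<and> g X < 2 * s j} X) \<le> (1 :: ennreal)" for X
    proof -
      have "(\<Sum>j<J. indicator {X. s j < g X \<and> g X < 2 * s j} X)
          \<le> (\<Sum>j<J. (indicator {X. s j < g X} X - indicator {X. s (Suc j) < g X} X :: real))"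
      proof (intro sum_mono)
        fix j
        show "indicator {X. s j < g X \<and> g X < 2 * s j} X
            \<le> (indicator {X. s j < g X} X - indicator {X. s (Suc j) < g X} X :: real)"
          using s_pos[of j] by (auto simp: indicator_def s_Suc)
      qed
      also have "\<dots> \<le> 1"
        by (subst sum_lessThan_telescope') (auto simp: indicator_def)
      finally have "ennreal (\<Sum>j<J. indicator {X. s j < g X \<and> g X < 2 * s j} X) \<le> ennreal 1"
        by (rule ennreal_leI)
      then show ?thesis
        by (simp add: ennreal_indicator flip: sum_ennreal)
    qed
    have "(\<Sum>j<J. en j) = (\<integral>\<^sup>+X. (\<Sum>j<J. ennreal (?N X) * indicator {X. s j < g X \<and> g X < 2 * s j} X) \<partial>lborel)"
      unfolding en_def by (rule nn_integral_sum[symmetric]) measurable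
    also have "\<dots> = (\<integral>\<^sup>+X. ennreal (?N X) * (\<Sum>j<J. indicator {X. s j < g X \<and> g X < 2 * s j} X) \<partial>lborel)"
      by (simp add: sum_distrib_left)
    also have "\<dots> \<le> (\<integral>\<^sup>+X. ennreal (?N X) * 1 \<partial>lborel)"
      by (intro nn_integral_mono mult_left_mono disj) auto
    also have "\<dots> \<le> ennreal E" using e by simp
    finally show ?thesis .
  qed
  have en_le: "en j \<le> ennreal E" for j
  proof -
    have "en j \<le> (\<integral>\<^sup>+X. ennreal (?N X) \<partial>lborel)"
      unfolding en_def by (intro nn_integral_mono) (auto simp: indicator_def)
    then show ?thesis using e by simp
  qed
  define ee where "ee j = enn2real (en j)" for j
  have en_ee: "en j = ennreal (ee j)" for j
    using en_le[of j] unfolding ee_def by (intro ennreal_enn2real[symmetric]) (auto simp: le_less_trans)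
  have ee_nonneg: "0 \<le> ee j" for j by (simp add: ee_def)
  have ee_sum: "(\<Sum>j<J. ee j) \<le> E"
    using en_sum \<open>E \<ge> 0\<close> by (simp add: en_ee sum_ennreal ee_nonneg sum_nonneg)
  define a where "a j = measure lborel {X. g X > s j}" for j
  have fin': "emeasure lborel {X. g X \<noteq> 0} < \<infinity>"
    using fin by (simp add: le_less_trans)
  have a_le: "emeasure lborel {X. g X > s j} \<le> ennreal V" for j
    by (rule order.trans[OF _ fin(1)]) (use s_pos[of j] in \<open>auto intro!: emeasure_mono\<close>)
  have a_eq: "emeasure lborel {X. g X > s j} = ennreal (a j)" for j
    unfolding a_def using a_le[of j] by (intro emeasure_eq_ennreal_measure) (auto simp: top_unique)
  have a_nonneg: "0 \<le> a j" for j by (simp add: a_def)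
  define b where "b j = s j powr q * a j" for j
  define c where "c = 128 * (4 + real CARD('m))"
  define C where "C = 2 powr q * c"
  have step: "b (Suc j) \<le> C * b j powr (2 / Q) * ee j" for j
  proof -
    have "a (Suc j) \<le> c / (s j)\<^sup>2 * a j powr (2 / Q) * ee j"
      unfolding a_def s_Suc c_def
      using assms s_pos ee_nonneg fin' en_ee[of j]
      by (intro dyadic_level_bound) (auto simp: en_def)
    then have "b (Suc j) \<le> (2 * s j) powr q * (c / (s j)\<^sup>2 * a j powr (2 / Q) * ee j)"
      unfolding b_def s_Suc by (intro mult_left_mono) auto
    also have "(2 * s j) powr q = 2 powr q * s j powr q"
      using s_pos[of j] by (simp add: powr_mult)
    also have "2 powr q * s j powr q * (c / (s j)\<^sup>2 * a j powr (2 / Q) * ee j)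
        = C * (s j powr q / (s j)\<^sup>2 * a j powr (2 / Q)) * ee j"
      by (simp add: C_def)
    also have "s j powr q / (s j)\<^sup>2 = s j powr (q * (2 / Q))"
      unfolding q2[symmetric] using s_pos[of j] by (simp add: powr_diff)
    also have "s j powr (q * (2 / Q)) * a j powr (2 / Q) = b j powr (2 / Q)"
      using s_pos[of j] a_nonneg[of j] by (simp add: b_def powr_mult powr_powr)
    finally show ?thesis .
  qed
  have b_nonneg: "0 \<le> b j" for j by (simp add: b_def a_nonneg)
  have b0: "b 0 \<le> \<delta> powr q * V"
  proof -
    have "a 0 \<le> V" using a_le[of 0] a_eq[of 0] \<open>V \<ge> 0\<close> by simp
    then show ?thesis by (simp add: b_def s_def mult_left_mono)
  qed
  have "c \<ge> 0" by (simp add: c_def)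
  then have "(\<Sum>j\<le>J. b j) \<le> 2 * (\<delta> powr q * V) + (2 * C * E) powr (1 / (1 - 2 / Q))"
    using \<open>Q > 2\<close> by (intro sum_absorb[where e = ee] b_nonneg ee_nonneg ee_sum step b0) (auto simp: C_def)
  then have bsum: "(\<Sum>j\<le>J. b j) \<le> 2 * (\<delta> powr q * V) + (2 * C * E) powr (Q / (Q - 2))"
    unfolding q3 .
  have "(\<integral>\<^sup>+X. ennreal (g X powr q) \<partial>lborel)
      \<le> (\<integral>\<^sup>+X. ennreal (\<delta> powr q) * indicator {X. g X \<noteq> 0} X
           + (\<Sum>j<J. ennreal (s (Suc j) powr q) * indicator {X. g X > s j} X) \<partial>lborel)"
  proof (rule nn_integral_mono)
    fix X
    have "g X powr q \<le> (if g X \<noteq> 0 then \<delta> powr q else 0) + (\<Sum>j<J. if g X > s j then s (Suc j) powr q else 0)"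
      unfolding s_def using \<open>\<delta> > 0\<close> \<open>q > 2\<close> by (intro dyadic_pointwise_bound BJ nonneg) auto
    then have "ennreal (g X powr q) \<le> ennreal (if g X \<noteq> 0 then \<delta> powr q else 0)
        + (\<Sum>j<J. ennreal (if g X > s j then s (Suc j) powr q else 0))"
      by (subst sum_ennreal) (auto simp: sum_nonneg ennreal_leI simp flip: ennreal_plus)
    also have "ennreal (if g X \<noteq> 0 then \<delta> powr q else 0) = ennreal (\<delta> powr q) * indicator {X. g X \<noteq> 0} X"
      by (simp add: indicator_def)
    also have "(\<Sum>j<J. ennreal (if g X > s j then s (Suc j) powr q else 0))
        = (\<Sum>j<J. ennreal (s (Suc j) powr q) * indicator {X. g X > s j} X)"
      by (intro sum.cong) (auto simp: indicator_def)
    finally show "ennreal (g X powr q) \<le> ennreal (\<delta> powr q) * indicator {X. g X \<noteq> 0} X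
           + (\<Sum>j<J. ennreal (s (Suc j) powr q) * indicator {X. g X > s j} X)" .
  qed
  also have "\<dots> = (\<integral>\<^sup>+X. ennreal (\<delta> powr q) * indicator {X. g X \<noteq> 0} X \<partial>lborel)
      + (\<integral>\<^sup>+X. (\<Sum>j<J. ennreal (s (Suc j) powr q) * indicator {X. g X > s j} X) \<partial>lborel)"
    by (rule nn_integral_add) measurable
  also have "(\<integral>\<^sup>+X. (\<Sum>j<J. ennreal (s (Suc j) powr q) * indicator {X. g X > s j} X) \<partial>lborel)
      = (\<Sum>j<J. \<integral>\<^sup>+X. ennreal (s (Suc j) powr q) * indicator {X. g X > s j} X \<partial>lborel)"
    by (rule nn_integral_sum) measurable
  also have "(\<integral>\<^sup>+X. ennreal (\<delta> powr q) * indicator {X. g X \<noteq> 0} X \<partial>lborel)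
      + (\<Sum>j<J. \<integral>\<^sup>+X. ennreal (s (Suc j) powr q) * indicator {X. g X > s j} X \<partial>lborel)
      = ennreal (\<delta> powr q) * emeasure lborel {X. g X \<noteq> 0}
      + (\<Sum>j<J. ennreal (s (Suc j) powr q) * emeasure lborel {X. g X > s j})"
    by (simp add: nn_integral_cmult_indicator)
  also have "\<dots> \<le> ennreal (\<delta> powr q) * ennreal V + (\<Sum>j<J. ennreal (s (Suc j) powr q) * ennreal (a j))"
    unfolding a_eq by (intro add_right_mono mult_left_mono fin) auto
  also have "\<dots> = ennreal (\<delta> powr q * V + (\<Sum>j<J. s (Suc j) powr q * a j))"
    using a_nonneg \<open>V \<ge> 0\<close> by (simp add: sum_nonneg sum_ennreal flip: ennreal_mult ennreal_plus)
  also have "\<dots> \<le> ennreal (sobolev_const CARD('m) Q * E powr (Q / (Q - 2)) + \<delta> powr q * (V + 2 * 2 powr q * V))"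
  proof (rule ennreal_leI)
    have "(\<Sum>j<J. s (Suc j) powr q * a j) = 2 powr q * (\<Sum>j<J. b j)"
      using s_pos by (simp add: s_Suc powr_mult b_def sum_distrib_left mult.assoc less_imp_le)
    also have "\<dots> \<le> 2 powr q * (\<Sum>j\<le>J. b j)"
      by (intro mult_left_mono sum_mono2) (auto simp: b_nonneg)
    also have "\<dots> \<le> 2 powr q * (2 * (\<delta> powr q * V) + (2 * C * E) powr (Q / (Q - 2)))"
      by (intro mult_left_mono bsum) auto
    also have "(2 * C * E) powr (Q / (Q - 2)) = (2 * C) powr (Q / (Q - 2)) * E powr (Q / (Q - 2))"
      by (rule powr_mult)
    finally show "\<delta> powr q * V + (\<Sum>j<J. s (Suc j) powr q * a j)
        \<le> sobolev_const CARD('m) Q * E powr (Q / (Q - 2)) + \<delta> powr q * (V + 2 * 2 powr q * V)"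
      unfolding sobolev_const_def q_def[symmetric] C_def c_def by (simp add: algebra_simps)
  qed
  finally show ?thesis .
qed

text \<open>Values outside \<open>\<Omega>\<close> are arbitrary, so the extension by zero has to be
  made explicit before whole-space estimates apply. It is of class \<open>C1\<close> because
  \<open>\<Omega>\<close> and the complement of the support are open and cover the space.\<close>

lemma C1_0_zero_extension:
  fixes \<Omega> :: "'a::euclidean_space set"
  assumes "open \<Omega>" "\<psi> \<in> C1_0 \<Omega>"
  shows "GDERIV (\<lambda>X. if X \<in> \<Omega> then \<psi> X else 0) X :> (if X \<in> \<Omega> then grad \<psi> X else 0)"
    and "continuous_on UNIV (\<lambda>X. if X \<in> \<Omega> then grad \<psi> X else 0)"
    and "compact (closure {X. (if X \<in> \<Omega> then \<psi> X else 0) \<noteq> 0})"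
proof -
  let ?g = "\<lambda>X. if X \<in> \<Omega> then \<psi> X else 0" and ?D = "\<lambda>X. if X \<in> \<Omega> then grad \<psi> X else 0"
  define K where "K = closure (support_on \<Omega> \<psi>)"
  have K: "compact K" "K \<subseteq> \<Omega>"
    using assms(2) by (auto simp: C1_0_def compactly_inside_def K_def)
  have out: "X \<notin> K \<Longrightarrow> ?g X = 0" for X
    using closure_subset[of "support_on \<Omega> \<psi>"] by (auto simp: K_def support_on_def)
  have "open (- K)" using K by (simp add: compact_imp_closed open_Compl)
  have in_: "GDERIV ?g X :> grad \<psi> X" if "X \<in> \<Omega>" for X
  proof -
    have "(\<psi> has_derivative (\<lambda>h. h \<bullet> grad \<psi> X)) (at X)"
      using assms(2) that C1_GDERIV by (auto simp: C1_0_def gderiv_def)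
    then show ?thesis
      unfolding gderiv_def
      by (rule has_derivative_transform_within_open[OF _ assms(1) that]) simp
  qed
  have out_: "GDERIV ?g X :> 0" if "X \<in> - K" for X
  proof -
    have "((\<lambda>_. 0::real) has_derivative (\<lambda>h. h \<bullet> (0::'a))) (at X)" by simp
    then show ?thesis
      unfolding gderiv_def
      by (rule has_derivative_transform_within_open[OF _ \<open>open (- K)\<close> that]) (use out in auto)
  qed
  show gd: "GDERIV ?g X :> ?D X" for X
    using in_ out_ K by (cases "X \<in> \<Omega>") auto
  have "continuous_on \<Omega> ?D"
    using assms(2) by (auto simp: C1_0_def C1_def cong: continuous_on_cong_simp)
  moreover have "continuous_on (- K) ?D"
  proof -
    \<comment> \<open>In the part of \<open>\<Omega>\<close> off the support,
      \<open>grad \<psi>\<close> must be 0 by uniqueness of the gradient.\<close>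
    have "?D X = 0" if "X \<in> - K" for X
      using GDERIV_unique[OF gd out_[OF that]] .
    then show ?thesis
      by (intro continuous_on_eq[OF continuous_on_const[of _ 0]]) auto
  qed
  ultimately have "continuous_on (\<Omega> \<union> - K) ?D"
    using assms(1) \<open>open (- K)\<close> by (intro continuous_on_open_Un)
  moreover have "\<Omega> \<union> - K = UNIV" using K by auto
  ultimately show "continuous_on UNIV ?D" by simp
  have "{X. ?g X \<noteq> 0} = support_on \<Omega> \<psi>" by (auto simp: support_on_def)
  then show "compact (closure {X. ?g X \<noteq> 0})" using K K_def by simp
qed

text \<open>Function spaces are stated over \<open>lebesgue_on \<Omega>\<close>, whereas the
  translation arguments use Borel functions and \<open>lborel\<close>; this passes from one to the
  other.\<close>

lemma nn_integral_lebesgue_on_zero_extension: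
  assumes "open \<Omega>" and [measurable]: "h \<in> borel_measurable borel"
    and "\<And>X. X \<in> \<Omega> \<Longrightarrow> h X = k X" "\<And>X. X \<notin> \<Omega> \<Longrightarrow> h X = 0"
  shows "(\<integral>\<^sup>+X. k X \<partial>lebesgue_on \<Omega>) = (\<integral>\<^sup>+X. h X \<partial>lborel)"
proof -
  have [simp]: "\<Omega> \<in> sets lebesgue" using \<open>open \<Omega>\<close> by (simp add: sets_completionI_sets)
  have "(\<integral>\<^sup>+X. k X \<partial>lebesgue_on \<Omega>) = (\<integral>\<^sup>+X. k X * indicator \<Omega> X \<partial>lebesgue)"
    by (subst nn_integral_restrict_space) auto
  also have "\<dots> = (\<integral>\<^sup>+X. h X \<partial>lebesgue)"
    using assms by (intro nn_integral_cong) (auto simp: indicator_def)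
  also have "\<dots> = (\<integral>\<^sup>+X. h X \<partial>lborel)"
    by (rule nn_integral_completion)
  finally show ?thesis .
qed

text \<open>Extend by zero and let the lowest level \<open>1 / real (Suc n)\<close> tend to 0 in
  \<open>sobolev_approx\<close>. The measure \<open>V\<close> of the support is finite and
  independent of \<open>n\<close>, so the error vanishes. The constant does not depend on
  \<open>\<Omega>\<close>.\<close>

lemma grushin_sobolev:
  fixes \<psi> :: "'m::finite point \<Rightarrow> real" and lam Q E :: real
  assumes "open \<Omega>" "bounded \<Omega>" and \<psi>: "\<psi> \<in> C1_0 \<Omega>"
    and "lam \<ge> 0" and Q: "Q = 1 + (1 + lam) * CARD('m)" and "Q > 2" and "E \<ge> 0"
    and nonneg: "\<And>X. X \<in> \<Omega> \<Longrightarrow> 0 \<le> \<psi> X"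
    and E: "(\<integral>\<^sup>+X. ennreal ((norm (grushin_sqrtA lam X (grad \<psi> X)))\<^sup>2) \<partial>lebesgue_on \<Omega>) \<le> ennreal E"
  shows "(\<integral>\<^sup>+X. ennreal (\<psi> X powr (2 * Q / (Q - 2))) \<partial>lebesgue_on \<Omega>)
    \<le> ennreal (sobolev_const CARD('m) Q * E powr (Q / (Q - 2)))"
proof -
  define q where "q = 2 * Q / (Q - 2)"
  have "q > 0" using \<open>Q > 2\<close> by (simp add: q_def)
  define g where "g X = (if X \<in> \<Omega> then \<psi> X else 0)" for X
  define D where "D X = (if X \<in> \<Omega> then grad \<psi> X else 0)" for X
  have g: "GDERIV g X :> D X" for X
    using C1_0_zero_extension(1)[OF \<open>open \<Omega>\<close> \<psi>] by (simp add: g_def [abs_def] D_def)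
  have D: "continuous_on UNIV D"
    using C1_0_zero_extension(2)[OF \<open>open \<Omega>\<close> \<psi>] by (simp add: D_def [abs_def])
  have cg: "continuous_on UNIV g" using g by (rule GDERIV_imp_continuous_on)
  have [measurable]: "g \<in> borel_measurable borel" "D \<in> borel_measurable borel"
    by (auto intro!: borel_measurable_continuous_onI cg D)
  have g0: "0 \<le> g X" for X using nonneg by (simp add: g_def)
  define K where "K = closure {X. g X \<noteq> 0}"
  have K: "compact K"
    using C1_0_zero_extension(3)[OF \<open>open \<Omega>\<close> \<psi>] by (simp add: K_def g_def)
  have gK: "X \<notin> K \<Longrightarrow> g X = 0" for X
    using closure_subset[of "{X. g X \<noteq> 0}"] by (auto simp: K_def)
  have "compact (g ` K)"
    using K cg by (intro compact_continuous_image) (auto intro: continuous_on_subset)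
  then obtain B where "\<forall>z\<in>g ` K. norm z \<le> B"
    using bounded_iff[of "g ` K"] by (blast dest: compact_imp_bounded)
  then have B: "g X \<le> max B 0" for X
    using gK[of X] by (cases "X \<in> K") (auto simp: le_max_iff_disj)
  define V where "V = measure lborel K"
  have "emeasure lborel K < \<infinity>" using K by (intro emeasure_bounded_finite compact_imp_bounded) 
  then have "emeasure lborel K = ennreal V"
    unfolding V_def by (intro emeasure_eq_ennreal_measure) auto
  moreover have "emeasure lborel {X. g X \<noteq> 0} \<le> emeasure lborel K"
    using gK K by (intro emeasure_mono) (auto intro: borel_compact)
  ultimately have V: "emeasure lborel {X. g X \<noteq> 0} \<le> ennreal V" "V \<ge> 0"
    by (auto simp: V_def)
  have e: "(\<integral>\<^sup>+X. ennreal ((norm (grushin_sqrtA lam X (D X)))\<^sup>2) \<partial>lborel) \<le> ennreal E"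
  proof -
    have "(\<integral>\<^sup>+X. ennreal ((norm (grushin_sqrtA lam X (grad \<psi> X)))\<^sup>2) \<partial>lebesgue_on \<Omega>)
        = (\<integral>\<^sup>+X. ennreal ((norm (grushin_sqrtA lam X (D X)))\<^sup>2) \<partial>lborel)"
    proof (rule nn_integral_lebesgue_on_zero_extension[OF \<open>open \<Omega>\<close>])
      show "(\<lambda>X. ennreal ((norm (grushin_sqrtA lam X (D X)))\<^sup>2)) \<in> borel_measurable borel"
        by measurable
    qed (auto simp: D_def grushin_sqrtA_def)
    then show ?thesis using E by simp
  qed
  have "(\<integral>\<^sup>+X. ennreal (\<psi> X powr q) \<partial>lebesgue_on \<Omega>) = (\<integral>\<^sup>+X. ennreal (g X powr q) \<partial>lborel)"
  proof (rule nn_integral_lebesgue_on_zero_extension[OF \<open>open \<Omega>\<close>])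
    show "(\<lambda>X. ennreal (g X powr q)) \<in> borel_measurable borel" by measurable
  qed (auto simp: g_def)
  also have "\<dots> \<le> ennreal (sobolev_const CARD('m) Q * E powr (Q / (Q - 2)))"
  proof (rule tendsto_lowerbound)
    let ?F = "\<lambda>n. ennreal (sobolev_const CARD('m) Q * E powr (Q / (Q - 2))
        + (1 / real (Suc n)) powr q * (V + 2 * 2 powr q * V))"
    show "\<forall>\<^sub>F n in sequentially. (\<integral>\<^sup>+X. ennreal (g X powr q) \<partial>lborel) \<le> ?F n"
      unfolding q_def
      by (intro always_eventually allI sobolev_approx[where D = D, OF g D _ _ _ _ _ _ _ B])
         (use assms V e g0 in auto)
    have "(\<lambda>n. (1 / real (Suc n)) powr q) \<longlonglongrightarrow> 0 powr q"
      using \<open>q > 0\<close> by (intro tendsto_powr'[OF LIMSEQ_Suc[OF lim_1_over_n] tendsto_const]) auto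
    then have "(\<lambda>n. sobolev_const CARD('m) Q * E powr (Q / (Q - 2))
        + (1 / real (Suc n)) powr q * (V + 2 * 2 powr q * V))
        \<longlonglongrightarrow> sobolev_const CARD('m) Q * E powr (Q / (Q - 2)) + 0 powr q * (V + 2 * 2 powr q * V)"
      by (intro tendsto_add tendsto_mult tendsto_const)
    then show "?F \<longlonglongrightarrow> ennreal (sobolev_const CARD('m) Q * E powr (Q / (Q - 2)))"
      by (intro tendsto_ennrealI) simp
  qed simp
  finally show ?thesis by (simp add: q_def)
qed

section \<open>Testing the weak equation\<close>

lemma C1_0_compose:
  fixes \<phi> :: "'a::euclidean_space \<Rightarrow> real"
  assumes "\<phi> \<in> C1_0 \<Omega>" and F: "\<And>t. (F has_real_derivative F' t) (at t)"
    and F': "continuous_on UNIV F'" and "F 0 = 0"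
  shows "(\<lambda>X. F (\<phi> X)) \<in> C1_0 \<Omega>"
    and "X \<in> \<Omega> \<Longrightarrow> grad (\<lambda>X. F (\<phi> X)) X = F' (\<phi> X) *\<^sub>R grad \<phi> X"
proof -
  have \<phi>: "\<phi> \<in> C1 \<Omega>" and supp: "support_on \<Omega> \<phi> \<Subset> \<Omega>"
    using assms(1) by (auto simp: C1_0_def)
  have gd: "GDERIV (\<lambda>X. F (\<phi> X)) X :> F' (\<phi> X) *\<^sub>R grad \<phi> X" if "X \<in> \<Omega>" for X
    using C1_GDERIV[OF \<phi> that] F by (rule GDERIV_compose_real)
  show "X \<in> \<Omega> \<Longrightarrow> grad (\<lambda>X. F (\<phi> X)) X = F' (\<phi> X) *\<^sub>R grad \<phi> X"
    by (rule grad_eq[OF gd])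
  have "continuous_on \<Omega> \<phi>"
    using C1_GDERIV[OF \<phi>] by (meson GDERIV_imp_differentiable continuous_at_imp_continuous_on
        differentiable_imp_continuous_within)
  then have "continuous_on \<Omega> (\<lambda>X. F' (\<phi> X) *\<^sub>R grad \<phi> X)"
    using \<phi> by (intro continuous_intros continuous_on_compose2[OF F']) (auto simp: C1_def)
  then have "(\<lambda>X. F (\<phi> X)) \<in> C1 \<Omega>"
    using gd by (intro C1I)
  moreover have "support_on \<Omega> (\<lambda>X. F (\<phi> X)) \<Subset> \<Omega>"
  proof -
    have sub: "closure (support_on \<Omega> (\<lambda>X. F (\<phi> X))) \<subseteq> closure (support_on \<Omega> \<phi>)"
      using \<open>F 0 = 0\<close> by (intro closure_mono) (auto simp: support_on_def)
    moreover have "compact (closure (support_on \<Omega> \<phi>) \<inter> closure (support_on \<Omega> (\<lambda>X. F (\<phi> X))))"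
      using supp by (intro compact_Int_closed) (auto simp: compactly_inside_def)
    moreover have "closure (support_on \<Omega> \<phi>) \<inter> closure (support_on \<Omega> (\<lambda>X. F (\<phi> X)))
        = closure (support_on \<Omega> (\<lambda>X. F (\<phi> X)))"
      using sub by blast
    ultimately show ?thesis using supp by (auto simp: compactly_inside_def)
  qed
  ultimately show "(\<lambda>X. F (\<phi> X)) \<in> C1_0 \<Omega>"
    by (simp add: C1_0_def)
qed

text \<open>The weak quasi-gradient involves \<open>grushin_sqrtA_inv\<close>, which inverts
  \<open>grushin_sqrtA\<close> only off this hyperplane.\<close>

lemma AE_fst_nonzero:
  fixes \<Omega> :: "'m::finite point set"
  assumes "\<Omega> \<in> sets lebesgue"
  shows "AE X in lebesgue_on \<Omega>. fst X \<noteq> 0"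
proof -
  have "(1, 0) \<in> (Basis :: 'm point set)" by (simp add: Basis_prod_def)
  then have "negligible {X :: 'm point. X \<bullet> (1, 0) = 0}"
    by (rule negligible_standard_hyperplane)
  then have "{X :: 'm point. fst X = 0} \<in> null_sets lebesgue"
    by (simp add: negligible_iff_null_sets inner_prod_def)
  then have "AE X in lebesgue. X \<notin> {X :: 'm point. fst X = 0}"
    by (rule AE_not_in)
  then show ?thesis
    using assms by (auto simp: AE_restrict_space_iff elim: eventually_mono)
qed

lemma grushin_sqrtA_adjoint:
  "grushin_sqrtA lam X V \<bullet> W = V \<bullet> grushin_sqrtA lam X W"
  by (simp add: grushin_sqrtA_def inner_prod_def)

section \<open>Square integrable functions and measurability on the domain\<close>

lemma integrable_inner_of_square:
  fixes U V :: "'a \<Rightarrow> 'b::euclidean_space"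
  assumes [measurable]: "U \<in> borel_measurable M" "V \<in> borel_measurable M"
    and "integrable M (\<lambda>X. (norm (U X))\<^sup>2)" "integrable M (\<lambda>X. (norm (V X))\<^sup>2)"
  shows "integrable M (\<lambda>X. U X \<bullet> V X)"
proof (rule Bochner_Integration.integrable_bound)
  show "integrable M (\<lambda>X. (norm (U X))\<^sup>2 + (norm (V X))\<^sup>2)"
    using assms by simp
  show "AE X in M. norm (U X \<bullet> V X) \<le> norm ((norm (U X))\<^sup>2 + (norm (V X))\<^sup>2)"
  proof (rule AE_I2)
    fix X
    have "\<bar>U X \<bullet> V X\<bar> \<le> norm (U X) * norm (V X)" by (rule Cauchy_Schwarz_ineq2)
    also have "\<dots> \<le> (norm (U X))\<^sup>2 + (norm (V X))\<^sup>2"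
      using sum_squares_bound[of "norm (U X)" "norm (V X)"]
        mult_nonneg_nonneg[OF norm_ge_zero[of "U X"] norm_ge_zero[of "V X"]]
      by linarith
    finally show "norm (U X \<bullet> V X) \<le> norm ((norm (U X))\<^sup>2 + (norm (V X))\<^sup>2)"
      by simp
  qed
qed measurable

lemma Lp2_iff:
  "u \<in> Lp 2 \<Omega> \<longleftrightarrow> u \<in> borel_measurable (lebesgue_on \<Omega>) \<and> integrable (lebesgue_on \<Omega>) (\<lambda>X. (norm (u X))\<^sup>2)"
  by (simp add: Lp_def)

lemma integrable_square_diff:
  fixes U V :: "'a \<Rightarrow> 'b::euclidean_space"
  assumes [measurable]: "U \<in> borel_measurable M" "V \<in> borel_measurable M"
    and "integrable M (\<lambda>X. (norm (U X))\<^sup>2)" "integrable M (\<lambda>X. (norm (V X))\<^sup>2)"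
  shows "integrable M (\<lambda>X. (norm (U X - V X))\<^sup>2)"
proof -
  have "integrable M (\<lambda>X. (norm (U X))\<^sup>2 + (norm (V X))\<^sup>2 - 2 * (U X \<bullet> V X))"
    using integrable_inner_of_square[OF assms] assms by simp
  moreover have "(norm (U X - V X))\<^sup>2 = (norm (U X))\<^sup>2 + (norm (V X))\<^sup>2 - 2 * (U X \<bullet> V X)" for X
    by (simp add: power2_norm_eq_inner inner_diff inner_commute)
  ultimately show ?thesis by simp
qed

text \<open>Integrate \<open>\<bar>d\<bar> \<le> \<delta> + d\<^sup>2 / \<delta>\<close> with
  \<open>\<delta>\<close> close to the L2 norm of \<open>d\<close>; the measure being finite, both
  terms are of order \<open>\<delta>\<close>.\<close>

lemma tendsto_L1_of_L2:
  fixes d :: "nat \<Rightarrow> 'a \<Rightarrow> real"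
  assumes M: "finite_measure M" and [measurable]: "\<And>n. d n \<in> borel_measurable M"
    and int: "\<And>n. integrable M (\<lambda>X. (d n X)\<^sup>2)"
    and lim: "(\<lambda>n. \<integral>X. (d n X)\<^sup>2 \<partial>M) \<longlonglongrightarrow> 0"
  shows "integrable M (d n)" and "(\<lambda>n. \<integral>X. \<bar>d n X\<bar> \<partial>M) \<longlonglongrightarrow> 0"
proof -
  interpret finite_measure M by (rule M)
  show int1: "integrable M (d n)" for n
    by (rule square_integrable_imp_integrable[OF _ int]) measurable
  define I where "I n = (\<integral>X. (d n X)\<^sup>2 \<partial>M)" for n
  have I0: "0 \<le> I n" for n by (simp add: I_def)
  \<comment> \<open>The extra \<open>1 / real (Suc n)\<close> keeps \<open>\<delta> n\<close>
    positive even if \<open>d n\<close> vanishes a.e.\<close>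
  define \<delta> where "\<delta> n = sqrt (I n + 1 / real (Suc n))" for n
  have "0 < I n + 1 / real (Suc n)" for n
    using I0[of n] by (simp add: add_nonneg_pos)
  then have \<delta>: "\<delta> n > 0" "(\<delta> n)\<^sup>2 = I n + 1 / real (Suc n)" for n
    by (simp_all add: \<delta>_def less_imp_le)
  have "(\<lambda>n. I n + 1 / real (Suc n)) \<longlonglongrightarrow> 0 + 0"
    using lim unfolding I_def by (intro tendsto_add LIMSEQ_Suc[OF lim_1_over_n])
  then have "\<delta> \<longlonglongrightarrow> sqrt 0"
    unfolding \<delta>_def by (intro tendsto_real_sqrt) simp
  then have lim\<delta>: "(\<lambda>n. \<delta> n * (measure M (space M) + 1)) \<longlonglongrightarrow> 0"
    by (auto intro!: tendsto_eq_intros)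
  have upper: "(\<integral>X. \<bar>d n X\<bar> \<partial>M) \<le> \<delta> n * (measure M (space M) + 1)" for n
  proof -
    have "(\<integral>X. \<bar>d n X\<bar> \<partial>M) \<le> (\<integral>X. \<delta> n + (1 / \<delta> n) * (d n X)\<^sup>2 \<partial>M)"
    proof (rule integral_mono)
      fix X
      have "0 \<le> (\<bar>d n X\<bar> - \<delta> n)\<^sup>2 + \<delta> n * \<bar>d n X\<bar>" using \<delta>(1)[of n] by simp
      then have "\<bar>d n X\<bar> * \<delta> n \<le> (\<delta> n)\<^sup>2 + (d n X)\<^sup>2"
        by (simp add: power2_diff algebra_simps)
      then show "\<bar>d n X\<bar> \<le> \<delta> n + 1 / \<delta> n * (d n X)\<^sup>2"
        using \<delta>(1)[of n] by (simp add: field_simps power2_eq_square)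
    qed (use int int1 in auto)
    also have "\<dots> = \<delta> n * measure M (space M) + (1 / \<delta> n) * I n"
      using int by (simp add: I_def)
    also have "(1 / \<delta> n) * I n \<le> (1 / \<delta> n) * (\<delta> n)\<^sup>2"
      using \<delta>(1)[of n] by (intro mult_left_mono) (auto simp: \<delta>(2))
    also have "(1 / \<delta> n) * (\<delta> n)\<^sup>2 = \<delta> n"
      using \<delta>(1)[of n] by (simp add: power2_eq_square)
    finally show ?thesis by (simp add: algebra_simps)
  qed
  show "(\<lambda>n. \<integral>X. \<bar>d n X\<bar> \<partial>M) \<longlonglongrightarrow> 0"
    by (rule tendsto_sandwich[OF _ _ tendsto_const lim\<delta>]) (auto intro!: always_eventually upper)
qed

lemma finite_measure_lebesgue_on:
  fixes \<Omega> :: "'a::euclidean_space set"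
  assumes "open \<Omega>" "bounded \<Omega>"
  shows "finite_measure (lebesgue_on \<Omega>)"
proof
  have "emeasure lborel \<Omega> < \<infinity>" using \<open>bounded \<Omega>\<close> by (rule emeasure_bounded_finite)
  then show "emeasure (lebesgue_on \<Omega>) (space (lebesgue_on \<Omega>)) \<noteq> \<infinity>"
    using \<open>open \<Omega>\<close> by (simp add: emeasure_restrict_space sets_completionI_sets emeasure_completion)
qed

text \<open>Lebesgue measure is complete. This is needed because quasi-gradients and pointwise
  limits are prescribed only almost everywhere.\<close>

lemma borel_measurable_lebesgue_on_AE:
  fixes f g :: "'a::euclidean_space \<Rightarrow> 'b::euclidean_space"
  assumes S: "S \<in> sets lebesgue" and f: "f \<in> borel_measurable (lebesgue_on S)"
    and ae: "AE x in lebesgue_on S. f x = g x"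
  shows "g \<in> borel_measurable (lebesgue_on S)"
proof -
  have "(\<lambda>x. indicator S x *\<^sub>R f x) \<in> borel_measurable lebesgue"
    using f S by (simp add: borel_measurable_restrict_space_iff)
  moreover have "AE x in lebesgue. indicator S x *\<^sub>R f x = indicator S x *\<^sub>R g x"
    using ae S by (auto simp: AE_restrict_space_iff indicator_def elim!: eventually_mono)
  ultimately have "(\<lambda>x. indicator S x *\<^sub>R g x) \<in> borel_measurable lebesgue"
    by (rule borel_measurable_AE)
  then show ?thesis
    using S by (simp add: borel_measurable_restrict_space_iff)
qed

text \<open>The gradient of \<open>\<Phi> (\<phi>)\<close> carries the weight
  \<open>(p \<phi>)\<^sup>2\<close>, the same weight that occurs in the energy density of
  \<open>\<Psi> (\<phi>)\<close>. The equation controls the weighted integral of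
  \<open>V \<bullet> U\<close>, with \<open>V\<close> the scaled gradient of \<open>\<phi>\<close>
  and \<open>U\<close> its L2 limit; replacing \<open>V \<bullet> U\<close> by the square of
  \<open>V\<close> costs a factor 2 and an error that vanishes along the approximating
  sequence.\<close>

lemma tested_energy_bound:
  fixes \<phi> :: "'m::finite point \<Rightarrow> real" and U :: "'m point \<Rightarrow> 'm point"
  assumes \<Omega>: "open \<Omega>" "bounded \<Omega>" and \<phi>: "\<phi> \<in> C1_0 \<Omega>" and "\<phi> \<in> borel_measurable (lebesgue_on \<Omega>)"
    and V: "(\<lambda>X. grushin_sqrtA lam X (grad \<phi> X)) \<in> Lp 2 \<Omega>" and U: "U \<in> Lp 2 \<Omega>"
    and G: "AE X in lebesgue_on \<Omega>. G X = grushin_sqrtA_inv lam X (U X)"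
    and eq: "weak_equation lam \<Omega> G h"
    and p: "continuous_on UNIV p" "\<And>t. \<bar>p t\<bar> \<le> L"
    and \<Psi>: "\<And>t. (\<Psi> has_real_derivative p t) (at t)" "\<Psi> 0 = 0"
    and \<Phi>: "\<And>t. (\<Phi> has_real_derivative (p t)\<^sup>2) (at t)" "\<Phi> 0 = 0"
  shows "(\<integral>\<^sup>+X. ennreal ((norm (grushin_sqrtA lam X (grad (\<lambda>X. \<Psi> (\<phi> X)) X)))\<^sup>2) \<partial>lebesgue_on \<Omega>)
    \<le> ennreal (2 * (\<integral>X. h X * \<Phi> (\<phi> X) \<partial>lebesgue_on \<Omega>)
        + L\<^sup>2 * (\<integral>X. (norm (grushin_sqrtA lam X (grad \<phi> X) - U X))\<^sup>2 \<partial>lebesgue_on \<Omega>))"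
proof -
  let ?M = "lebesgue_on \<Omega>"
  have \<Omega>_sets: "\<Omega> \<in> sets lebesgue" using \<Omega> by (simp add: sets_completionI_sets)
  have space: "space ?M = \<Omega>" by simp
  define V where "V X = grushin_sqrtA lam X (grad \<phi> X)" for X
  define P where "P X = (p (\<phi> X))\<^sup>2" for X
  have [measurable]: "p \<in> borel_measurable borel" using p(1) by (rule borel_measurable_continuous_onI)
  have [measurable]: "\<phi> \<in> borel_measurable ?M" "V \<in> borel_measurable ?M" "U \<in> borel_measurable ?M"
    using assms by (auto simp: Lp2_iff V_def [abs_def])
  have P_meas [measurable]: "P \<in> borel_measurable ?M" unfolding P_def by measurable
  have sq: "integrable ?M (\<lambda>X. (norm (V X))\<^sup>2)" "integrable ?M (\<lambda>X. (norm (U X))\<^sup>2)"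
    using assms by (auto simp: Lp2_iff V_def)
  have VU: "integrable ?M (\<lambda>X. V X \<bullet> U X)"
    using sq by (intro integrable_inner_of_square) auto
  have VmU: "integrable ?M (\<lambda>X. (norm (V X - U X))\<^sup>2)"
    using sq by (intro integrable_square_diff) auto
  have P_bound: "P X \<le> L\<^sup>2" "0 \<le> P X" for X
    using p(2)[of "\<phi> X"] power_mono[of "\<bar>p (\<phi> X)\<bar>" L 2] by (auto simp: P_def)
  have bdd: "integrable ?M (\<lambda>X. P X * g X)" if [measurable]: "g \<in> borel_measurable ?M" and "integrable ?M g" for g
  proof (rule Bochner_Integration.integrable_bound)
    show "integrable ?M (\<lambda>X. L\<^sup>2 * g X)" using that by simp
    show "AE X in ?M. norm (P X * g X) \<le> norm (L\<^sup>2 * g X)"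
      using P_bound by (intro AE_I2) (auto simp: abs_mult intro!: mult_right_mono)
  qed measurable
  have "(\<lambda>X. \<Phi> (\<phi> X)) \<in> C1_0 \<Omega>"
    and grad\<Phi>: "\<And>X. X \<in> \<Omega> \<Longrightarrow> grad (\<lambda>X. \<Phi> (\<phi> X)) X = P X *\<^sub>R grad \<phi> X"
    using C1_0_compose[OF \<phi> \<Phi>(1) _ \<Phi>(2)] p(1) by (auto simp: P_def intro!: continuous_intros)
  then have "(\<integral>X. grushin_A lam X (G X) \<bullet> grad (\<lambda>X. \<Phi> (\<phi> X)) X \<partial>?M) = (\<integral>X. h X * \<Phi> (\<phi> X) \<partial>?M)"
    using eq by (auto simp: weak_equation_def)
  moreover have "(\<integral>X. grushin_A lam X (G X) \<bullet> grad (\<lambda>X. \<Phi> (\<phi> X)) X \<partial>?M) = (\<integral>X. P X * (V X \<bullet> U X) \<partial>?M)"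
  proof -
    have "AE X in ?M. X \<in> \<Omega>" by (rule AE_I2) (simp add: space)
    \<comment> \<open>Write \<open>grushin_A\<close> as the square of \<open>grushin_sqrtA\<close>
      and move one factor to the test gradient. Off \<open>fst X = 0\<close> the other factor turns
      \<open>G X\<close> back into \<open>U X\<close>.\<close>
    then have ae: "AE X in ?M. P X * (V X \<bullet> U X) = grushin_A lam X (G X) \<bullet> grad (\<lambda>X. \<Phi> (\<phi> X)) X"
      using G AE_fst_nonzero[OF \<Omega>_sets]
    proof eventually_elim
      case (elim X)
      then show ?case
        using grushin_sqrtA_adjoint[of lam X "U X" "grad \<phi> X"]
        by (simp add: grad\<Phi> grushin_sqrtA_inverse V_def inner_commute flip: grushin_sqrtA_square)
    qed
    have m: "(\<lambda>X. P X * (V X \<bullet> U X)) \<in> borel_measurable ?M" by measurable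
    show ?thesis
      by (rule integral_cong_AE[OF m borel_measurable_lebesgue_on_AE[OF \<Omega>_sets m ae] ae, symmetric])
  qed
  ultimately have test: "(\<integral>X. P X * (V X \<bullet> U X) \<partial>?M) = (\<integral>X. h X * \<Phi> (\<phi> X) \<partial>?M)" by simp
  have "(\<integral>\<^sup>+X. ennreal ((norm (grushin_sqrtA lam X (grad (\<lambda>X. \<Psi> (\<phi> X)) X)))\<^sup>2) \<partial>?M)
      = (\<integral>\<^sup>+X. ennreal (P X * (norm (V X))\<^sup>2) \<partial>?M)"
    using C1_0_compose(2)[OF \<phi> \<Psi>(1) p(1) \<Psi>(2)]
    by (intro nn_integral_cong) (simp add: space grushin_sqrtA_scaleR P_def V_def power_mult_distrib)
  also have "\<dots> = ennreal (\<integral>X. P X * (norm (V X))\<^sup>2 \<partial>?M)"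
    using P_bound sq by (intro nn_integral_eq_integral bdd) auto
  also have "\<dots> \<le> ennreal (2 * (\<integral>X. h X * \<Phi> (\<phi> X) \<partial>?M) + L\<^sup>2 * (\<integral>X. (norm (V X - U X))\<^sup>2 \<partial>?M))"
  proof (rule ennreal_leI)
    have "(\<integral>X. P X * (norm (V X))\<^sup>2 \<partial>?M) \<le> (\<integral>X. 2 * (P X * (V X \<bullet> U X)) + L\<^sup>2 * (norm (V X - U X))\<^sup>2 \<partial>?M)"
    proof (rule integral_mono)
      fix X
      \<comment> \<open>Expanding the square on the right leaves the surplus
        \<open>(norm (U X))\<^sup>2\<close>, which is dropped.\<close>
      have "(norm (V X))\<^sup>2 \<le> 2 * (V X \<bullet> U X) + (norm (V X - U X))\<^sup>2"
        by (simp add: power2_norm_eq_inner inner_diff inner_commute)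
      then have "P X * (norm (V X))\<^sup>2 \<le> P X * (2 * (V X \<bullet> U X) + (norm (V X - U X))\<^sup>2)"
        by (intro mult_left_mono P_bound)
      also have "\<dots> \<le> 2 * (P X * (V X \<bullet> U X)) + L\<^sup>2 * (norm (V X - U X))\<^sup>2"
        using P_bound(1)[of X] by (simp add: algebra_simps mult_left_mono mult_right_mono)
      finally show "P X * (norm (V X))\<^sup>2 \<le> 2 * (P X * (V X \<bullet> U X)) + L\<^sup>2 * (norm (V X - U X))\<^sup>2" .
      show "integrable ?M (\<lambda>X. 2 * (P X * (V X \<bullet> U X)) + L\<^sup>2 * (norm (V X - U X))\<^sup>2)"
        using bdd[OF _ VU] VmU by simp
    qed (use sq bdd in auto)
    also have "\<dots> = 2 * (\<integral>X. h X * \<Phi> (\<phi> X) \<partial>?M) + L\<^sup>2 * (\<integral>X. (norm (V X - U X))\<^sup>2 \<partial>?M)"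
      using VU VmU bdd[OF _ VU] by (simp add: test)
    finally show "(\<integral>X. P X * (norm (V X))\<^sup>2 \<partial>?M)
      \<le> 2 * (\<integral>X. h X * \<Phi> (\<phi> X) \<partial>?M) + L\<^sup>2 * (\<integral>X. (norm (V X - U X))\<^sup>2 \<partial>?M)" .
  qed
  finally show ?thesis by (simp add: V_def)
qed

text \<open>Apply the Sobolev inequality to \<open>\<Psi> (\<phi> n)\<close> with the energy bound
  of \<open>tested_energy_bound\<close> and let \<open>n\<close> grow. On the right \<open>h\<close>
  is bounded and \<open>\<Phi>\<close> is Lipschitz, so L1 convergence of \<open>\<phi> n\<close>
  suffices. On the left Fatou's lemma is used along a subsequence converging a.e. The bounds
  \<open>H\<close> and \<open>L\<close> justify the limit but do not enter the conclusion.\<close>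

lemma sobolev_weak_equation:
  fixes w :: "'m::finite point \<Rightarrow> real" and lam Q :: real
  assumes \<Omega>: "open \<Omega>" "bounded \<Omega>" and "lam \<ge> 0" and Q: "Q = 1 + (1 + lam) * CARD('m)" "Q > 2"
    and G: "quasi_gradient_H1_0 lam \<Omega> w G" and eq: "weak_equation lam \<Omega> G h"
    and h: "h \<in> borel_measurable (lebesgue_on \<Omega>)" "AE X in lebesgue_on \<Omega>. \<bar>h X\<bar> \<le> H"
    and p: "continuous_on UNIV p" "\<And>t. 0 \<le> p t" "\<And>t. p t \<le> L" "\<And>t. t \<le> 0 \<Longrightarrow> p t = 0"
    and \<Psi>: "\<And>t. (\<Psi> has_real_derivative p t) (at t)" "\<Psi> 0 = 0"
    and \<Phi>: "\<And>t. (\<Phi> has_real_derivative (p t)\<^sup>2) (at t)" "\<Phi> 0 = 0"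
  shows "(\<integral>\<^sup>+X. ennreal (\<Psi> (w X) powr (2 * Q / (Q - 2))) \<partial>lebesgue_on \<Omega>)
    \<le> ennreal (sobolev_const CARD('m) Q * (2 * (\<integral>X. h X * \<Phi> (w X) \<partial>lebesgue_on \<Omega>)) powr (Q / (Q - 2)))"
proof -
  let ?M = "lebesgue_on \<Omega>" and ?q = "2 * Q / (Q - 2)" and ?S = "sobolev_const CARD('m) Q"
  interpret finite_measure ?M using \<Omega> by (rule finite_measure_lebesgue_on)
  obtain \<phi> U where rep: "represents (C1_0 \<Omega>) (normA0 lam \<Omega>) \<Omega> \<phi> w"
    and U: "L2_limit \<Omega> (\<lambda>n X. grushin_sqrtA lam X (grad (\<phi> n) X)) U"
    and GU: "AE X in ?M. G X = grushin_sqrtA_inv lam X (U X)"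
    using G by (auto simp: quasi_gradient_H1_0_def quasi_gradient_along_def)
  have \<phi>: "\<And>n. \<phi> n \<in> C1_0 \<Omega>" and L2: "L2_limit \<Omega> \<phi> w"
    using rep by (auto simp: represents_def)
  have [measurable]: "\<phi> n \<in> borel_measurable ?M" "w \<in> borel_measurable ?M" for n
    using L2 by (auto simp: L2_limit_def Lp_def)
  note h(1) [measurable]
  define V where "V n X = grushin_sqrtA lam X (grad (\<phi> n) X)" for n X
  have mono: "\<Psi> s \<le> \<Psi> t" if "s \<le> t" for s t
    using that \<Psi>(1) p(2) by (meson DERIV_nonneg_imp_nondecreasing)
  \<comment> \<open>The approximants \<open>\<phi> n\<close> may be negative somewhere. Since
    \<open>p\<close> vanishes on the negative axis, \<open>\<Psi> (\<phi> n)\<close> is still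
    nonnegative, as \<open>grushin_sobolev\<close> requires.\<close>
  have \<Psi>_neg: "\<Psi> t = 0" if "t \<le> 0" for t
  proof (cases "t = 0")
    case False
    have "\<exists>z>t. z < 0 \<and> \<Psi> 0 - \<Psi> t = (0 - t) * p z"
      using that False \<Psi>(1) by (intro MVT2) auto
    then show ?thesis using p(4) \<Psi>(2) by force
  qed (simp add: \<Psi>)
  have \<Psi>_nonneg: "0 \<le> \<Psi> t" for t
    using mono[of 0 t] \<Psi>_neg[of t] \<Psi>(2) by (cases "t \<le> 0") auto
  have \<Phi>_lip: "\<bar>\<Phi> s - \<Phi> t\<bar> \<le> L\<^sup>2 * \<bar>s - t\<bar>" for s t
  proof -
    have "norm (\<Phi> s - \<Phi> t) \<le> L\<^sup>2 * norm (s - t)"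
    proof (rule field_differentiable_bound[of UNIV])
      show "norm ((p z)\<^sup>2) \<le> L\<^sup>2" for z
        using p(2,3)[of z] by (simp add: power_mono)
    qed (use \<Phi>(1) in auto)
    then show ?thesis by simp
  qed
  have cont: "isCont \<Psi> t" "isCont \<Phi> t" for t
    using \<Psi>(1) \<Phi>(1) by (auto intro: DERIV_isCont)
  then have [measurable]: "\<Psi> \<in> borel_measurable borel" "\<Phi> \<in> borel_measurable borel"
    by (auto intro!: borel_measurable_continuous_onI continuous_at_imp_continuous_on)
  define d where "d n X = \<phi> n X - w X" for n X
  have d_int: "integrable ?M (\<lambda>X. (d n X)\<^sup>2)" for n
    using L2 integrable_square_diff[of "\<phi> n" ?M w] by (auto simp: L2_limit_def Lp2_iff d_def)
  have d_lim: "(\<lambda>n. \<integral>X. (d n X)\<^sup>2 \<partial>?M) \<longlonglongrightarrow> 0"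
    using L2 by (simp add: L2_limit_def d_def)
  have d_meas [measurable]: "d n \<in> borel_measurable ?M" for n unfolding d_def by measurable
  note d1 = tendsto_L1_of_L2[OF finite_measure_axioms d_meas d_int d_lim]
  have w_int: "integrable ?M w"
  proof (rule square_integrable_imp_integrable)
    show "integrable ?M (\<lambda>X. (w X)\<^sup>2)" using L2 by (simp add: L2_limit_def Lp2_iff)
  qed measurable
  have h\<Phi>_int: "integrable ?M (\<lambda>X. h X * \<Phi> (g X))" if [measurable]: "g \<in> borel_measurable ?M" and "integrable ?M g" for g
  proof (rule Bochner_Integration.integrable_bound)
    show "integrable ?M (\<lambda>X. H * (L\<^sup>2 * g X))" using that by simp
    show "AE X in ?M. norm (h X * \<Phi> (g X)) \<le> norm (H * (L\<^sup>2 * g X))"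
      using h(2)
    proof eventually_elim
      case (elim X)
      have "\<bar>h X\<bar> * \<bar>\<Phi> (g X)\<bar> \<le> H * (L\<^sup>2 * \<bar>g X\<bar>)"
        using elim \<Phi>_lip[of "g X" 0] \<Phi>(2) by (intro mult_mono) auto
      also have "\<dots> \<le> \<bar>H\<bar> * (L\<^sup>2 * \<bar>g X\<bar>)" by (intro mult_right_mono) auto
      finally show ?case by (simp add: abs_mult)
    qed
  qed measurable
  have \<phi>_int: "integrable ?M (\<phi> n)" for n
  proof -
    have "integrable ?M (\<lambda>X. d n X + w X)" using d1(1) w_int by simp
    then show ?thesis by (simp add: d_def)
  qed
  have lim_h: "(\<lambda>n. \<integral>X. h X * \<Phi> (\<phi> n X) \<partial>?M) \<longlonglongrightarrow> (\<integral>X. h X * \<Phi> (w X) \<partial>?M)"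
  proof (rule LIM_zero_cancel, rule Lim_null_comparison)
    show "(\<lambda>n. \<bar>H\<bar> * L\<^sup>2 * (\<integral>X. \<bar>d n X\<bar> \<partial>?M)) \<longlonglongrightarrow> 0"
      using d1(2) by (auto intro!: tendsto_eq_intros)
    show "\<forall>\<^sub>F n in sequentially. norm ((\<integral>X. h X * \<Phi> (\<phi> n X) \<partial>?M) - (\<integral>X. h X * \<Phi> (w X) \<partial>?M))
        \<le> \<bar>H\<bar> * L\<^sup>2 * (\<integral>X. \<bar>d n X\<bar> \<partial>?M)"
    proof (intro always_eventually allI)
      fix n
      have "(\<integral>X. h X * \<Phi> (\<phi> n X) \<partial>?M) - (\<integral>X. h X * \<Phi> (w X) \<partial>?M)
          = (\<integral>X. h X * \<Phi> (\<phi> n X) - h X * \<Phi> (w X) \<partial>?M)"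
        by (rule Bochner_Integration.integral_diff[symmetric]) (auto intro!: h\<Phi>_int \<phi>_int w_int)
      also have "norm \<dots> \<le> (\<integral>X. norm (h X * \<Phi> (\<phi> n X) - h X * \<Phi> (w X)) \<partial>?M)"
        by (rule integral_norm_bound)
      also have "\<dots> \<le> (\<integral>X. \<bar>H\<bar> * L\<^sup>2 * \<bar>d n X\<bar> \<partial>?M)"
      proof (rule integral_mono_AE)
        show "integrable ?M (\<lambda>X. norm (h X * \<Phi> (\<phi> n X) - h X * \<Phi> (w X)))"
          by (intro integrable_norm Bochner_Integration.integrable_diff h\<Phi>_int \<phi>_int w_int) auto
        show "AE X in ?M. norm (h X * \<Phi> (\<phi> n X) - h X * \<Phi> (w X)) \<le> \<bar>H\<bar> * L\<^sup>2 * \<bar>d n X\<bar>"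
          using h(2)
        proof eventually_elim
          case (elim X)
          have "\<bar>h X\<bar> * \<bar>\<Phi> (\<phi> n X) - \<Phi> (w X)\<bar> \<le> \<bar>H\<bar> * (L\<^sup>2 * \<bar>\<phi> n X - w X\<bar>)"
            using elim \<Phi>_lip by (intro mult_mono) auto
          then show ?case by (simp add: d_def abs_mult flip: right_diff_distrib)
        qed
      qed (use d1(1) in auto)
      finally show "norm ((\<integral>X. h X * \<Phi> (\<phi> n X) \<partial>?M) - (\<integral>X. h X * \<Phi> (w X) \<partial>?M))
        \<le> \<bar>H\<bar> * L\<^sup>2 * (\<integral>X. \<bar>d n X\<bar> \<partial>?M)" by simp
    qed
  qed
  define E where "E n = 2 * (\<integral>X. h X * \<Phi> (\<phi> n X) \<partial>?M) + L\<^sup>2 * (\<integral>X. (norm (V n X - U X))\<^sup>2 \<partial>?M)" for n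
  have energy: "(\<integral>\<^sup>+X. ennreal ((norm (grushin_sqrtA lam X (grad (\<lambda>X. \<Psi> (\<phi> n X)) X)))\<^sup>2) \<partial>?M) \<le> ennreal (E n)" for n
    unfolding E_def V_def
    by (rule tested_energy_bound[OF \<Omega> \<phi> _ _ _ GU eq p(1) _ \<Psi> \<Phi>])
       (use U p(2,3) in \<open>auto simp: L2_limit_def\<close>)
  have E_lim: "E \<longlonglongrightarrow> 2 * (\<integral>X. h X * \<Phi> (w X) \<partial>?M)"
  proof -
    have "(\<lambda>n. \<integral>X. (norm (V n X - U X))\<^sup>2 \<partial>?M) \<longlonglongrightarrow> 0"
      using U by (simp add: L2_limit_def V_def)
    then show ?thesis
      unfolding E_def by (auto intro!: tendsto_eq_intros lim_h)
  qed
  \<comment> \<open>\<open>ennreal\<close> sends negative reals to 0, so the energy bound persists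
    with \<open>max 0 (E n)\<close>, which meets the sign condition of the Sobolev
    inequality.\<close>
  have sob: "(\<integral>\<^sup>+X. ennreal (\<Psi> (\<phi> n X) powr ?q) \<partial>?M) \<le> ennreal (?S * (max 0 (E n)) powr (Q / (Q - 2)))" for n
  proof (rule grushin_sobolev[OF \<Omega> _ \<open>lam \<ge> 0\<close> Q])
    show "(\<lambda>X. \<Psi> (\<phi> n X)) \<in> C1_0 \<Omega>"
      by (rule C1_0_compose(1)[OF \<phi> \<Psi>(1) p(1) \<Psi>(2)])
    show "(\<integral>\<^sup>+X. ennreal ((norm (grushin_sqrtA lam X (grad (\<lambda>X. \<Psi> (\<phi> n X)) X)))\<^sup>2) \<partial>?M) \<le> ennreal (max 0 (E n))"
      using energy[of n] by (rule order.trans) (intro ennreal_leI, simp)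
  qed (auto simp: \<Psi>_nonneg)
  have "\<exists>r::nat\<Rightarrow>nat. strict_mono r \<and> (AE X in ?M. (\<lambda>n. (d (r n) X)\<^sup>2) \<longlonglongrightarrow> 0)"
    using d_lim by (intro tendsto_L1_AE_subseq d_int) simp
  then obtain r :: "nat \<Rightarrow> nat" where r: "strict_mono r" "AE X in ?M. (\<lambda>n. (d (r n) X)\<^sup>2) \<longlonglongrightarrow> 0"
    by blast
  have q: "?q > 0" "Q / (Q - 2) > 0" using \<open>Q > 2\<close> by auto
  have ae: "AE X in ?M. ennreal (\<Psi> (w X) powr ?q) = liminf (\<lambda>n. ennreal (\<Psi> (\<phi> (r n) X) powr ?q))"
    using r(2)
  proof eventually_elim
    case (elim X)
    have "(\<lambda>n. \<bar>d (r n) X\<bar>) \<longlonglongrightarrow> 0"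
      using tendsto_real_sqrt[OF elim] by simp
    then have "(\<lambda>n. d (r n) X) \<longlonglongrightarrow> 0" by (rule tendsto_rabs_zero_cancel)
    then have "(\<lambda>n. \<phi> (r n) X) \<longlonglongrightarrow> w X"
      unfolding d_def by (rule LIM_zero_cancel)
    then have "(\<lambda>n. \<Psi> (\<phi> (r n) X)) \<longlonglongrightarrow> \<Psi> (w X)"
      by (rule isCont_tendsto_compose[OF cont(1)])
    then have "(\<lambda>n. \<Psi> (\<phi> (r n) X) powr ?q) \<longlonglongrightarrow> \<Psi> (w X) powr ?q"
      using q \<Psi>_nonneg by (intro tendsto_powr' tendsto_const) auto
    then have "(\<lambda>n. ennreal (\<Psi> (\<phi> (r n) X) powr ?q)) \<longlonglongrightarrow> ennreal (\<Psi> (w X) powr ?q)"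
      by (rule tendsto_ennrealI)
    then show ?case
      by (intro lim_imp_Liminf[symmetric]) auto
  qed
  have "(\<integral>\<^sup>+X. ennreal (\<Psi> (w X) powr ?q) \<partial>?M) = (\<integral>\<^sup>+X. liminf (\<lambda>n. ennreal (\<Psi> (\<phi> (r n) X) powr ?q)) \<partial>?M)"
    by (rule nn_integral_cong_AE[OF ae])
  also have "\<dots> \<le> liminf (\<lambda>n. \<integral>\<^sup>+X. ennreal (\<Psi> (\<phi> (r n) X) powr ?q) \<partial>?M)"
    by (rule nn_integral_liminf) measurable
  also have "\<dots> \<le> liminf (\<lambda>n. ennreal (?S * (max 0 (E (r n))) powr (Q / (Q - 2))))"
    by (intro Liminf_mono always_eventually allI sob)
  also have "\<dots> = ennreal (?S * (max 0 (2 * (\<integral>X. h X * \<Phi> (w X) \<partial>?M))) powr (Q / (Q - 2)))"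
  proof (rule lim_imp_Liminf)
    have "(\<lambda>n. E (r n)) \<longlonglongrightarrow> 2 * (\<integral>X. h X * \<Phi> (w X) \<partial>?M)"
      using LIMSEQ_subseq_LIMSEQ[OF E_lim r(1)] by (simp add: o_def)
    then have "(\<lambda>n. (max 0 (E (r n))) powr (Q / (Q - 2))) \<longlonglongrightarrow> (max 0 (2 * (\<integral>X. h X * \<Phi> (w X) \<partial>?M))) powr (Q / (Q - 2))"
      using q by (intro tendsto_powr' tendsto_max tendsto_const) auto
    then show "(\<lambda>n. ennreal (?S * (max 0 (E (r n))) powr (Q / (Q - 2))))
        \<longlonglongrightarrow> ennreal (?S * (max 0 (2 * (\<integral>X. h X * \<Phi> (w X) \<partial>?M))) powr (Q / (Q - 2)))"
      by (intro tendsto_ennrealI tendsto_mult tendsto_const)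
  qed simp
  \<comment> \<open>Removing \<open>max\<close> is harmless: \<open>0 powr x\<close> is 0 and every
    value of \<open>powr\<close> is nonnegative, whatever the sign of the base.\<close>
  also have "\<dots> \<le> ennreal (?S * (2 * (\<integral>X. h X * \<Phi> (w X) \<partial>?M)) powr (Q / (Q - 2)))"
    by (intro ennreal_leI) (auto simp: max_def sobolev_const_def)
  finally show ?thesis .
qed

section \<open>Power test functions\<close>

lemma continuous_imp_antiderivative:
  fixes p :: "real \<Rightarrow> real"
  assumes "continuous_on UNIV p"
  obtains F where "\<And>t. (F has_real_derivative p t) (at t)" "F 0 = 0"
proof -
  have "\<exists>F. \<forall>x::real. - \<infinity> < ereal x \<longrightarrow> ereal x < \<infinity> \<longrightarrow> (F has_vector_derivative p x) (at x)"
    using assms by (intro einterval_antiderivative) (auto simp: continuous_on_eq_continuous_at)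
  then obtain F where "\<And>x. (F has_real_derivative p x) (at x)"
    by (auto simp: has_real_derivative_iff_has_vector_derivative)
  then have "((\<lambda>t. F t - F 0) has_real_derivative p x) (at x)" for x
    by (auto intro!: derivative_eq_intros)
  then show thesis by (rule that) simp
qed

text \<open>Truncation at \<open>K\<close> makes the derivative bounded, as admissible test
  functions demand. Up to \<open>k + K\<close> it is invisible: \<open>F\<close> is constant below
  \<open>k\<close>, where \<open>0 powr (\<beta> - 1)\<close> is 0, and beyond \<open>k\<close> it
  differs from the power by a constant, which is 0 by comparison at \<open>k\<close>.\<close>

lemma antiderivative_truncated_power:
  fixes F :: "real \<Rightarrow> real"
  assumes F: "\<And>t. (F has_real_derivative \<beta> * (min (max 0 (t - k)) K) powr (\<beta> - 1)) (at t)"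
    and "F 0 = 0" "k \<ge> 0" "K \<ge> 0" "\<beta> > 1" and t: "t \<le> k + K"
  shows "F t = (max 0 (t - k)) powr \<beta>"
proof -
  have contF: "continuous_on S F" for S
    using F by (intro continuous_at_imp_continuous_on) (auto intro: DERIV_isCont)
  have const: "F b = F a" if "a < b" "b \<le> k" for a b
  proof (rule DERIV_isconst_end[OF \<open>a < b\<close> contF])
    fix x assume "a < x" "x < b"
    then show "(F has_real_derivative 0) (at x)"
      using F[of x] that \<open>K \<ge> 0\<close> by (simp add: max_def min_def split: if_splits)
  qed
  show ?thesis
  proof (cases "t \<le> k")
    case True
    have "F t = F 0"
      using const[of t 0] const[of 0 t] \<open>t \<le> k\<close> \<open>k \<ge> 0\<close>
      by (cases t "0::real" rule: linorder_cases) auto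
    then show ?thesis using True assms by simp
  next
    case False
    have "F k = 0"
      using const[of 0 k] \<open>k \<ge> 0\<close> \<open>F 0 = 0\<close> by (cases "k = 0") auto
    have "F t - (t - k) powr \<beta> = F k - (k - k) powr \<beta>"
    proof (rule DERIV_isconst_end[where f = "\<lambda>t. F t - (t - k) powr \<beta>"])
      show "k < t" using False by simp
      show "continuous_on {k..t} (\<lambda>t. F t - (t - k) powr \<beta>)"
        using \<open>\<beta> > 1\<close> by (intro continuous_intros contF continuous_on_powr') auto
      fix x assume x: "k < x" "x < t"
      have "((\<lambda>t. (t - k) powr \<beta>) has_real_derivative \<beta> * (x - k) powr (\<beta> - 1) * 1) (at x)"
        using x by (intro DERIV_chain2[OF has_real_derivative_powr]) (auto intro!: derivative_eq_intros)
      moreover have "min (max 0 (x - k)) K = x - k" using x t by simp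
      ultimately show "((\<lambda>t. F t - (t - k) powr \<beta>) has_real_derivative 0) (at x)"
        using DERIV_diff[OF F[of x], of "\<lambda>t. (t - k) powr \<beta>"] by fastforce
    qed
    then show ?thesis using False \<open>F k = 0\<close> assms by simp
  qed
qed

text \<open>Weighted Young's inequality is applied pointwise to both functions divided by their
  integrals. Writing the second exponent as \<open>1 - 1 / r\<close> and taking \<open>z\<close>
  integrable includes the case \<open>r = 1\<close> without an infinite conjugate exponent.\<close>

lemma integral_powr_Holder:
  fixes f z :: "'a \<Rightarrow> real"
  assumes [measurable]: "f \<in> borel_measurable M" "z \<in> borel_measurable M"
    and f0: "AE X in M. 0 \<le> f X" and z0: "AE X in M. 0 \<le> z X" and "r \<ge> 1"
    and fi: "integrable M (\<lambda>X. f X powr r)" and zi: "integrable M z"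
  shows "integrable M (\<lambda>X. f X * z X powr (1 - 1 / r))"
    and "(\<integral>X. f X * z X powr (1 - 1 / r) \<partial>M)
      \<le> (\<integral>X. f X powr r \<partial>M) powr (1 / r) * (\<integral>X. z X \<partial>M) powr (1 - 1 / r)"
proof -
  define \<theta> where "\<theta> = 1 / r"
  have \<theta>: "0 < \<theta>" "\<theta> \<le> 1" using \<open>r \<ge> 1\<close> by (auto simp: \<theta>_def)
  have young: "a powr \<theta> * b powr (1 - \<theta>) \<le> \<theta> * a + (1 - \<theta>) * b" if "0 \<le> a" "0 \<le> b" for a b :: real
  proof (cases "a = 0 \<or> b = 0")
    case False
    then show ?thesis using that \<theta> by (intro Youngs_inequality_0) auto
  qed (use that \<theta> in auto)
  have fr: "(f X powr r) powr \<theta> = f X" if "0 \<le> f X" for X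
    using that \<open>r \<ge> 1\<close> by (simp add: \<theta>_def powr_powr)
  show int: "integrable M (\<lambda>X. f X * z X powr (1 - 1 / r))"
  proof (rule Bochner_Integration.integrable_bound)
    show "integrable M (\<lambda>X. \<theta> * f X powr r + (1 - \<theta>) * z X)"
      using fi zi by simp
    show "AE X in M. norm (f X * z X powr (1 - 1 / r)) \<le> norm (\<theta> * f X powr r + (1 - \<theta>) * z X)"
      using f0 z0
    proof eventually_elim
      case (elim X)
      then show ?case
        using young[of "f X powr r" "z X"] fr[of X] by (simp add: \<theta>_def)
    qed
  qed measurable
  define A where "A = (\<integral>X. f X powr r \<partial>M)"
  define B where "B = (\<integral>X. z X \<partial>M)"
  have "0 \<le> A" by (simp add: A_def)
  have "0 \<le> B" unfolding B_def by (rule integral_nonneg_AE[OF z0])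
  show "(\<integral>X. f X * z X powr (1 - 1 / r) \<partial>M)
      \<le> (\<integral>X. f X powr r \<partial>M) powr (1 / r) * (\<integral>X. z X \<partial>M) powr (1 - 1 / r)"
  \<comment> \<open>Normalization is impossible here, but the integrand vanishes a.e. For
    \<open>r = 1\<close> and \<open>B = 0\<close> this relies on \<open>0 powr 0 = 0\<close>, on
    both sides.\<close>
  proof (cases "A = 0 \<or> B = 0")
    case True
    have "AE X in M. f X * z X powr (1 - 1 / r) = 0"
    proof (cases "A = 0")
      case True
      then have "AE X in M. f X powr r = 0"
        using fi by (subst (asm) A_def, subst (asm) integral_nonneg_eq_0_iff_AE) auto
      then show ?thesis by eventually_elim simp
    next
      case False
      then have "AE X in M. z X = 0"
        using \<open>A = 0 \<or> B = 0\<close> zi z0 integral_nonneg_eq_0_iff_AE[OF zi z0] by (simp add: B_def)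
      then show ?thesis by eventually_elim simp
    qed
    then have "(\<integral>X. f X * z X powr (1 - 1 / r) \<partial>M) = 0"
      by (rule integral_eq_zero_AE)
    then show ?thesis by simp
  next
    case False
    then have pos: "A > 0" "B > 0" using \<open>0 \<le> A\<close> \<open>0 \<le> B\<close> by auto
    let ?C = "A powr \<theta> * B powr (1 - \<theta>)"
    have "(\<integral>X. f X * z X powr (1 - 1 / r) \<partial>M) \<le> (\<integral>X. ?C * (\<theta> / A * f X powr r + (1 - \<theta>) / B * z X) \<partial>M)"
    proof (rule integral_mono_AE)
      show "AE X in M. f X * z X powr (1 - 1 / r) \<le> ?C * (\<theta> / A * f X powr r + (1 - \<theta>) / B * z X)"
        using f0 z0
      proof eventually_elim
        case (elim X)
        have "f X * z X powr (1 - \<theta>) = ?C * ((f X powr r / A) powr \<theta> * (z X / B) powr (1 - \<theta>))"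
          using pos elim fr[of X] by (simp add: powr_divide)
        also have "\<dots> \<le> ?C * (\<theta> * (f X powr r / A) + (1 - \<theta>) * (z X / B))"
          using pos elim by (intro mult_left_mono young) auto
        finally show ?case by (simp add: \<theta>_def)
      qed
    qed (use int fi zi in auto)
    also have "\<dots> = ?C * (\<theta> / A * A + (1 - \<theta>) / B * B)"
      using fi zi by (simp add: A_def B_def)
    also have "\<dots> = ?C" using pos by simp
    finally show ?thesis by (simp add: A_def B_def \<theta>_def)
  qed
qed

text \<open>Choose \<open>p\<close> so that, below a bound \<open>K\<close> for \<open>w\<close>,
  \<open>\<Psi>\<close> is the power \<open>\<gamma>\<close> and \<open>\<Phi>\<close> is
  \<open>\<gamma>\<^sup>2 / (2 * \<gamma> - 1)\<close> times the power
  \<open>2 * \<gamma> - 1\<close> of the excess over \<open>k\<close>. The singular denominator is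
  at least \<open>\<tau> powr \<nu>\<close>, which lowers the exponent to
  \<open>2 * \<gamma> - 1 - \<nu>\<close>. Neither \<open>K\<close> nor \<open>n\<close> survives in
  the constants. When that exponent is 0, the factor is the indicator of \<open>w > k\<close>,
  because \<open>0 powr 0\<close> is 0.\<close>

lemma power_energy_estimate:
  fixes w f :: "'m::finite point \<Rightarrow> real" and lam Q k \<gamma> \<nu> :: real
  assumes \<Omega>: "open \<Omega>" "bounded \<Omega>" and "lam \<ge> 0" and Q: "Q = 1 + (1 + lam) * CARD('m)" "Q > 2"
    and sol: "approx_solution lam \<nu> \<Omega> f n w" and "n \<ge> 1"
    and f: "integrable (lebesgue_on \<Omega>) f" "AE X in lebesgue_on \<Omega>. 0 \<le> f X"
    and "k \<ge> 0" "\<gamma> > 1" "\<nu> > 0" "\<nu> \<le> 2 * \<gamma> - 1"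
  defines "\<tau> \<equiv> \<lambda>X. max 0 (w X - k)"
  shows "integrable (lebesgue_on \<Omega>) (\<lambda>X. f X * \<tau> X powr (2 * \<gamma> - 1 - \<nu>))"
    and "(\<integral>\<^sup>+X. ennreal (\<tau> X powr (\<gamma> * (2 * Q / (Q - 2)))) \<partial>lebesgue_on \<Omega>)
      \<le> ennreal (sobolev_const CARD('m) Q *
          (2 * \<gamma>\<^sup>2 / (2 * \<gamma> - 1) * (\<integral>X. f X * \<tau> X powr (2 * \<gamma> - 1 - \<nu>) \<partial>lebesgue_on \<Omega>)) powr (Q / (Q - 2)))"
proof -
  let ?M = "lebesgue_on \<Omega>" and ?q = "2 * Q / (Q - 2)" and ?e = "2 * \<gamma> - 1 - \<nu>"
  define h where "h X = min (f X) (real n) / (w X + 1 / real n) powr \<nu>" for X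
  obtain G C where w0: "AE X in ?M. 0 \<le> w X" and G: "quasi_gradient_H1_0 lam \<Omega> w G"
    and eq: "weak_equation lam \<Omega> G h" and w_meas [measurable]: "w \<in> borel_measurable ?M"
    and C: "AE X in ?M. norm (w X) \<le> C"
    using sol by (auto simp: approx_solution_def Linfty_def h_def [abs_def])
  define K where "K = max 1 C"
  have "K > 0" by (simp add: K_def)
  have wK: "AE X in ?M. w X \<le> K"
    using C by eventually_elim (auto simp: K_def)
  have f_meas [measurable]: "f \<in> borel_measurable ?M" using f(1) by simp
  have h_meas: "h \<in> borel_measurable ?M" unfolding h_def by measurable
  have \<tau>K: "AE X in ?M. \<tau> X \<le> K"
    using wK \<open>K > 0\<close> \<open>k \<ge> 0\<close> by (auto simp: \<tau>_def elim!: eventually_mono)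
  have \<tau>0: "0 \<le> \<tau> X" for X by (simp add: \<tau>_def)
  have [measurable]: "\<tau> \<in> borel_measurable ?M" unfolding \<tau>_def by measurable
  show int: "integrable ?M (\<lambda>X. f X * \<tau> X powr ?e)"
  proof (rule Bochner_Integration.integrable_bound)
    show "integrable ?M (\<lambda>X. K powr ?e * f X)" using f by simp
    show "AE X in ?M. norm (f X * \<tau> X powr ?e) \<le> norm (K powr ?e * f X)"
      using \<tau>K
    proof eventually_elim
      case (elim X)
      have "\<tau> X powr ?e \<le> K powr ?e"
        using elim \<tau>0 assms by (intro powr_mono2) auto
      then have "\<bar>f X\<bar> * \<tau> X powr ?e \<le> \<bar>f X\<bar> * K powr ?e"
        by (intro mult_left_mono) auto
      then show ?case by (simp add: abs_mult mult.commute)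
    qed
  qed measurable
  \<comment> \<open>This bound degenerates as \<open>n\<close> grows; it is used only to justify the
    limit in \<open>sobolev_weak_equation\<close>.\<close>
  have h0: "AE X in ?M. \<bar>h X\<bar> \<le> real n * (1 / (1 / real n) powr \<nu>)"
    using f(2) w0
  proof eventually_elim
    case (elim X)
    have "(1 / real n) powr \<nu> \<le> (w X + 1 / real n) powr \<nu>"
      using elim \<open>n \<ge> 1\<close> \<open>\<nu> > 0\<close> by (intro powr_mono2) auto
    moreover have "0 < (1 / real n) powr \<nu>" using \<open>n \<ge> 1\<close> by simp
    ultimately have "min (f X) (real n) / (w X + 1 / real n) powr \<nu> \<le> real n / (1 / real n) powr \<nu>"
      using elim by (intro frac_le) auto
    then show ?case using elim by (simp add: h_def)
  qed
  define p where "p t = \<gamma> * (min (max 0 (t - k)) K) powr (\<gamma> - 1)" for t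
  have p_cont: "continuous_on UNIV p"
    unfolding p_def using \<open>\<gamma> > 1\<close> \<open>K > 0\<close> by (intro continuous_intros continuous_on_powr') auto
  then have p2_cont: "continuous_on UNIV (\<lambda>t. (p t)\<^sup>2)" by (intro continuous_intros)
  obtain \<Psi> where \<Psi>: "\<And>t. (\<Psi> has_real_derivative p t) (at t)" "\<Psi> 0 = 0"
    using continuous_imp_antiderivative[OF p_cont] by blast
  obtain \<Phi> where \<Phi>: "\<And>t. (\<Phi> has_real_derivative (p t)\<^sup>2) (at t)" "\<Phi> 0 = 0"
    using continuous_imp_antiderivative[OF p2_cont] by blast
  have \<Psi>_eq: "\<Psi> t = (max 0 (t - k)) powr \<gamma>" if "t \<le> K" for t
    using \<Psi> that \<open>k \<ge> 0\<close> \<open>\<gamma> > 1\<close> \<open>K > 0\<close>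
    by (intro antiderivative_truncated_power[where K = K]) (auto simp: p_def)
  let ?c = "\<gamma>\<^sup>2 / (2 * \<gamma> - 1)"
  have "?c > 0" using \<open>\<gamma> > 1\<close> by simp
  have \<Phi>_eq: "\<Phi> t = ?c * (max 0 (t - k)) powr (2 * \<gamma> - 1)" if "t \<le> K" for t
  proof -
    have "\<Phi> t / ?c = (max 0 (t - k)) powr (2 * \<gamma> - 1)"
    proof (rule antiderivative_truncated_power[where K = K])
      fix s
      let ?m = "min (max 0 (s - k)) K"
      have "(?m powr (\<gamma> - 1))\<^sup>2 = ?m powr (2 * \<gamma> - 1 - 1)"
        by (simp add: power2_eq_square flip: powr_add)
      then have "(p s)\<^sup>2 / ?c = (2 * \<gamma> - 1) * ?m powr (2 * \<gamma> - 1 - 1)"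
        using \<open>\<gamma> > 1\<close> by (simp add: p_def power_mult_distrib)
      then show "((\<lambda>s. \<Phi> s / ?c) has_real_derivative (2 * \<gamma> - 1) * ?m powr (2 * \<gamma> - 1 - 1)) (at s)"
        using DERIV_cdivide[OF \<Phi>(1)[of s], of ?c] by simp
    qed (use assms that \<Phi> \<open>K > 0\<close> in auto)
    moreover have "a = c * b" if "a / c = b" "c > 0" for a b c :: real
      using that by auto
    ultimately show ?thesis using \<open>?c > 0\<close> by blast
  qed
  have main: "(\<integral>\<^sup>+X. ennreal (\<Psi> (w X) powr ?q) \<partial>?M)
    \<le> ennreal (sobolev_const CARD('m) Q * (2 * (\<integral>X. h X * \<Phi> (w X) \<partial>?M)) powr (Q / (Q - 2)))"
  proof (rule sobolev_weak_equation[OF \<Omega> \<open>lam \<ge> 0\<close> Q G eq h_meas h0 p_cont _ _ _ \<Psi> \<Phi>])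
    show "0 \<le> p t" for t using \<open>\<gamma> > 1\<close> by (simp add: p_def)
    show "p t \<le> \<gamma> * K powr (\<gamma> - 1)" for t
      unfolding p_def using \<open>\<gamma> > 1\<close> \<open>K > 0\<close> by (intro mult_left_mono powr_mono2) auto
    show "p t = 0" if "t \<le> 0" for t using that \<open>k \<ge> 0\<close> \<open>K > 0\<close> by (simp add: p_def)
  qed
  have "(\<integral>X. h X * \<Phi> (w X) \<partial>?M) \<le> (\<integral>X. ?c * (f X * \<tau> X powr ?e) \<partial>?M)"
  proof (rule integral_mono_AE')
    show "integrable ?M (\<lambda>X. ?c * (f X * \<tau> X powr ?e))" using int by simp
    show "AE X in ?M. 0 \<le> ?c * (f X * \<tau> X powr ?e)"
      using f(2) by eventually_elim (use \<open>\<gamma> > 1\<close> in simp)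
    show "AE X in ?M. h X * \<Phi> (w X) \<le> ?c * (f X * \<tau> X powr ?e)"
      using f(2) w0 wK
    proof eventually_elim
      case (elim X)
      have \<Phi>w: "\<Phi> (w X) = ?c * \<tau> X powr (2 * \<gamma> - 1)"
        using \<Phi>_eq elim by (simp add: \<tau>_def)
      show ?case
      proof (cases "\<tau> X = 0")
        case True then show ?thesis using \<Phi>w by simp
      next
        case False
        then have pos: "\<tau> X > 0" using \<tau>0[of X] by simp
        have "0 \<le> 1 / real n" by simp
        \<comment> \<open>The shift by \<open>1 / real n\<close> and the level \<open>k\<close> both
          work in the favourable direction.\<close>
        then have le: "\<tau> X \<le> w X + 1 / real n"
          using elim \<open>k \<ge> 0\<close> unfolding \<tau>_def by linarith
        have "h X \<le> f X / \<tau> X powr \<nu>"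
          unfolding h_def using pos le elim \<open>\<nu> > 0\<close> by (intro frac_le powr_mono2) auto
        then have "h X * \<Phi> (w X) \<le> f X / \<tau> X powr \<nu> * (?c * \<tau> X powr (2 * \<gamma> - 1))"
          unfolding \<Phi>w using \<open>\<gamma> > 1\<close> by (intro mult_right_mono) auto
        also have "\<dots> = ?c * (f X * (\<tau> X powr (2 * \<gamma> - 1) / \<tau> X powr \<nu>))"
          by (simp add: mult.commute mult.left_commute)
        also have "\<tau> X powr (2 * \<gamma> - 1) / \<tau> X powr \<nu> = \<tau> X powr ?e"
          by (simp add: powr_diff)
        finally show ?thesis .
      qed
    qed
  qed
  then have le: "2 * (\<integral>X. h X * \<Phi> (w X) \<partial>?M) \<le> 2 * \<gamma>\<^sup>2 / (2 * \<gamma> - 1) * (\<integral>X. f X * \<tau> X powr ?e \<partial>?M)"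
    by simp
  have nonneg: "0 \<le> (\<integral>X. h X * \<Phi> (w X) \<partial>?M)"
  proof (rule integral_nonneg_AE)
    show "AE X in ?M. 0 \<le> h X * \<Phi> (w X)"
      using f(2) w0 wK
    proof eventually_elim
      case (elim X)
      then show ?case using \<Phi>_eq \<open>\<gamma> > 1\<close> by (simp add: h_def)
    qed
  qed
  have "(\<integral>\<^sup>+X. ennreal (\<tau> X powr (\<gamma> * ?q)) \<partial>?M) = (\<integral>\<^sup>+X. ennreal (\<Psi> (w X) powr ?q) \<partial>?M)"
  proof (rule nn_integral_cong_AE)
    show "AE X in ?M. ennreal (\<tau> X powr (\<gamma> * ?q)) = ennreal (\<Psi> (w X) powr ?q)"
      using wK by eventually_elim (simp add: \<Psi>_eq \<tau>_def powr_powr)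
  qed
  also note main
  also have "ennreal (sobolev_const CARD('m) Q * (2 * (\<integral>X. h X * \<Phi> (w X) \<partial>?M)) powr (Q / (Q - 2)))
      \<le> ennreal (sobolev_const CARD('m) Q *
          (2 * \<gamma>\<^sup>2 / (2 * \<gamma> - 1) * (\<integral>X. f X * \<tau> X powr ?e \<partial>?M)) powr (Q / (Q - 2)))"
    using le nonneg \<open>Q > 2\<close>
    by (intro ennreal_leI mult_left_mono powr_mono2) (auto simp: sobolev_const_def)
  finally show "(\<integral>\<^sup>+X. ennreal (\<tau> X powr (\<gamma> * ?q)) \<partial>?M)
      \<le> ennreal (sobolev_const CARD('m) Q *
          (2 * \<gamma>\<^sup>2 / (2 * \<gamma> - 1) * (\<integral>X. f X * \<tau> X powr ?e \<partial>?M)) powr (Q / (Q - 2)))" .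
qed

section \<open>Integrability and boundedness\<close>

text \<open>As a real number \<open>Y\<close> is finite, so division by
  \<open>Y powr \<theta>\<close> is legitimate.\<close>

lemma power_absorb:
  fixes Y D \<theta> :: real
  assumes "0 \<le> Y" "Y \<le> D * Y powr \<theta>" "0 \<le> D" "\<theta> < 1"
  shows "Y \<le> D powr (1 / (1 - \<theta>))"
proof (cases "Y = 0")
  case False
  then have "Y > 0" using assms by simp
  have "Y powr (1 - \<theta>) = Y / Y powr \<theta>" using \<open>Y > 0\<close> by (simp add: powr_diff)
  also have "\<dots> \<le> D" using assms \<open>Y > 0\<close> by (simp add: pos_divide_le_eq)
  finally have "(Y powr (1 - \<theta>)) powr (1 / (1 - \<theta>)) \<le> D powr (1 / (1 - \<theta>))"
    using assms by (intro powr_mono2) auto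
  then show ?thesis using \<open>Y > 0\<close> assms by (simp add: powr_powr)
qed simp

text \<open>Along the levels \<open>d * (1 - (1 / 2) ^ i)\<close> the quantity \<open>Y\<close>
  decays like \<open>\<rho> ^ i\<close>: the loss \<open>2 powr e\<close> from halving the gaps is
  beaten by the power \<open>\<beta> > 1\<close>. By monotonicity \<open>Y d\<close> lies below all
  these values. The number \<open>d\<close> is found before \<open>Y\<close> is given, so it serves
  all approximate solutions at once.\<close>

lemma stampacchia:
  fixes D M e \<beta> :: real
  assumes "0 \<le> D" "0 \<le> M" "0 < e" "1 < \<beta>"
  obtains d where "d > 0"
    and "\<And>Y. (\<And>k. 0 \<le> Y k) \<Longrightarrow> antimono Y \<Longrightarrow> Y 0 \<le> M \<Longrightarrow>
      (\<And>h k. 0 \<le> k \<Longrightarrow> k < h \<Longrightarrow> Y h \<le> D * (h - k) powr (- e) * Y k powr \<beta>) \<Longrightarrow> Y d = (0::real)"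
proof -
  \<comment> \<open>Adding 1 to both data makes them positive, so that \<open>d > 0\<close> also
    when \<open>D\<close> or \<open>M\<close> is 0.\<close>
  define D' where "D' = D + 1"
  define N where "N = M + 1"
  \<comment> \<open>\<open>\<rho>\<close> solves
    \<open>\<rho> powr \<beta> * 2 powr e = \<rho>\<close>, and \<open>d\<close> is chosen so that
    \<open>D' * 2 powr e * N powr (\<beta> - 1) * d powr (- e) = \<rho>\<close>. These are the two
    identities that the induction step consumes.\<close>
  define \<rho> where "\<rho> = 2 powr (- (e / (\<beta> - 1)))"
  define d where "d = (D' * 2 powr e * N powr (\<beta> - 1) / \<rho>) powr (1 / e)"
  have pos: "D' > 0" "N > 0" "\<rho> > 0" using assms by (auto simp: D'_def N_def \<rho>_def)
  have "\<rho> < 2 powr 0"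
    unfolding \<rho>_def using assms by (intro powr_less_mono) auto
  then have "\<rho> < 1" by simp
  have "d > 0" using pos by (simp add: d_def)
  have de: "d powr e = D' * 2 powr e * N powr (\<beta> - 1) / \<rho>"
    using pos \<open>0 < e\<close> by (simp add: d_def powr_powr)
  have \<rho>\<beta>: "\<rho> powr \<beta> * 2 powr e = \<rho>"
  proof -
    have "\<rho> powr (\<beta> - 1) = 2 powr (- e)"
      using assms by (simp add: \<rho>_def powr_powr)
    then have "\<rho> powr (\<beta> - 1) * 2 powr e = 1" by (simp flip: powr_add)
    moreover have "\<rho> powr \<beta> = \<rho> powr (\<beta> - 1) * \<rho>"
      using pos by (simp add: powr_diff)
    ultimately show ?thesis by simp
  qed
  show thesis
  proof (rule that[OF \<open>d > 0\<close>])
    fix Y :: "real \<Rightarrow> real"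
    assume Y0: "\<And>k. 0 \<le> Y k" and "antimono Y" and YM: "Y 0 \<le> M"
      and step: "\<And>h k. 0 \<le> k \<Longrightarrow> k < h \<Longrightarrow> Y h \<le> D * (h - k) powr (- e) * Y k powr \<beta>"
    define lev where "lev i = d * (1 - (1 / 2) ^ i)" for i :: nat
    have lev: "0 \<le> lev i" "lev i < lev (Suc i)" "lev i \<le> d" "lev (Suc i) - lev i = d * (1 / 2) ^ Suc i" for i
      using \<open>d > 0\<close> by (auto simp: lev_def power_le_one algebra_simps)
    have bound: "Y (lev i) \<le> N * \<rho> ^ i" for i
    proof (induction i)
      case 0
      then show ?case using YM by (simp add: lev_def N_def)
    next
      case (Suc i)
      have two: "(2 ^ Suc i) powr e = 2 powr e * (2 powr e) ^ i"
        by (simp add: powr_mult powr_power powr_powr mult.commute flip: powr_realpow)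
      have "(d * (1 / 2) ^ Suc i) powr (- e) = d powr (- e) * ((1 / 2) ^ Suc i) powr (- e)"
        by (rule powr_mult)
      also have "((1 / 2 :: real) ^ Suc i) powr (- e) = (2 ^ Suc i) powr e"
        by (simp add: powr_minus power_one_over powr_divide)
      finally have gap: "(lev (Suc i) - lev i) powr (- e) = d powr (- e) * (2 powr e * (2 powr e) ^ i)"
        unfolding lev(4) two .
      have "Y (lev (Suc i)) \<le> D * (lev (Suc i) - lev i) powr (- e) * Y (lev i) powr \<beta>"
        by (rule step) (use lev in auto)
      also have "\<dots> \<le> D' * (lev (Suc i) - lev i) powr (- e) * (N * \<rho> ^ i) powr \<beta>"
      proof (rule mult_mono)
        show "Y (lev i) powr \<beta> \<le> (N * \<rho> ^ i) powr \<beta>"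
          using Suc Y0 assms by (intro powr_mono2) auto
        show "D * (lev (Suc i) - lev i) powr (- e) \<le> D' * (lev (Suc i) - lev i) powr (- e)"
          by (intro mult_right_mono) (auto simp: D'_def)
      qed (use pos in auto)
      also have "(N * \<rho> ^ i) powr \<beta> = N powr \<beta> * (\<rho> powr \<beta>) ^ i"
        using pos by (simp add: powr_mult powr_power powr_powr mult.commute flip: powr_realpow)
      also have "N powr \<beta> = N powr (\<beta> - 1) * N"
        using pos by (simp add: powr_diff)
      also have "D' * (lev (Suc i) - lev i) powr (- e) * (N powr (\<beta> - 1) * N * (\<rho> powr \<beta>) ^ i)
          = (D' * 2 powr e * N powr (\<beta> - 1) * d powr (- e)) * N * (\<rho> powr \<beta> * 2 powr e) ^ i"
        unfolding gap by (simp add: power_mult_distrib)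
      also have "D' * 2 powr e * N powr (\<beta> - 1) * d powr (- e) = \<rho>"
        using pos by (simp add: powr_minus de)
      finally show ?case by (simp add: \<rho>\<beta> mult.commute mult.left_commute)
    qed
    have "(\<lambda>i. N * \<rho> ^ i) \<longlonglongrightarrow> N * 0"
      using pos \<open>\<rho> < 1\<close> by (intro tendsto_mult tendsto_const LIMSEQ_realpow_zero) auto
    moreover have "Y d \<le> N * \<rho> ^ i" for i
      using bound[of i] antimonoD[OF \<open>antimono Y\<close> lev(3)[of i]] by simp
    ultimately have "Y d \<le> N * 0"
      by (intro LIMSEQ_le_const) auto
    then show "Y d = 0" using Y0[of d] by simp
  qed
qed

section \<open>Uniform bounds for the approximate solutions\<close>

lemma integrable_of_nn_integral_le:
  fixes g :: "'a \<Rightarrow> real"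
  assumes [measurable]: "g \<in> borel_measurable M" and "\<And>X. 0 \<le> g X" and "0 \<le> B"
    and le: "(\<integral>\<^sup>+X. ennreal (g X) \<partial>M) \<le> ennreal B"
  shows "integrable M g" and "(\<integral>X. g X \<partial>M) \<le> B"
proof -
  have "(\<integral>\<^sup>+X. ennreal (g X) \<partial>M) < \<infinity>" using le by (simp add: le_less_trans)
  then show int: "integrable M g"
    using assms by (intro integrableI_nonneg) auto
  show "(\<integral>X. g X \<partial>M) \<le> B"
    using le assms nn_integral_eq_integral[OF int] by simp
qed

text \<open>The exponent \<open>\<gamma>\<close> satisfies both
  \<open>\<gamma> * (2 * Q / (Q - 2)) = s\<close> and
  \<open>2 * \<gamma> - 1 - \<nu> = s * (1 - 1 / r)\<close>. Hence Holder's inequality returns the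
  quantity being estimated, raised to the power \<open>(1 - 1 / r) * \<kappa>\<close>. This power is
  below 1 exactly because \<open>r < Q / 2\<close>, and the term is absorbed. The bound is
  independent of \<open>n\<close>.\<close>

lemma approx_solution_integral_bound:
  fixes w f :: "'m::finite point \<Rightarrow> real" and lam Q r \<nu> :: real
  assumes \<Omega>: "open \<Omega>" "bounded \<Omega>" and "lam \<ge> 0" and Q: "Q = 1 + (1 + lam) * CARD('m)" "Q > 2"
    and "n \<ge> 1" and sol: "approx_solution lam \<nu> \<Omega> f n w" and "\<nu> > 1"
    and f: "integrable (lebesgue_on \<Omega>) f" "AE X in lebesgue_on \<Omega>. 0 \<le> f X"
    and fr: "integrable (lebesgue_on \<Omega>) (\<lambda>X. f X powr r)"
    and r: "1 \<le> r" "r < Q / 2"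
  defines "s \<equiv> Q * r * (\<nu> + 1) / (Q - 2 * r)"
  defines "\<gamma> \<equiv> (\<nu> + 1) * (r * (Q - 2)) / (2 * (Q - 2 * r))"
  defines "\<kappa> \<equiv> Q / (Q - 2)"
  defines "D \<equiv> sobolev_const CARD('m) Q *
    (2 * \<gamma>\<^sup>2 / (2 * \<gamma> - 1) * (\<integral>X. f X powr r \<partial>lebesgue_on \<Omega>) powr (1 / r)) powr \<kappa>"
  shows "(\<integral>\<^sup>+X. ennreal (w X powr s) \<partial>lebesgue_on \<Omega>) \<le> ennreal (D powr (1 / (1 - (1 - 1 / r) * \<kappa>)))"
proof -
  let ?M = "lebesgue_on \<Omega>"
  define \<tau> where "\<tau> X = max 0 (w X - 0)" for X
  have "Q - 2 * r > 0" "Q - 2 > 0" using r Q by auto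
  \<comment> \<open>This yields \<open>\<gamma> > 1\<close> and a nonnegative exponent
    \<open>2 * \<gamma> - 1 - \<nu>\<close>; equality holds for \<open>r = 1\<close>.\<close>
  have \<gamma>1: "(\<nu> + 1) / 2 \<le> \<gamma>"
  proof -
    have "Q * 1 \<le> Q * r" using r Q by (intro mult_left_mono) auto
    then have "1 \<le> r * (Q - 2) / (Q - 2 * r)"
      using \<open>Q - 2 * r > 0\<close> by (simp add: field_simps)
    then have "(\<nu> + 1) / 2 * 1 \<le> (\<nu> + 1) / 2 * (r * (Q - 2) / (Q - 2 * r))"
      using \<open>\<nu> > 1\<close> by (intro mult_left_mono) auto
    then show ?thesis by (simp add: \<gamma>_def)
  qed
  then have "\<gamma> > 1" using \<open>\<nu> > 1\<close> by simp
  have gq: "\<gamma> * (2 * Q / (Q - 2)) = s"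
  proof -
    have "(\<nu> + 1) * (r * b) / (2 * a) * (2 * Q / b) = Q * r * (\<nu> + 1) / a" if "a > 0" "b > 0" for a b
      using that by (simp add: field_simps)
    from this[OF \<open>Q - 2 * r > 0\<close> \<open>Q - 2 > 0\<close>] show ?thesis
      by (simp add: \<gamma>_def s_def)
  qed
  have ge: "2 * \<gamma> - 1 - \<nu> = s * (1 - 1 / r)"
  proof -
    define a where "a = Q - 2 * r"
    have "a > 0" and "Q = a + 2 * r" using \<open>Q - 2 * r > 0\<close> by (simp_all add: a_def)
    then show ?thesis
      using r by (simp add: \<gamma>_def s_def field_simps)
  qed
  have [measurable]: "w \<in> borel_measurable ?M" "f \<in> borel_measurable ?M"
    using sol f by (auto simp: approx_solution_def Linfty_def)
  have [measurable]: "\<tau> \<in> borel_measurable ?M" unfolding \<tau>_def by measurable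
  have S0: "0 \<le> sobolev_const CARD('m) Q" by (simp add: sobolev_const_def)
  have "D \<ge> 0" using S0 by (simp add: D_def)
  have est: "integrable ?M (\<lambda>X. f X * \<tau> X powr (2 * \<gamma> - 1 - \<nu>))"
    "(\<integral>\<^sup>+X. ennreal (\<tau> X powr s) \<partial>?M)
      \<le> ennreal (sobolev_const CARD('m) Q *
          (2 * \<gamma>\<^sup>2 / (2 * \<gamma> - 1) * (\<integral>X. f X * \<tau> X powr (2 * \<gamma> - 1 - \<nu>) \<partial>?M)) powr \<kappa>)"
    using power_energy_estimate[OF \<Omega> \<open>lam \<ge> 0\<close> Q sol \<open>n \<ge> 1\<close> f order_refl \<open>\<gamma> > 1\<close>] \<gamma>1 \<open>\<nu> > 1\<close>
    unfolding \<tau>_def gq \<kappa>_def by auto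
  define Y where "Y = (\<integral>X. \<tau> X powr s \<partial>?M)"
  \<comment> \<open>Finiteness of the integral of \<open>\<tau> powr s\<close> must be known before
    absorption. It comes from the energy estimate, whose right-hand side is finite because
    \<open>w\<close> is bounded, although not uniformly in \<open>n\<close>.\<close>
  have Y: "integrable ?M (\<lambda>X. \<tau> X powr s)"
    and Yle: "Y \<le> sobolev_const CARD('m) Q *
          (2 * \<gamma>\<^sup>2 / (2 * \<gamma> - 1) * (\<integral>X. f X * \<tau> X powr (2 * \<gamma> - 1 - \<nu>) \<partial>?M)) powr \<kappa>"
    using integrable_of_nn_integral_le[OF _ _ _ est(2)] S0 unfolding Y_def by auto
  have "0 \<le> Y" by (simp add: Y_def)
  have "s * (1 - 1 / r) = 2 * \<gamma> - 1 - \<nu>" by (simp add: ge)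
  then have pw: "(\<tau> X powr s) powr (1 - 1 / r) = \<tau> X powr (2 * \<gamma> - 1 - \<nu>)" for X
    by (simp add: powr_powr)
  have H: "(\<integral>X. f X * \<tau> X powr (2 * \<gamma> - 1 - \<nu>) \<partial>?M)
      \<le> (\<integral>X. f X powr r \<partial>?M) powr (1 / r) * Y powr (1 - 1 / r)"
    unfolding Y_def pw[symmetric] using f fr r Y by (intro integral_powr_Holder) auto
  have I0: "0 \<le> (\<integral>X. f X * \<tau> X powr (2 * \<gamma> - 1 - \<nu>) \<partial>?M)"
    by (rule integral_nonneg_AE) (use f(2) in \<open>auto elim: eventually_mono\<close>)
  define c where "c = 2 * \<gamma>\<^sup>2 / (2 * \<gamma> - 1)"
  have "c > 0" using \<open>\<gamma> > 1\<close> by (simp add: c_def)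
  have "\<kappa> > 0" using \<open>Q > 2\<close> by (simp add: \<kappa>_def)
  have "Y \<le> sobolev_const CARD('m) Q * (c * (\<integral>X. f X * \<tau> X powr (2 * \<gamma> - 1 - \<nu>) \<partial>?M)) powr \<kappa>"
    unfolding c_def by (rule Yle)
  also have "\<dots> \<le> sobolev_const CARD('m) Q *
      (c * ((\<integral>X. f X powr r \<partial>?M) powr (1 / r) * Y powr (1 - 1 / r))) powr \<kappa>"
    using S0 H I0 \<open>c > 0\<close> \<open>\<kappa> > 0\<close> by (intro mult_left_mono powr_mono2) auto
  also have "\<dots> = D * Y powr ((1 - 1 / r) * \<kappa>)"
    by (simp add: D_def powr_mult powr_powr flip: c_def)
  finally have "Y \<le> D * Y powr ((1 - 1 / r) * \<kappa>)" .
  moreover have "(1 - 1 / r) * \<kappa> < 1"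
    using \<open>Q - 2 * r > 0\<close> \<open>Q - 2 > 0\<close> r by (simp add: \<kappa>_def field_simps)
  ultimately have YD: "Y \<le> D powr (1 / (1 - (1 - 1 / r) * \<kappa>))"
    using \<open>0 \<le> Y\<close> \<open>D \<ge> 0\<close> by (intro power_absorb) auto
  have "(\<integral>\<^sup>+X. ennreal (w X powr s) \<partial>?M) = (\<integral>\<^sup>+X. ennreal (\<tau> X powr s) \<partial>?M)"
    by (rule nn_integral_cong_AE)
       (use sol in \<open>auto simp: approx_solution_def \<tau>_def elim!: eventually_mono\<close>)
  also have "\<dots> = ennreal Y"
    unfolding Y_def by (intro nn_integral_eq_integral Y) auto
  finally show ?thesis using YD by (simp add: ennreal_leI)
qed

text \<open>For \<open>\<gamma> = (\<nu> + 1) / 2\<close> the right-hand side of the energy estimate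
  is the integral of \<open>f\<close> over \<open>w n > k\<close>. On \<open>w n > h\<close> the
  excess over a lower level \<open>k\<close> is at least \<open>h - k\<close>, so a Chebyshev factor
  and Holder's inequality bound this integral at level \<open>h\<close> by a power of the integral
  at level \<open>k\<close>. The resulting power \<open>\<theta> * \<kappa>\<close> exceeds 1
  exactly because \<open>r > Q / 2\<close>, and \<open>stampacchia\<close> applies.\<close>

lemma approx_solutions_uniformly_bounded:
  fixes w :: "nat \<Rightarrow> 'm::finite point \<Rightarrow> real" and f :: "'m point \<Rightarrow> real" and lam Q r \<nu> :: real
  assumes \<Omega>: "open \<Omega>" "bounded \<Omega>" and "lam \<ge> 0" and Q: "Q = 1 + (1 + lam) * CARD('m)" "Q > 2"
    and sol: "\<And>n. n \<ge> 1 \<Longrightarrow> approx_solution lam \<nu> \<Omega> f n (w n)" and "\<nu> > 1"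
    and f: "integrable (lebesgue_on \<Omega>) f" "AE X in lebesgue_on \<Omega>. 0 \<le> f X"
    and fr: "integrable (lebesgue_on \<Omega>) (\<lambda>X. f X powr r)"
    and r: "1 \<le> r" "Q / 2 < r"
  obtains d where "\<And>n. n \<ge> 1 \<Longrightarrow> AE X in lebesgue_on \<Omega>. w n X \<le> d"
proof -
  let ?M = "lebesgue_on \<Omega>" and ?S = "sobolev_const CARD('m) Q"
  define \<gamma> where "\<gamma> = (\<nu> + 1) / 2"
  define \<kappa> where "\<kappa> = Q / (Q - 2)"
  define \<theta> where "\<theta> = 1 - 1 / r"
  define p where "p = \<gamma> * (2 * Q / (Q - 2))"
  define c where "c = 2 * \<gamma>\<^sup>2 / (2 * \<gamma> - 1)"
  define A where "A = (\<integral>X. f X powr r \<partial>?M) powr (1 / r)"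
  have "\<gamma> > 1" using \<open>\<nu> > 1\<close> by (simp add: \<gamma>_def)
  have "\<kappa> > 0" "p > 0" "c > 0" "0 \<le> A" using \<open>\<gamma> > 1\<close> \<open>Q > 2\<close> by (auto simp: \<kappa>_def p_def c_def A_def)
  have "\<theta> > 0" using r Q by (simp add: \<theta>_def)
  have \<theta>\<kappa>: "\<theta> * \<kappa> > 1"
    using r Q(2) by (simp add: \<theta>_def \<kappa>_def field_simps)
  have S0: "0 \<le> ?S" by (simp add: sobolev_const_def)
  have [measurable]: "f \<in> borel_measurable ?M" using f by auto
  define M0 where "M0 = ?S * (c * (\<integral>X. f X \<partial>?M)) powr \<kappa>"
  define D where "D = ?S * (c * A) powr \<kappa>"
  have "0 \<le> D" "0 \<le> M0" using S0 by (simp_all add: D_def M0_def)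
  have "0 < p * \<theta> * \<kappa>" using \<open>p > 0\<close> \<open>\<theta> > 0\<close> \<open>\<kappa> > 0\<close> by simp
  then obtain d where "d > 0" and d: "\<And>Y. (\<And>k. 0 \<le> Y k) \<Longrightarrow> antimono Y \<Longrightarrow> Y 0 \<le> M0 \<Longrightarrow>
      (\<And>h k. 0 \<le> k \<Longrightarrow> k < h \<Longrightarrow> Y h \<le> D * (h - k) powr (- (p * \<theta> * \<kappa>)) * Y k powr (\<theta> * \<kappa>)) \<Longrightarrow> Y d = (0::real)"
    using stampacchia[OF \<open>0 \<le> D\<close> \<open>0 \<le> M0\<close> _ \<theta>\<kappa>] by blast
  have "AE X in ?M. w n X \<le> d" if "n \<ge> 1" for n
  proof -
    have [measurable]: "w n \<in> borel_measurable ?M"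
      using sol[OF that] by (auto simp: approx_solution_def Linfty_def)
    define \<tau> where "\<tau> k X = max 0 (w n X - k)" for k X
    have \<tau>0: "0 \<le> \<tau> k X" for k X by (simp add: \<tau>_def)
    have \<tau>_meas [measurable]: "\<tau> k \<in> borel_measurable ?M" for k unfolding \<tau>_def by measurable
    \<comment> \<open>The estimates are available only for nonnegative levels, while
      \<open>stampacchia\<close> asks for a monotone function on the whole line; hence
      \<open>max 0 k\<close>.\<close>
    define Y where "Y k = (\<integral>X. \<tau> (max 0 k) X powr p \<partial>?M)" for k
    \<comment> \<open>\<open>\<tau> k X powr 0\<close> is the indicator of \<open>w n X > k\<close>,
      since \<open>0 powr 0\<close> is 0.\<close>
    define I where "I k = (\<integral>X. f X * \<tau> k X powr 0 \<partial>?M)" for k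
    have est: "integrable ?M (\<lambda>X. f X * \<tau> k X powr 0)"
      "(\<integral>\<^sup>+X. ennreal (\<tau> k X powr p) \<partial>?M) \<le> ennreal (?S * (c * I k) powr \<kappa>)" if "k \<ge> 0" for k
    proof -
      have e0: "2 * \<gamma> - 1 - \<nu> = 0" by (simp add: \<gamma>_def field_simps)
      show "integrable ?M (\<lambda>X. f X * \<tau> k X powr 0)"
        "(\<integral>\<^sup>+X. ennreal (\<tau> k X powr p) \<partial>?M) \<le> ennreal (?S * (c * I k) powr \<kappa>)"
        using power_energy_estimate[OF \<Omega> \<open>lam \<ge> 0\<close> Q sol[OF \<open>n \<ge> 1\<close>] \<open>n \<ge> 1\<close> f that \<open>\<gamma> > 1\<close>] \<open>\<nu> > 1\<close> e0
        unfolding \<tau>_def p_def \<kappa>_def c_def I_def by (auto simp: e0)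
    qed
    have int: "integrable ?M (\<lambda>X. \<tau> k X powr p)"
      and Y_le: "(\<integral>X. \<tau> k X powr p \<partial>?M) \<le> ?S * (c * I k) powr \<kappa>" if "k \<ge> 0" for k
      using integrable_of_nn_integral_le[OF _ _ _ est(2)[OF that]] S0 by auto
    have I0: "0 \<le> I k" for k
      unfolding I_def by (rule integral_nonneg_AE) (use f(2) in \<open>auto elim: eventually_mono\<close>)
    have "Y d = 0"
    proof (rule d)
      show "0 \<le> Y k" for k by (simp add: Y_def)
      show "antimono Y"
      proof (rule antimonoI)
        fix k h :: real assume "k \<le> h"
        show "Y h \<le> Y k"
          unfolding Y_def
        proof (rule integral_mono)
          show "\<tau> (max 0 h) X powr p \<le> \<tau> (max 0 k) X powr p" for X
            using \<open>k \<le> h\<close> \<open>p > 0\<close> by (intro powr_mono2) (auto simp: \<tau>_def)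
        qed (auto intro: int)
      qed
      \<comment> \<open>The starting value is controlled by the integral of \<open>f\<close> alone,
        so \<open>M0\<close>, and with it \<open>d\<close>, is the same for all
        \<open>n\<close>.\<close>
      have "I 0 \<le> (\<integral>X. f X \<partial>?M)"
        unfolding I_def
        by (rule integral_mono_AE[OF est(1) f(1)]) (use f(2) in \<open>auto elim!: eventually_mono simp: powr_def\<close>)
      then have "?S * (c * I 0) powr \<kappa> \<le> M0"
        unfolding M0_def using S0 \<open>c > 0\<close> \<open>\<kappa> > 0\<close> I0 by (intro mult_left_mono powr_mono2) auto
      then show "Y 0 \<le> M0" using Y_le[of 0] by (simp add: Y_def)
      fix h k :: real assume hk: "0 \<le> k" "k < h"
      have Yk: "Y k = (\<integral>X. \<tau> k X powr p \<partial>?M)" "Y h = (\<integral>X. \<tau> h X powr p \<partial>?M)"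
        using hk by (simp_all add: Y_def)
      have "I h \<le> (\<integral>X. (h - k) powr (- (p * \<theta>)) * (f X * (\<tau> k X powr p) powr \<theta>) \<partial>?M)"
        unfolding I_def
      proof (rule integral_mono_AE)
        show "integrable ?M (\<lambda>X. f X * \<tau> h X powr 0)" using est(1) hk by simp
        show "integrable ?M (\<lambda>X. (h - k) powr (- (p * \<theta>)) * (f X * (\<tau> k X powr p) powr \<theta>))"
          unfolding \<theta>_def using f fr r int[OF hk(1)]
          by (intro integrable_mult_right integral_powr_Holder(1)) auto
        show "AE X in ?M. f X * \<tau> h X powr 0 \<le> (h - k) powr (- (p * \<theta>)) * (f X * (\<tau> k X powr p) powr \<theta>)"
          using f(2)
        proof eventually_elim
          case (elim X)
          show ?case
          proof (cases "\<tau> h X = 0")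
            \<comment> \<open>Here \<open>w n X > h\<close>, so the excess over \<open>k\<close> is
              at least \<open>h - k\<close> and the Chebyshev factor is at least 1.\<close>
            case False
            then have "h - k \<le> \<tau> k X" by (auto simp: \<tau>_def max_def split: if_splits)
            then have "(h - k) powr (p * \<theta>) \<le> \<tau> k X powr (p * \<theta>)"
              using hk \<open>p > 0\<close> \<open>\<theta> > 0\<close> by (intro powr_mono2) auto
            then have "1 \<le> (h - k) powr (- (p * \<theta>)) * \<tau> k X powr (p * \<theta>)"
              using hk by (simp add: powr_minus field_simps)
            then have "f X * 1 \<le> f X * ((h - k) powr (- (p * \<theta>)) * \<tau> k X powr (p * \<theta>))"
              using elim by (intro mult_left_mono) auto
            then show ?thesis using False by (simp add: powr_powr mult.left_commute)
          qed (use elim in simp)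
        qed
      qed
      also have "\<dots> = (h - k) powr (- (p * \<theta>)) * (\<integral>X. f X * (\<tau> k X powr p) powr \<theta> \<partial>?M)"
        by simp
      also have "\<dots> \<le> (h - k) powr (- (p * \<theta>)) * (A * Y k powr \<theta>)"
        unfolding A_def \<theta>_def Yk(1) using f fr r int[OF hk(1)]
        by (intro mult_left_mono integral_powr_Holder(2)) auto
      finally have Ih: "I h \<le> (h - k) powr (- (p * \<theta>)) * (A * Y k powr \<theta>)" .
      have "Y h \<le> ?S * (c * I h) powr \<kappa>" using Y_le[of h] hk Yk by simp
      also have "\<dots> \<le> ?S * (c * ((h - k) powr (- (p * \<theta>)) * (A * Y k powr \<theta>))) powr \<kappa>"
        using Ih I0 S0 \<open>c > 0\<close> \<open>\<kappa> > 0\<close> by (intro mult_left_mono powr_mono2) auto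
      also have "\<dots> = D * (h - k) powr (- (p * \<theta> * \<kappa>)) * Y k powr (\<theta> * \<kappa>)"
        by (simp add: D_def powr_mult powr_powr)
      finally show "Y h \<le> D * (h - k) powr (- (p * \<theta> * \<kappa>)) * Y k powr (\<theta> * \<kappa>)" .
    qed
    then have "(\<integral>X. \<tau> d X powr p \<partial>?M) = 0" using \<open>d > 0\<close> by (simp add: Y_def)
    then have "AE X in ?M. \<tau> d X powr p = 0"
      using integral_nonneg_eq_0_iff_AE[OF int[of d]] \<open>d > 0\<close> by simp
    then show ?thesis by eventually_elim (auto simp: \<tau>_def max_def split: if_splits)
  qed
  then show thesis by (rule that)
qed

section \<open>Passage to the limit in the approximating problems\<close>

theorem theorem3p4:
  fixes \<Omega> :: "(real \<times> (real ^ 'm::finite)) set"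
    and f u :: "real \<times> (real ^ 'm) \<Rightarrow> real"
    and un :: "nat \<Rightarrow> real \<times> (real ^ 'm) \<Rightarrow> real"
    and lam \<nu> r Q :: real
  assumes "lam \<ge> 1" and "\<nu> > 1" and "r \<ge> 1"
    and "Q = (real CARD('m) + 1) + lam * real CARD('m)"
    and "open \<Omega>" and "bounded \<Omega>" and "Lambda_connected lam \<Omega>"
    and "f \<in> Lp r \<Omega>"
    and "AE X in lebesgue_on \<Omega>. 0 \<le> f X"
    and "\<not> (AE X in lebesgue_on \<Omega>. f X = 0)"
    and "\<And>n. n \<ge> 1 \<Longrightarrow> approx_solution lam \<nu> \<Omega> f n (un n)"
    and "AE X in lebesgue_on \<Omega>. (\<lambda>n. un n X) \<longlonglongrightarrow> u X"
    and "weak_solution lam \<nu> \<Omega> f u"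
  shows "(r > Q / 2 \<longrightarrow> u \<in> Linfty \<Omega>) \<and>
         (r < Q / 2 \<longrightarrow> u \<in> Lp (Q * r * (\<nu> + 1) / (Q - 2 * r)) \<Omega>)"
proof -
  let ?M = "lebesgue_on \<Omega>"
  interpret finite_measure ?M
    using \<open>open \<Omega>\<close> \<open>bounded \<Omega>\<close> by (rule finite_measure_lebesgue_on)
  have Q: "Q = 1 + (1 + lam) * CARD('m)" using assms by (simp add: algebra_simps)
  \<comment> \<open>With \<open>lam \<ge> 1\<close> and at least one vertical variable,
    \<open>Q \<ge> 3\<close>; the Sobolev exponent is thus meaningful.\<close>
  have "(1 + 1) * 1 \<le> (1 + lam) * real CARD('m)"
    using \<open>lam \<ge> 1\<close> by (intro mult_mono) (auto simp: Suc_le_eq)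
  then have "Q > 2" using Q by simp
  have "lam \<ge> 0" using \<open>lam \<ge> 1\<close> by simp
  have f_meas [measurable]: "f \<in> borel_measurable ?M"
    and "integrable ?M (\<lambda>X. \<bar>f X\<bar> powr r)"
    using \<open>f \<in> Lp r \<Omega>\<close> by (auto simp: Lp_def)
  have fr: "integrable ?M (\<lambda>X. f X powr r)"
    by (rule integrable_cong_AE_imp[OF \<open>integrable ?M (\<lambda>X. \<bar>f X\<bar> powr r)\<close>])
       (use assms(9) in \<open>auto elim!: eventually_mono\<close>)
  \<comment> \<open>On a finite measure space \<open>f \<le> 1 + f powr r\<close> reduces
    integrability to that of \<open>f powr r\<close>.\<close>
  have f: "integrable ?M f"
  proof (rule Bochner_Integration.integrable_bound)
    show "integrable ?M (\<lambda>X. 1 + f X powr r)" using fr by simp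
    show "AE X in ?M. norm (f X) \<le> norm (1 + f X powr r)"
      using \<open>AE X in ?M. 0 \<le> f X\<close>
    proof eventually_elim
      case (elim X)
      show ?case
      proof (cases "f X \<le> 1")
        case False
        then have "f X powr 1 \<le> f X powr r" using \<open>r \<ge> 1\<close> by (intro powr_mono) auto
        then show ?thesis using False by simp
      qed (use elim in \<open>simp add: add_increasing2\<close>)
    qed
  qed measurable
  note sol = assms(11)
  \<comment> \<open>\<open>un 0\<close> is unconstrained, so the sequence is used from index 1 on,
    through \<open>Suc\<close>.\<close>
  have un_meas [measurable]: "un (Suc n) \<in> borel_measurable ?M" for n
    using sol[of "Suc n"] by (auto simp: approx_solution_def Linfty_def)
  have lim: "AE X in ?M. (\<lambda>n. un (Suc n) X) \<longlonglongrightarrow> u X"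
    using assms(12) by eventually_elim (rule LIMSEQ_Suc)
  have "AE X in ?M. \<forall>n. 0 \<le> un (Suc n) X"
    using sol by (auto simp: AE_all_countable approx_solution_def)
  then have un0: "AE X in ?M. 0 \<le> u X"
    using lim by eventually_elim (rule LIMSEQ_le_const, auto)
  \<comment> \<open>The pointwise \<open>lim\<close> is measurable everywhere and agrees with
    \<open>u\<close> only almost everywhere.\<close>
  have u_meas: "u \<in> borel_measurable ?M"
  proof (rule borel_measurable_lebesgue_on_AE)
    show "\<Omega> \<in> sets lebesgue" using \<open>open \<Omega>\<close> by (simp add: sets_completionI_sets)
    show "(\<lambda>X. lim (\<lambda>n. un (Suc n) X)) \<in> borel_measurable ?M" by measurable
    show "AE X in ?M. lim (\<lambda>n. un (Suc n) X) = u X"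
      using lim by eventually_elim (rule limI)
  qed
  show ?thesis
  proof (intro conjI impI)
    assume "r > Q / 2"
    then obtain d where d: "\<And>n. n \<ge> 1 \<Longrightarrow> AE X in ?M. un n X \<le> d"
      using approx_solutions_uniformly_bounded[OF \<open>open \<Omega>\<close> \<open>bounded \<Omega>\<close> \<open>lam \<ge> 0\<close> Q \<open>Q > 2\<close> sol \<open>\<nu> > 1\<close>
          f assms(9) fr \<open>r \<ge> 1\<close>] by blast
    \<comment> \<open>The bound \<open>d\<close> is common to all \<open>n\<close>, and the
      countably many exceptional null sets are merged into one.\<close>
    have "AE X in ?M. \<forall>n. un (Suc n) X \<le> d"
      using d by (simp add: AE_all_countable)
    then have "AE X in ?M. norm (u X) \<le> d"
      using lim un0
    proof eventually_elim
      case (elim X)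
      then have "u X \<le> d" by (intro LIMSEQ_le_const2[OF elim(2)]) auto
      then show ?case using elim by simp
    qed
    then show "u \<in> Linfty \<Omega>" using u_meas by (auto simp: Linfty_def)
  next
    assume "r < Q / 2"
    let ?s = "Q * r * (\<nu> + 1) / (Q - 2 * r)"
    have "?s > 0" using \<open>r < Q / 2\<close> \<open>r \<ge> 1\<close> \<open>Q > 2\<close> \<open>\<nu> > 1\<close> by simp
    obtain B where B: "\<And>n. (\<integral>\<^sup>+X. ennreal (un (Suc n) X powr ?s) \<partial>?M) \<le> ennreal B"
      using approx_solution_integral_bound[OF \<open>open \<Omega>\<close> \<open>bounded \<Omega>\<close> \<open>lam \<ge> 0\<close> Q \<open>Q > 2\<close> _ sol \<open>\<nu> > 1\<close>
          f assms(9) fr \<open>r \<ge> 1\<close> \<open>r < Q / 2\<close>] by (metis le_add1 plus_1_eq_Suc)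
    have "(\<integral>\<^sup>+X. ennreal (norm (u X) powr ?s) \<partial>?M)
        = (\<integral>\<^sup>+X. liminf (\<lambda>n. ennreal (un (Suc n) X powr ?s)) \<partial>?M)"
    proof (rule nn_integral_cong_AE)
      show "AE X in ?M. ennreal (norm (u X) powr ?s) = liminf (\<lambda>n. ennreal (un (Suc n) X powr ?s))"
        using lim un0 \<open>AE X in ?M. \<forall>n. 0 \<le> un (Suc n) X\<close>
      proof eventually_elim
        case (elim X)
        then have "(\<lambda>n. ennreal (un (Suc n) X powr ?s)) \<longlonglongrightarrow> ennreal (u X powr ?s)"
          using \<open>?s > 0\<close> by (intro tendsto_ennrealI tendsto_powr' tendsto_const) auto
        then have "liminf (\<lambda>n. ennreal (un (Suc n) X powr ?s)) = ennreal (u X powr ?s)"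
          by (intro lim_imp_Liminf) auto
        then show ?case using elim by simp
      qed
    qed
    \<comment> \<open>Fatou's lemma transfers the bound \<open>B\<close>, which is uniform in
      \<open>n\<close>, to the limit.\<close>
    also have "\<dots> \<le> liminf (\<lambda>n. \<integral>\<^sup>+X. ennreal (un (Suc n) X powr ?s) \<partial>?M)"
      by (rule nn_integral_liminf) measurable
    also have "\<dots> \<le> liminf (\<lambda>n. ennreal B)"
      by (intro Liminf_mono always_eventually allI B)
    also have "\<dots> < \<infinity>" by (simp add: Liminf_const)
    finally have "integrable ?M (\<lambda>X. norm (u X) powr ?s)"
      using u_meas by (intro integrableI_nonneg) auto
    then show "u \<in> Lp ?s \<Omega>" using u_meas by (simp add: Lp_def)
  qed
qed

end
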